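(* (a) For all absolutely successful General Entanglement Purification Protocols with parameter $\langle N,K,M,\epsilon,\delta\rangle$ (where $N\ge 2$), the following inequality holds: $$\delta\ \ge\ \frac{M-K}{M}\cdot\frac{N}{N-1}\,\epsilon .$$ (b) The bound in (a) is tight: for any integers $N,M,K$ (with $N\ge 2$) such that $NK/M$ and $M/K$ are both integers, there exists an absolutely successful General Entanglement Purification Protocol with parameter $$\Big\langle N,\,K,\,M,\,\epsilon,\ \frac{M-K}{M}\cdot\frac{N}{N-1}\,\epsilon\Big\rangle .$$
   Context: Let $\mathcal H_T$ be a $T$-dimensional complex Hilbert space with computational basis $|0\rangle,\dots,|T-1\rangle$. In a bipartite system $\mathcal H_T^A\otimes\mathcal H_T^B$ (first factor held by Alice, second by Bob) put $\Psi_T=\frac1{\sqrt T}\sum_{i=0}^{T-1}|i\rangle^A|i\rangle^B$. The fidelity of a (mixed) state $\rho$ on $\mathcal H_T^A\otimes\mathcal H_T^B$ is $F(\rho)=\langle\Psi_T|\rho|\Psi_T\rangle$. A General Entanglement Purification Protocol (GEPP) $\mathcal P$ with dimensions $N,K,M$ receives an unknown state $\rho$ on $\mathcal H_N^A\otimes\mathcal H_N^B$ together with the auxiliary state $\Psi_K$ on $\mathcal H_K^A\otimes\mathcal H_K^B$. Alice and Bob apply only local operations (local unitaries, local ancillas, local measurements, discarding of local subsystems, classical randomness) and classical communication (LOCC). At the end they either output the symbol FAIL (written $\mathcal P(\rho)=\mathrm{FAIL}$) or output a (possibly mixed) state $\mathcal P(\rho)$ on $\mathcal H_M^A\otimes\mathcal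 H_M^B$. The result $\mathcal P(\rho)$ is random, depending on the classical random choices and measurement outcomes that are retained; when such classical information is discarded, the output is the corresponding averaged mixed state. The protocol does not depend on $\rho$. $\mathcal P$ is absolutely successful with parameter $\langle N,K,M,\epsilon,\delta\rangle$ if for all states $\rho$ with $F(\rho)\ge 1-\epsilon$: $\Pr[\mathcal P(\rho)=\mathrm{FAIL}]=0$ and $\Pr[F(\mathcal P(\rho))\ge 1-\delta]=1$.
   Formalization: Part (a) is proved for ε ≥ 0 and, when K < M, for ε ≤ 1 − 1/N; outside this range it is false (no admissible ρ if ε < 0; ignoring ρ and outputting Ψ_K gives δ = (M−K)/M). Protocols have finitely many rounds, outcomes and random choices. *)

theory Defs
  imports "Jordan_Normal_Form.Schur_Decomposition"
begin

section \<open>Bipartite states\<close>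

definition kron :: "complex mat \<Rightarrow> complex mat \<Rightarrow> complex mat" where
  "kron A B = mat (dim_row A * dim_row B) (dim_col A * dim_col B)
     (\<lambda>(i, j). A $$ (i div dim_row B, j div dim_col B) * B $$ (i mod dim_row B, j mod dim_col B))"

definition mtrace :: "complex mat \<Rightarrow> complex" where
  "mtrace A = (\<Sum>i<dim_row A. A $$ (i, i))"

text \<open>Positivity uses the order of \<^theory>\<open>HOL-Library.Complex_Order\<close>, so that the
  quadratic form is required to be real and nonnegative; hermiticity follows.\<close>

definition density :: "nat \<Rightarrow> complex mat \<Rightarrow> bool" where
  "density n \<rho> \<longleftrightarrow> \<rho> \<in> carrier_mat n n \<and> (\<forall>v\<in>carrier_vec n. (\<rho> *\<^sub>v v) \<bullet>c v \<ge> 0) \<and> mtrace \<rho> = 1"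

definition ket :: "nat \<Rightarrow> nat \<Rightarrow> complex mat" where
  "ket e k = mat e 1 (\<lambda>(i, j). if i = k then 1 else 0)"

text \<open>The basis vector with Alice in state i and Bob in state j of local dimension T has
  index i * T + j, in agreement with \<^const>\<open>kron\<close>.\<close>

definition max_ent :: "nat \<Rightarrow> complex vec" where
  "max_ent T = vec (T * T) (\<lambda>k. if k div T = k mod T then complex_of_real (1 / sqrt (real T)) else 0)"

definition max_ent_proj :: "nat \<Rightarrow> complex mat" where
  "max_ent_proj T = mat (T * T) (T * T) (\<lambda>(i, j). max_ent T $ i * cnj (max_ent T $ j))"

definition fidelity :: "nat \<Rightarrow> complex mat \<Rightarrow> real" where
  "fidelity T \<rho> = Re ((\<rho> *\<^sub>v max_ent T) \<bullet>c max_ent T)"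

text \<open>The input of a protocol is the tensor product of the given state with the auxiliary
  maximally entangled state, with the factors regrouped from (A B)(A' B') to (A A')(B B'):
  for indices a, b below N and k, l below K, regrouping sends the index of
  (a, k, b, l) to that of (a, b, k, l).\<close>

definition regroup :: "nat \<Rightarrow> nat \<Rightarrow> nat \<Rightarrow> nat" where
  "regroup N K i =
    (let x = i div (N * K); y = i mod (N * K);
         a = x div K; k = x mod K; b = y div K; l = y mod K
     in (a * N + b) * (K * K) + (k * K + l))"

definition joint_input :: "nat \<Rightarrow> nat \<Rightarrow> complex mat \<Rightarrow> complex mat" where
  "joint_input N K \<rho> = mat (N * K * (N * K)) (N * K * (N * K))
     (\<lambda>(i, j). kron \<rho> (max_ent_proj K) $$ (regroup N K i, regroup N K j))"


section \<open>LOCC protocols\<close>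

datatype party = Alice | Bob

text \<open>A protocol is a finite tree. Every step may depend on the whole past of random choices
  and measurement outcomes of both parties; this is the classical communication. The label of
  an output is the classical information that is retained at the end, and output branches
  that carry the same label are averaged.\<close>

datatype gepp =
    Fail
  | Output nat
  | Unitary party "complex mat" gepp
  | Ancilla party nat gepp
  | Discard party nat gepp
  | Measure party "(complex mat \<times> gepp) list"
  | Random "(real \<times> gepp) list"

definition unitary_mat :: "nat \<Rightarrow> complex mat \<Rightarrow> bool" where
  "unitary_mat n U \<longleftrightarrow> U \<in> carrier_mat n n \<and> mat_adjoint U * U = 1\<^sub>m n \<and> U * mat_adjoint U = 1\<^sub>m n"

definition mat_sum :: "nat \<Rightarrow> complex mat list \<Rightarrow> complex mat" where
  "mat_sum n As = foldr (+) As (0\<^sub>m n n)"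

text \<open>The measurement operators E are general, with the sum of the E* E equal to the identity;
  projective measurements are a special case.\<close>

definition measurement :: "nat \<Rightarrow> complex mat list \<Rightarrow> bool" where
  "measurement n Es \<longleftrightarrow>
     set Es \<subseteq> carrier_mat n n \<and> mat_sum n (map (\<lambda>E. mat_adjoint E * E) Es) = 1\<^sub>m n"

definition distribution :: "real list \<Rightarrow> bool" where
  "distribution ps \<longleftrightarrow> (\<forall>p\<in>set ps. 0 \<le> p) \<and> sum_list ps = 1"

text \<open>Well-formedness relative to the current local dimensions d and the output dimension M.\<close>

fun wf_gepp :: "nat \<Rightarrow> (party \<Rightarrow> nat) \<Rightarrow> gepp \<Rightarrow> bool" where
  "wf_gepp M d Fail \<longleftrightarrow> True"
| "wf_gepp M d (Output l) \<longleftrightarrow> d Alice = M \<and> d Bob = M"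
| "wf_gepp M d (Unitary q U P) \<longleftrightarrow> unitary_mat (d q) U \<and> wf_gepp M d P"
| "wf_gepp M d (Ancilla q e P) \<longleftrightarrow> 0 < e \<and> wf_gepp M (d(q := d q * e)) P"
| "wf_gepp M d (Discard q e P) \<longleftrightarrow> 0 < e \<and> e dvd d q \<and> wf_gepp M (d(q := d q div e)) P"
| "wf_gepp M d (Measure q bs) \<longleftrightarrow>
     measurement (d q) (map fst bs) \<and> (\<forall>b\<in>set bs. wf_gepp M d (snd b))"
| "wf_gepp M d (Random bs) \<longleftrightarrow>
     distribution (map fst bs) \<and> (\<forall>b\<in>set bs. wf_gepp M d (snd b))"

definition apply_local :: "party \<Rightarrow> (party \<Rightarrow> nat) \<Rightarrow> complex mat \<Rightarrow> complex mat \<Rightarrow> complex mat" where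
  "apply_local q d X \<sigma> =
    (let Y = kron (if q = Alice then X else 1\<^sub>m (d Alice)) (if q = Bob then X else 1\<^sub>m (d Bob))
     in Y * \<sigma> * mat_adjoint Y)"

text \<open>An ancilla of dimension e is appended, in basis state 0, as the last tensor factor of the
  local system; discarding traces out the last tensor factor of dimension e.\<close>

definition add_ancilla :: "party \<Rightarrow> nat \<Rightarrow> (party \<Rightarrow> nat) \<Rightarrow> complex mat \<Rightarrow> complex mat" where
  "add_ancilla q e d \<sigma> = apply_local q d (kron (1\<^sub>m (d q)) (ket e 0)) \<sigma>"

definition discard_factor :: "party \<Rightarrow> nat \<Rightarrow> (party \<Rightarrow> nat) \<Rightarrow> complex mat \<Rightarrow> complex mat" where
  "discard_factor q e d \<sigma> =
    (let d' = d(q := d q div e)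
     in mat_sum (d' Alice * d' Bob)
          (map (\<lambda>k. apply_local q d (kron (1\<^sub>m (d' q)) (mat_adjoint (ket e k))) \<sigma>) [0..<e]))"

text \<open>Running a protocol lists its branches, each with its outcome (\<^const>\<open>None\<close> for FAIL, or the
  output label) and its unnormalised state, whose trace is the probability of the branch.\<close>

fun run :: "(party \<Rightarrow> nat) \<Rightarrow> gepp \<Rightarrow> complex mat \<Rightarrow> (nat option \<times> complex mat) list" where
  "run d Fail \<sigma> = [(None, \<sigma>)]"
| "run d (Output l) \<sigma> = [(Some l, \<sigma>)]"
| "run d (Unitary q U P) \<sigma> = run d P (apply_local q d U \<sigma>)"
| "run d (Ancilla q e P) \<sigma> = run (d(q := d q * e)) P (add_ancilla q e d \<sigma>)"
| "run d (Discard q e P) \<sigma> = run (d(q := d q div e)) P (discard_factor q e d \<sigma>)"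
| "run d (Measure q bs) \<sigma> = concat (map (\<lambda>b. run d (snd b) (apply_local q d (fst b) \<sigma>)) bs)"
| "run d (Random bs) \<sigma> = concat (map (\<lambda>b. run d (snd b) (complex_of_real (fst b) \<cdot>\<^sub>m \<sigma>)) bs)"


section \<open>Absolutely successful protocols\<close>

definition is_gepp :: "nat \<Rightarrow> nat \<Rightarrow> nat \<Rightarrow> gepp \<Rightarrow> bool" where
  "is_gepp N K M P \<longleftrightarrow> wf_gepp M (\<lambda>_. N * K) P"

definition branches :: "nat \<Rightarrow> nat \<Rightarrow> gepp \<Rightarrow> complex mat \<Rightarrow> (nat option \<times> complex mat) list" where
  "branches N K P \<rho> = run (\<lambda>_. N * K) P (joint_input N K \<rho>)"

definition outcome_prob :: "nat \<Rightarrow> nat \<Rightarrow> gepp \<Rightarrow> complex mat \<Rightarrow> nat option \<Rightarrow> real" where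
  "outcome_prob N K P \<rho> r = (\<Sum>b\<leftarrow>filter (\<lambda>b. fst b = r) (branches N K P \<rho>). Re (mtrace (snd b)))"

text \<open>The normalised average of all branches with label l (a junk value if the probability is 0).\<close>

definition output_state :: "nat \<Rightarrow> nat \<Rightarrow> nat \<Rightarrow> gepp \<Rightarrow> complex mat \<Rightarrow> nat \<Rightarrow> complex mat" where
  "output_state N K M P \<rho> l =
     complex_of_real (1 / outcome_prob N K P \<rho> (Some l)) \<cdot>\<^sub>m
       mat_sum (M * M) (map snd (filter (\<lambda>b. fst b = Some l) (branches N K P \<rho>)))"

definition prob_fail :: "nat \<Rightarrow> nat \<Rightarrow> gepp \<Rightarrow> complex mat \<Rightarrow> real" where
  "prob_fail N K P \<rho> = outcome_prob N K P \<rho> None"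

definition prob_fidelity_ge :: "nat \<Rightarrow> nat \<Rightarrow> nat \<Rightarrow> gepp \<Rightarrow> complex mat \<Rightarrow> real \<Rightarrow> real" where
  "prob_fidelity_ge N K M P \<rho> t =
     (\<Sum>l | Some l \<in> fst ` set (branches N K P \<rho>) \<and> fidelity M (output_state N K M P \<rho> l) \<ge> t.
        outcome_prob N K P \<rho> (Some l))"

definition absolutely_successful :: "nat \<Rightarrow> nat \<Rightarrow> nat \<Rightarrow> real \<Rightarrow> real \<Rightarrow> gepp \<Rightarrow> bool" where
  "absolutely_successful N K M \<epsilon> \<delta> P \<longleftrightarrow>
     is_gepp N K M P \<and>
     (\<forall>\<rho>. density (N * N) \<rho> \<and> fidelity N \<rho> \<ge> 1 - \<epsilon> \<longrightarrow>
        prob_fail N K P \<rho> = 0 \<and> prob_fidelity_ge N K M P \<rho> (1 - \<delta>) = 1)"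

end

(* Lower bound: feed the protocol the mixture (1 - p) Psi + p |00><00| with p = N/(N-1) epsilon, whose
   fidelity is 1 - epsilon. Local operations and classical communication never raise the Schmidt number, so
   the second component, which starts with Schmidt number at most K because of the auxiliary state, reaches
   fidelity at most K/M; averaging over all branches gives 1 - delta <= (1 - p) + p K/M.

   Tightness: with M = m K and N = m n, both parties partition the N basis states into n blocks of size m,
   chosen uniformly at random, and measure the block. If the blocks agree they keep the position in the block
   together with the auxiliary state; otherwise they reset the position to |0>, which has fidelity 1/m. Since
   any two distinct basis states share a block with probability (m-1)/(N-1), the expected fidelity is an
   affine function of the input fidelity alone, and no further twirling is needed. *)

theory Submission
  imports Defs "HOL-Analysis.Convex" "HOL-Combinatorics.Permutations"
begin

section \<open>Matrices\<close>

text \<open>The success condition speaks of normalised output states, one per label, which are not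
  linear in the input. Weighting each fidelity by its probability removes the normalisation: the sum
  of the fidelities of the unnormalised branches is linear, is at least 1 - \<delta> on every test
  mixture, and can be bounded separately on the two components. The constant N/(N-1) arises because
  |00> still has fidelity 1/N, so weight p costs only p (1 - 1/N); the restriction on \<epsilon> for
  K < M keeps p at most 1. The ratio K/M is a fact about matrices: the overlap of a vector with the
  maximally entangled state is the trace of its coefficient matrix over sqrt M, and |tr A|^2 \<le> K
  |A|^2 for rank at most K.

  For tightness all branches share one label, so only the expected fidelity matters. The coherence
  between |aa> and |bb> survives when a and b share a block, which for distinct a, b has probability
  q = (m-1)/(N-1); pairs in different blocks contribute only their populations. The average is (q N
  F + 1 - q)/m, which equals 1 at F = 1 because q (N-1) = m - 1.\<close>

lemma sum_lessThan_mult: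
  fixes f :: "nat \<Rightarrow> 'a::comm_monoid_add"
  shows "(\<Sum>i<m * n. f i) = (\<Sum>a<m. \<Sum>b<n. f (a * n + b))"
proof -
  have "(\<Sum>i<m * n. f i) = (\<Sum>a<m. sum f {a * n..<a * n + n})"
    by (simp add: sum.nat_group)
  also have "\<dots> = (\<Sum>a<m. \<Sum>b<n. f (a * n + b))"
  proof (rule sum.cong[OF refl])
    fix a
    show "sum f {a * n..<a * n + n} = (\<Sum>b<n. f (a * n + b))"
      using sum.shift_bounds_nat_ivl[of f 0 "a * n" n]
      by (simp add: add.commute atLeast0LessThan)
  qed
  finally show ?thesis .
qed

lemma pair_index_less: "a < (m::nat) \<Longrightarrow> b < n \<Longrightarrow> a * n + b < m * n"
  by (metis Suc_leI add.commute add_less_cancel_left less_le_trans mult_Suc mult_le_mono1)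

lemma div_less_of_mult: "i < m * n \<Longrightarrow> i div n < (m::nat)"
  by (simp add: less_mult_imp_div_less)

lemma mod_less_of_mult: "i < m * n \<Longrightarrow> i mod n < (n::nat)"
  by (cases n) auto

lemma pair_index_div_mod: "b < n \<Longrightarrow> (a * n + b) div n = (a::nat)" "b < n \<Longrightarrow> (a * n + b) mod n = b"
  by auto

section \<open>Adjoints and Kronecker products\<close>

lemma adjoint_carrier [simp]: "A \<in> carrier_mat m n \<Longrightarrow> mat_adjoint A \<in> carrier_mat n m"
  unfolding mat_adjoint_def by (auto simp: mat_of_rows_def)

lemma dim_adjoint [simp]: "dim_row (mat_adjoint A) = dim_col A" "dim_col (mat_adjoint A) = dim_row A"
  unfolding mat_adjoint_def by (auto simp: mat_of_rows_def)

lemma index_adjoint [simp]: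
  fixes A :: "complex mat"
  shows "i < dim_col A \<Longrightarrow> j < dim_row A \<Longrightarrow> mat_adjoint A $$ (i, j) = cnj (A $$ (j, i))"
  unfolding mat_adjoint_def by (auto simp: mat_of_rows_def)

lemma adjoint_adjoint [simp]: "mat_adjoint (mat_adjoint A) = (A :: complex mat)"
  by (rule eq_matI) auto

lemma index_mult_sum:
  assumes "A \<in> carrier_mat m n" "B \<in> carrier_mat n k" "i < m" "j < k"
  shows "(A * B) $$ (i, j) = (\<Sum>r<n. A $$ (i, r) * B $$ (r, j))"
  using assms by (auto simp: scalar_prod_def atLeast0LessThan intro!: sum.cong)

lemma adjoint_mult:
  fixes A :: "complex mat"
  assumes A: "A \<in> carrier_mat m n" and B: "B \<in> carrier_mat n k"
  shows "mat_adjoint (A * B) = mat_adjoint B * mat_adjoint A"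
proof (rule eq_matI)
  fix i j assume "i < dim_row (mat_adjoint B * mat_adjoint A)" "j < dim_col (mat_adjoint B * mat_adjoint A)"
  then have i: "i < k" and j: "j < m" using A B by auto
  have "mat_adjoint (A * B) $$ (i, j) = cnj ((A * B) $$ (j, i))"
    using A B i j by (intro index_adjoint) auto
  also have "\<dots> = (\<Sum>r<n. mat_adjoint B $$ (i, r) * mat_adjoint A $$ (r, j))"
    using A B i j by (simp add: index_mult_sum[OF A B] cnj_sum mult.commute del: index_mult_mat)
  also have "\<dots> = (mat_adjoint B * mat_adjoint A) $$ (i, j)"
    using index_mult_sum[OF adjoint_carrier[OF B] adjoint_carrier[OF A] i j] by simp
  finally show "mat_adjoint (A * B) $$ (i, j) = (mat_adjoint B * mat_adjoint A) $$ (i, j)" .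
qed (use A B in auto)

lemma adjoint_one [simp]: "mat_adjoint (1\<^sub>m n :: complex mat) = 1\<^sub>m n"
  by (rule eq_matI) auto

lemma kron_carrier [simp]:
  "A \<in> carrier_mat m n \<Longrightarrow> B \<in> carrier_mat p q \<Longrightarrow> kron A B \<in> carrier_mat (m * p) (n * q)"
  by (auto simp: kron_def)

lemma dim_kron [simp]:
  "dim_row (kron A B) = dim_row A * dim_row B" "dim_col (kron A B) = dim_col A * dim_col B"
  by (auto simp: kron_def)

lemma index_kron:
  assumes "A \<in> carrier_mat m n" "B \<in> carrier_mat p q" "i < m * p" "j < n * q"
  shows "kron A B $$ (i, j) = A $$ (i div p, j div q) * B $$ (i mod p, j mod q)"
  using assms by (auto simp: kron_def)

lemma kron_mult:
  assumes A: "A \<in> carrier_mat m n" and B: "B \<in> carrier_mat p q"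
    and C: "C \<in> carrier_mat n k" and D: "D \<in> carrier_mat q r"
  shows "kron A B * kron C D = kron (A * C) (B * D)"
proof (rule eq_matI)
  fix i j assume "i < dim_row (kron (A * C) (B * D))" "j < dim_col (kron (A * C) (B * D))"
  then have i: "i < m * p" and j: "j < k * r" using A B C D by auto
  have "(kron A B * kron C D) $$ (i, j) = (\<Sum>t<n * q. kron A B $$ (i, t) * kron C D $$ (t, j))"
    by (rule index_mult_sum[OF kron_carrier[OF A B] kron_carrier[OF C D] i j])
  also have "\<dots> = (\<Sum>a<n. \<Sum>b<q. kron A B $$ (i, a * q + b) * kron C D $$ (a * q + b, j))"
    by (rule sum_lessThan_mult)
  also have "\<dots> = (\<Sum>a<n. \<Sum>b<q. (A $$ (i div p, a) * C $$ (a, j div r)) *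
        (B $$ (i mod p, b) * D $$ (b, j mod r)))"
    by (intro sum.cong refl)
       (simp add: index_kron[OF A B i] index_kron[OF C D _ j] pair_index_less)
  also have "\<dots> = (\<Sum>a<n. A $$ (i div p, a) * C $$ (a, j div r)) *
        (\<Sum>b<q. B $$ (i mod p, b) * D $$ (b, j mod r))"
    by (simp add: sum_product)
  also have "\<dots> = (A * C) $$ (i div p, j div r) * (B * D) $$ (i mod p, j mod r)"
    using index_mult_sum[OF A C div_less_of_mult[OF i] div_less_of_mult[OF j]]
      index_mult_sum[OF B D mod_less_of_mult[OF i] mod_less_of_mult[OF j]] by simp
  also have "\<dots> = kron (A * C) (B * D) $$ (i, j)"
    using index_kron[OF mult_carrier_mat[OF A C] mult_carrier_mat[OF B D] i j] by simp
  finally show "(kron A B * kron C D) $$ (i, j) = kron (A * C) (B * D) $$ (i, j)" .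
qed (use A B C D in auto)

lemma kron_adjoint: "mat_adjoint (kron A B) = kron (mat_adjoint A) (mat_adjoint B)"
proof (rule eq_matI)
  fix i j assume "i < dim_row (kron (mat_adjoint A) (mat_adjoint B))"
    "j < dim_col (kron (mat_adjoint A) (mat_adjoint B))"
  then have i: "i < dim_col A * dim_col B" and j: "j < dim_row A * dim_row B" by auto
  then show "mat_adjoint (kron A B) $$ (i, j) = kron (mat_adjoint A) (mat_adjoint B) $$ (i, j)"
    using div_less_of_mult[OF i] div_less_of_mult[OF j] mod_less_of_mult[OF i] mod_less_of_mult[OF j]
    by (auto simp: kron_def)
qed auto

lemma kron_one: "kron (1\<^sub>m m) (1\<^sub>m n) = 1\<^sub>m (m * n)"
proof (rule eq_matI)
  fix i j assume "i < dim_row (1\<^sub>m (m * n))" "j < dim_col (1\<^sub>m (m * n))"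
  then have i: "i < m * n" and j: "j < m * n" by auto
  have "i = j \<longleftrightarrow> i div n = j div n \<and> i mod n = j mod n"
    by (metis div_mult_mod_eq)
  then show "kron (1\<^sub>m m) (1\<^sub>m n) $$ (i, j) = 1\<^sub>m (m * n) $$ (i, j)"
    using i j div_less_of_mult[OF i] div_less_of_mult[OF j] mod_less_of_mult[OF i] mod_less_of_mult[OF j]
    by (auto simp: kron_def)
qed auto

lemma kron_add_left:
  assumes "A \<in> carrier_mat m n" "B \<in> carrier_mat m n" "C \<in> carrier_mat p q"
  shows "kron (A + B) C = kron A C + kron B C"
  using assms carrier_matD[OF assms(1)] carrier_matD[OF assms(2)] carrier_matD[OF assms(3)]
  by (intro eq_matI) (auto simp: kron_def distrib_right div_less_of_mult)

lemma kron_add_right: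
  assumes "A \<in> carrier_mat m n" "B \<in> carrier_mat m n" "C \<in> carrier_mat p q"
  shows "kron C (A + B) = kron C A + kron C B"
  using assms carrier_matD[OF assms(1)] carrier_matD[OF assms(2)] carrier_matD[OF assms(3)]
  by (intro eq_matI) (auto simp: kron_def distrib_left mod_less_of_mult)

lemma kron_zero_left: "C \<in> carrier_mat p q \<Longrightarrow> kron (0\<^sub>m m n) C = 0\<^sub>m (m * p) (n * q)"
  by (intro eq_matI) (auto simp: kron_def div_less_of_mult)

lemma kron_zero_right: "C \<in> carrier_mat p q \<Longrightarrow> kron C (0\<^sub>m m n) = 0\<^sub>m (p * m) (q * n)"
  by (intro eq_matI) (auto simp: kron_def mod_less_of_mult)

section \<open>Sums of matrix lists and traces\<close>

lemma mat_sum_simps [simp]: "mat_sum n [] = 0\<^sub>m n n" "mat_sum n (A # As) = A + mat_sum n As"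
  by (auto simp: mat_sum_def)

lemma mat_sum_carrier [simp]: "set As \<subseteq> carrier_mat n n \<Longrightarrow> mat_sum n As \<in> carrier_mat n n"
  by (induction As) auto

lemma mat_sum_index:
  assumes "set As \<subseteq> carrier_mat n n" "i < n" "j < n"
  shows "mat_sum n As $$ (i, j) = (\<Sum>A\<leftarrow>As. A $$ (i, j))"
  using assms(1)
proof (induction As)
  case (Cons A As)
  then have "mat_sum n As \<in> carrier_mat n n" by simp
  from carrier_matD[OF this] show ?case using Cons assms(2,3) by simp
qed (use assms in auto)

lemma kron_mat_sum_left:
  assumes "set As \<subseteq> carrier_mat m m" "C \<in> carrier_mat p p"
  shows "kron (mat_sum m As) C = mat_sum (m * p) (map (\<lambda>A. kron A C) As)"
  using assms(1)
proof (induction As)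
  case (Cons A As)
  then show ?case using assms(2) by (simp add: kron_add_left[of _ m m _ _ p p])
qed (use assms(2) in \<open>simp add: kron_zero_left\<close>)

lemma kron_mat_sum_right:
  assumes "set As \<subseteq> carrier_mat m m" "C \<in> carrier_mat p p"
  shows "kron C (mat_sum m As) = mat_sum (p * m) (map (kron C) As)"
  using assms(1)
proof (induction As)
  case (Cons A As)
  then show ?case using assms(2) by (simp add: kron_add_right[of _ m m _ _ p p])
qed (use assms(2) in \<open>simp add: kron_zero_right\<close>)

lemma mtrace_add:
  "A \<in> carrier_mat n n \<Longrightarrow> B \<in> carrier_mat n n \<Longrightarrow> mtrace (A + B) = mtrace A + mtrace B"
  by (auto simp: mtrace_def sum.distrib)

lemma mtrace_smult: "A \<in> carrier_mat n n \<Longrightarrow> mtrace (c \<cdot>\<^sub>m A) = c * mtrace A"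
  by (auto simp: mtrace_def sum_distrib_left)

lemma mtrace_zero [simp]: "mtrace (0\<^sub>m n n) = 0"
  by (auto simp: mtrace_def)

lemma mtrace_mat_sum:
  "set As \<subseteq> carrier_mat n n \<Longrightarrow> mtrace (mat_sum n As) = (\<Sum>A\<leftarrow>As. mtrace A)"
  by (induction As) (auto simp: mtrace_add[of _ n])

lemma mtrace_comm:
  assumes A: "A \<in> carrier_mat m n" and B: "B \<in> carrier_mat n m"
  shows "mtrace (A * B) = mtrace (B * A)"
proof -
  have "mtrace (A * B) = (\<Sum>i<m. \<Sum>r<n. A $$ (i, r) * B $$ (r, i))"
    using A by (simp add: mtrace_def index_mult_sum[OF A B] del: index_mult_mat(1))
  also have "\<dots> = (\<Sum>r<n. \<Sum>i<m. B $$ (r, i) * A $$ (i, r))"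
    by (subst sum.swap) (simp add: mult.commute)
  also have "\<dots> = mtrace (B * A)"
    using B by (simp add: mtrace_def index_mult_sum[OF B A] del: index_mult_mat(1))
  finally show ?thesis .
qed

section \<open>Local operations\<close>

text \<open>The completely positive map with the single Kraus operator \<open>Y\<close>. Since
  \<open>Y\<close> may be rectangular, unitaries, measurement outcomes, ancillas and the terms of a
  partial trace all have this form.\<close>

definition conj_by :: "complex mat \<Rightarrow> complex mat \<Rightarrow> complex mat" where
  "conj_by Y \<sigma> = Y * \<sigma> * mat_adjoint Y"

lemma conj_by_carrier [simp]:
  "Y \<in> carrier_mat m n \<Longrightarrow> \<sigma> \<in> carrier_mat n n \<Longrightarrow> conj_by Y \<sigma> \<in> carrier_mat m m"
  unfolding conj_by_def by (meson adjoint_carrier mult_carrier_mat)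

lemma conj_by_add:
  assumes "Y \<in> carrier_mat m n" "\<sigma> \<in> carrier_mat n n" "\<tau> \<in> carrier_mat n n"
  shows "conj_by Y (\<sigma> + \<tau>) = conj_by Y \<sigma> + conj_by Y \<tau>"
  unfolding conj_by_def
  using assms by (simp add: mult_add_distrib_mat[of _ m n _ n] add_mult_distrib_mat[of _ m n _ _ m])

lemma conj_by_zero: "Y \<in> carrier_mat m n \<Longrightarrow> conj_by Y (0\<^sub>m n n) = 0\<^sub>m m m"
  unfolding conj_by_def by (simp add: right_mult_zero_mat[of _ m n] left_mult_zero_mat[of _ n m])

lemma conj_by_mult:
  assumes "Y \<in> carrier_mat m n" "Z \<in> carrier_mat n k" "\<sigma> \<in> carrier_mat k k"
  shows "conj_by Y (conj_by Z \<sigma>) = conj_by (Y * Z) \<sigma>"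
proof -
  have Zs: "Z * \<sigma> \<in> carrier_mat n k" and a: "mat_adjoint Z \<in> carrier_mat k n" "mat_adjoint Y \<in> carrier_mat n m"
    using assms by auto
  have "Y * (Z * \<sigma> * mat_adjoint Z) * mat_adjoint Y = Y * (Z * \<sigma>) * mat_adjoint Z * mat_adjoint Y"
    using assoc_mult_mat[OF assms(1) Zs a(1)] by simp
  also have "\<dots> = Y * (Z * \<sigma>) * (mat_adjoint Z * mat_adjoint Y)"
    using assoc_mult_mat[OF mult_carrier_mat[OF assms(1) Zs] a] by simp
  also have "\<dots> = Y * Z * \<sigma> * mat_adjoint (Y * Z)"
    using assoc_mult_mat[OF assms] adjoint_mult[OF assms(1,2)] by simp
  finally show ?thesis unfolding conj_by_def .
qed

text \<open>A single Kraus operator sends a pure state to a pure state. This is why Schmidt rank can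
  be followed through a run one vector at a time.\<close>

lemma conj_by_outer:
  assumes "Y \<in> carrier_mat m n" "v \<in> carrier_mat n 1"
  shows "conj_by Y (v * mat_adjoint v) = (Y * v) * mat_adjoint (Y * v)"
proof -
  have a: "mat_adjoint v \<in> carrier_mat 1 n" "mat_adjoint Y \<in> carrier_mat n m" "Y * v \<in> carrier_mat m 1"
    using assms by (auto intro!: adjoint_carrier mult_carrier_mat)
  have "Y * (v * mat_adjoint v) = Y * v * mat_adjoint v"
    by (rule assoc_mult_mat[OF assms a(1), symmetric])
  then show ?thesis
    unfolding conj_by_def adjoint_mult[OF assms] by (simp only: assoc_mult_mat[OF a(3,1,2)])
qed

text \<open>The Kraus operators of a trace-preserving map from dimension \<open>n\<close> to
  dimension \<open>e\<close>. Allowing two dimensions puts all quantum steps of a protocol under one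
  notion.\<close>

definition kraus :: "nat \<Rightarrow> nat \<Rightarrow> complex mat list \<Rightarrow> bool" where
  "kraus n e Xs \<longleftrightarrow>
     set Xs \<subseteq> carrier_mat e n \<and> mat_sum n (map (\<lambda>X. mat_adjoint X * X) Xs) = 1\<^sub>m n"

text \<open>Cyclicity of the trace brings each adjoint next to its operator; the rest is
  additivity.\<close>

lemma mtrace_conj_by_sum:
  assumes "set Ys \<subseteq> carrier_mat e n" "\<sigma> \<in> carrier_mat n n"
  shows "(\<Sum>Y\<leftarrow>Ys. mtrace (conj_by Y \<sigma>)) = mtrace (mat_sum n (map (\<lambda>Y. mat_adjoint Y * Y) Ys) * \<sigma>)"
  using assms(1)
proof (induction Ys)
  case (Cons Y Ys)
  have Y: "Y \<in> carrier_mat e n" and aY: "mat_adjoint Y \<in> carrier_mat n e"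
    using Cons by auto
  have sc: "mat_sum n (map (\<lambda>Y. mat_adjoint Y * Y) Ys) \<in> carrier_mat n n"
    using Cons by (intro mat_sum_carrier) (auto intro!: mult_carrier_mat)
  have "mtrace (conj_by Y \<sigma>) = mtrace (mat_adjoint Y * (Y * \<sigma>))"
    unfolding conj_by_def
    by (rule mtrace_comm[of _ e n]) (use Y assms aY in auto)
  also have "mat_adjoint Y * (Y * \<sigma>) = mat_adjoint Y * Y * \<sigma>"
    using assoc_mult_mat[OF aY Y assms(2)] by simp
  finally have "mtrace (conj_by Y \<sigma>) = mtrace (mat_adjoint Y * Y * \<sigma>)" .
  moreover have "mtrace (mat_adjoint Y * Y * \<sigma> + mat_sum n (map (\<lambda>Y. mat_adjoint Y * Y) Ys) * \<sigma>) =
     mtrace (mat_adjoint Y * Y * \<sigma>) + mtrace (mat_sum n (map (\<lambda>Y. mat_adjoint Y * Y) Ys) * \<sigma>)"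
    by (rule mtrace_add[of _ n]) (use Y aY sc assms in \<open>auto intro!: mult_carrier_mat\<close>)
  ultimately show ?case
    using Cons
    by (simp add: add_mult_distrib_mat[OF mult_carrier_mat[OF aY Y] sc assms(2)] del: assoc_mult_mat)
qed (use assms in auto)

lemma kraus_mtrace:
  assumes "kraus n e Xs" "\<sigma> \<in> carrier_mat n n"
  shows "(\<Sum>X\<leftarrow>Xs. mtrace (conj_by X \<sigma>)) = mtrace \<sigma>"
  using assms mtrace_conj_by_sum[of Xs e n \<sigma>] by (auto simp: kraus_def)

definition local_op :: "party \<Rightarrow> (party \<Rightarrow> nat) \<Rightarrow> complex mat \<Rightarrow> complex mat" where
  "local_op q d X = kron (if q = Alice then X else 1\<^sub>m (d Alice)) (if q = Bob then X else 1\<^sub>m (d Bob))"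

lemma apply_local_conj_by: "apply_local q d X \<sigma> = conj_by (local_op q d X) \<sigma>"
  by (simp add: apply_local_def local_op_def conj_by_def Let_def)

abbreviation total_dim :: "(party \<Rightarrow> nat) \<Rightarrow> nat" where
  "total_dim d \<equiv> d Alice * d Bob"

lemma local_op_carrier [simp]:
  "X \<in> carrier_mat e (d q) \<Longrightarrow> local_op q d X \<in> carrier_mat (total_dim (d(q := e))) (total_dim d)"
  by (cases q) (auto simp: local_op_def simp del: carrier_matD intro!: kron_carrier)

lemma apply_local_carrier [simp]:
  "X \<in> carrier_mat e (d q) \<Longrightarrow> \<sigma> \<in> carrier_mat (total_dim d) (total_dim d) \<Longrightarrow>
   apply_local q d X \<sigma> \<in> carrier_mat (total_dim (d(q := e))) (total_dim (d(q := e)))"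
  unfolding apply_local_conj_by by (rule conj_by_carrier[OF local_op_carrier])

lemma apply_local_square_carrier:
  assumes "X \<in> carrier_mat (d q) (d q)" "\<sigma> \<in> carrier_mat (total_dim d) (total_dim d)"
  shows "apply_local q d X \<sigma> \<in> carrier_mat (total_dim d) (total_dim d)"
  using apply_local_carrier[of X "d q" d q \<sigma>, OF assms] by (simp only: fun_upd_triv)

text \<open>Padding with the identity of the other party commutes with products, adjoints and sums,
  so completeness on one side gives completeness on the joint system.\<close>

lemma kraus_local_op:
  assumes "kraus (d q) e Xs"
  shows "kraus (total_dim d) (total_dim (d(q := e))) (map (local_op q d) Xs)"
proof -
  have X: "X \<in> carrier_mat e (d q)" if "X \<in> set Xs" for X
    using assms that by (auto simp: kraus_def)
  have c: "set (map (\<lambda>X. mat_adjoint X * X) Xs) \<subseteq> carrier_mat (d q) (d q)"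
    using X by (auto intro!: mult_carrier_mat[OF adjoint_carrier])
  have "mat_adjoint (local_op q d X) * local_op q d X = local_op q d (mat_adjoint X * X)"
    if "X \<in> set Xs" for X
  proof (cases q)
    case Alice
    have "kron (mat_adjoint X) (1\<^sub>m (d Bob)) * kron X (1\<^sub>m (d Bob)) =
        kron (mat_adjoint X * X) (1\<^sub>m (d Bob) * 1\<^sub>m (d Bob))"
      using X[OF that] Alice by (intro kron_mult[of _ "d Alice" e _ "d Bob" "d Bob" _ "d Alice" _ "d Bob"]) auto
    then show ?thesis using Alice by (simp add: local_op_def kron_adjoint)
  next
    case Bob
    have "kron (1\<^sub>m (d Alice)) (mat_adjoint X) * kron (1\<^sub>m (d Alice)) X =
        kron (1\<^sub>m (d Alice) * 1\<^sub>m (d Alice)) (mat_adjoint X * X)"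
      using X[OF that] Bob by (intro kron_mult[of _ "d Alice" "d Alice" _ "d Bob" e _ "d Alice" _ "d Bob"]) auto
    then show ?thesis using Bob by (simp add: local_op_def kron_adjoint)
  qed
  then have "mat_sum (total_dim d) (map (\<lambda>Y. mat_adjoint Y * Y) (map (local_op q d) Xs)) =
    mat_sum (total_dim d) (map (local_op q d) (map (\<lambda>X. mat_adjoint X * X) Xs))"
    by (simp add: comp_def cong: map_cong)
  also have "\<dots> = local_op q d (mat_sum (d q) (map (\<lambda>X. mat_adjoint X * X) Xs))"
    using c kron_mat_sum_left[OF c, of "1\<^sub>m (d Bob)" "d Bob"] kron_mat_sum_right[OF c, of "1\<^sub>m (d Alice)" "d Alice"]
    by (cases q) (auto simp: local_op_def comp_def)
  also have "\<dots> = 1\<^sub>m (total_dim d)"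
    using assms by (cases q) (auto simp: kraus_def local_op_def kron_one)
  finally show ?thesis
    using local_op_carrier[of _ e d q] X by (auto simp: kraus_def simp del: fun_upd_apply)
qed

lemma kraus_apply_local_mtrace:
  assumes "kraus (d q) e Xs" "\<sigma> \<in> carrier_mat (total_dim d) (total_dim d)"
  shows "(\<Sum>X\<leftarrow>Xs. mtrace (apply_local q d X \<sigma>)) = mtrace \<sigma>"
  using kraus_mtrace[OF kraus_local_op[of d q e Xs, OF assms(1)] assms(2)]
  by (simp add: apply_local_conj_by comp_def)

lemma apply_local_add:
  assumes "X \<in> carrier_mat e (d q)" "\<sigma> \<in> carrier_mat (total_dim d) (total_dim d)"
    "\<tau> \<in> carrier_mat (total_dim d) (total_dim d)"
  shows "apply_local q d X (\<sigma> + \<tau>) = apply_local q d X \<sigma> + apply_local q d X \<tau>"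
  unfolding apply_local_conj_by by (rule conj_by_add[OF local_op_carrier]) (use assms in auto)

section \<open>The elementary protocol steps as Kraus families\<close>

lemma measurement_kraus: "measurement n Es \<longleftrightarrow> kraus n n Es"
  by (simp add: measurement_def kraus_def)

lemma unitary_kraus: "unitary_mat n U \<Longrightarrow> kraus n n [U]"
  by (auto simp: unitary_mat_def kraus_def)

lemma ket_carrier [simp]: "ket e k \<in> carrier_mat e (Suc 0)"
  by (simp add: ket_def)

lemma kron_ket_carrier [simp]:
  "kron (1\<^sub>m n) (ket e k) \<in> carrier_mat (n * e) n"
  "kron (1\<^sub>m n) (mat_adjoint (ket e k)) \<in> carrier_mat n (n * e)"
  using kron_carrier[of "1\<^sub>m n" n n "ket e k" e "Suc 0"]
    kron_carrier[of "1\<^sub>m n" n n "mat_adjoint (ket e k)" "Suc 0" e] by auto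

lemma ancilla_kraus:
  assumes "0 < e"
  shows "kraus n (n * e) [kron (1\<^sub>m n) (ket e 0)]"
proof -
  have "mat_adjoint (ket e 0) * ket e 0 = 1\<^sub>m 1"
    using assms by (intro eq_matI) (auto simp: ket_def scalar_prod_def if_distrib cong: if_cong)
  moreover have "mat_adjoint (kron (1\<^sub>m n) (ket e 0)) * kron (1\<^sub>m n) (ket e 0) =
      kron (1\<^sub>m n * 1\<^sub>m n) (mat_adjoint (ket e 0) * ket e 0)"
    unfolding kron_adjoint adjoint_one
    by (rule kron_mult[of _ n n _ "Suc 0" e _ n _ "Suc 0"]) auto
  ultimately show ?thesis
    using kron_ket_carrier(1)[of n e 0] by (simp add: kraus_def kron_one)
qed

lemma ket_resolution: "mat_sum e (map (\<lambda>k. ket e k * mat_adjoint (ket e k)) [0..<e]) = 1\<^sub>m e"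
proof (rule eq_matI)
  have c: "set (map (\<lambda>k. ket e k * mat_adjoint (ket e k)) [0..<e]) \<subseteq> carrier_mat e e"
    by (auto intro!: mult_carrier_mat[OF ket_carrier adjoint_carrier])
  fix i j assume "i < dim_row (1\<^sub>m e :: complex mat)" "j < dim_col (1\<^sub>m e :: complex mat)"
  then have ij: "i < e" "j < e" by auto
  have "mat_sum e (map (\<lambda>k. ket e k * mat_adjoint (ket e k)) [0..<e]) $$ (i, j) =
    (\<Sum>k<e. (ket e k * mat_adjoint (ket e k)) $$ (i, j))"
    using mat_sum_index[OF c ij] by (simp add: comp_def interv_sum_list_conv_sum_set_nat atLeast0LessThan)
  also have "\<dots> = (\<Sum>k<e. if k = i then (if i = j then 1 else 0) else 0)"
    using ij by (intro sum.cong refl) (auto simp: ket_def scalar_prod_def)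
  also have "\<dots> = 1\<^sub>m e $$ (i, j)" using ij by auto
  finally show "mat_sum e (map (\<lambda>k. ket e k * mat_adjoint (ket e k)) [0..<e]) $$ (i, j) = 1\<^sub>m e $$ (i, j)" .
next
  have "mat_sum e (map (\<lambda>k. ket e k * mat_adjoint (ket e k)) [0..<e]) \<in> carrier_mat e e"
    by (intro mat_sum_carrier) (auto intro!: mult_carrier_mat[OF ket_carrier adjoint_carrier])
  then show "dim_row (mat_sum e (map (\<lambda>k. ket e k * mat_adjoint (ket e k)) [0..<e])) = dim_row (1\<^sub>m e :: complex mat)"
    "dim_col (mat_sum e (map (\<lambda>k. ket e k * mat_adjoint (ket e k)) [0..<e])) = dim_col (1\<^sub>m e :: complex mat)"
    by auto
qed

text \<open>A partial trace is a measurement of the discarded factor in its basis with the outcome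
  forgotten. Completeness reduces to the resolution of the identity by the kets of that
  factor.\<close>

lemma discard_kraus:
  "kraus (n * e) n (map (\<lambda>k. kron (1\<^sub>m n) (mat_adjoint (ket e k))) [0..<e])"
proof -
  have *: "mat_adjoint (kron (1\<^sub>m n) (mat_adjoint (ket e k))) * kron (1\<^sub>m n) (mat_adjoint (ket e k)) =
     kron (1\<^sub>m n) (ket e k * mat_adjoint (ket e k))" for k
    using kron_mult[of "1\<^sub>m n" n n "ket e k" e "Suc 0" "1\<^sub>m n" n "mat_adjoint (ket e k)" e]
    unfolding kron_adjoint adjoint_one adjoint_adjoint by simp
  have "set (map (\<lambda>k. ket e k * mat_adjoint (ket e k)) [0..<e]) \<subseteq> carrier_mat e e"
    by (auto intro!: mult_carrier_mat[OF ket_carrier adjoint_carrier])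
  from kron_mat_sum_right[OF this, of "1\<^sub>m n" n] show ?thesis
    using kron_ket_carrier(2)[of n e] by (auto simp: kraus_def comp_def * ket_resolution kron_one)
qed

lemma add_ancilla_carrier:
  assumes "\<sigma> \<in> carrier_mat (total_dim d) (total_dim d)"
  shows "add_ancilla q e d \<sigma> \<in> carrier_mat (total_dim (d(q := d q * e))) (total_dim (d(q := d q * e)))"
  unfolding add_ancilla_def by (rule apply_local_carrier) (use assms in auto)

lemma discard_kraus_div:
  assumes "e dvd d q"
  shows "kraus (d q) (d q div e) (map (\<lambda>k. kron (1\<^sub>m (d q div e)) (mat_adjoint (ket e k))) [0..<e])"
  using discard_kraus[of "d q div e" e] assms by simp

lemma discard_op_carrier:
  assumes "e dvd d q"
  shows "kron (1\<^sub>m (d q div e)) (mat_adjoint (ket e k)) \<in> carrier_mat (d q div e) (d q)"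
  using kron_ket_carrier(2)[of "d q div e" e k] assms by simp

lemma discard_factor_eq:
  "discard_factor q e d \<sigma> = mat_sum (total_dim (d(q := d q div e)))
     (map (\<lambda>k. apply_local q d (kron (1\<^sub>m (d q div e)) (mat_adjoint (ket e k))) \<sigma>) [0..<e])"
  by (simp add: discard_factor_def Let_def)

lemma discard_terms_carrier:
  assumes "e dvd d q" "\<sigma> \<in> carrier_mat (total_dim d) (total_dim d)"
  shows "set (map (\<lambda>k. apply_local q d (kron (1\<^sub>m (d q div e)) (mat_adjoint (ket e k))) \<sigma>) ks)
    \<subseteq> carrier_mat (total_dim (d(q := d q div e))) (total_dim (d(q := d q div e)))"
  using apply_local_carrier[of _ "d q div e" d q \<sigma>, OF discard_op_carrier[of e d q, OF assms(1)] assms(2)] by auto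

lemma discard_factor_carrier:
  assumes "e dvd d q" "\<sigma> \<in> carrier_mat (total_dim d) (total_dim d)"
  shows "discard_factor q e d \<sigma> \<in> carrier_mat (total_dim (d(q := d q div e))) (total_dim (d(q := d q div e)))"
  unfolding discard_factor_eq by (rule mat_sum_carrier[OF discard_terms_carrier[of e d q, OF assms]])

lemma mat_sum_map_add:
  assumes "\<And>x. x \<in> set xs \<Longrightarrow> f x \<in> carrier_mat n n" "\<And>x. x \<in> set xs \<Longrightarrow> g x \<in> carrier_mat n n"
  shows "mat_sum n (map (\<lambda>x. f x + g x) xs) = mat_sum n (map f xs) + mat_sum n (map g xs)"
  using assms
proof (induction xs)
  case (Cons x xs)
  have c: "mat_sum n (map f xs) \<in> carrier_mat n n" "mat_sum n (map g xs) \<in> carrier_mat n n"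
    "f x \<in> carrier_mat n n" "g x \<in> carrier_mat n n"
    using Cons.prems by (auto intro!: mat_sum_carrier)
  have "mat_sum n (map (\<lambda>x. f x + g x) xs) = mat_sum n (map f xs) + mat_sum n (map g xs)"
    using Cons by auto
  then show ?case using carrier_matD[OF c(1)] carrier_matD[OF c(2)] carrier_matD[OF c(3)] carrier_matD[OF c(4)]
    by (auto intro!: eq_matI)
qed auto

lemma discard_factor_add:
  assumes "e dvd d q" "\<sigma> \<in> carrier_mat (total_dim d) (total_dim d)"
    "\<tau> \<in> carrier_mat (total_dim d) (total_dim d)"
  shows "discard_factor q e d (\<sigma> + \<tau>) = discard_factor q e d \<sigma> + discard_factor q e d \<tau>"
proof -
  let ?D = "total_dim (d(q := d q div e))"
  let ?f = "\<lambda>\<sigma> k. apply_local q d (kron (1\<^sub>m (d q div e)) (mat_adjoint (ket e k))) \<sigma>"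
  note op = discard_op_carrier[of e d q, OF assms(1)]
  have c: "?f \<sigma> k \<in> carrier_mat ?D ?D" "?f \<tau> k \<in> carrier_mat ?D ?D" for k
    using apply_local_carrier[of _ "d q div e" d q, OF op] assms by blast+
  have "mat_sum ?D (map (?f (\<sigma> + \<tau>)) [0..<e]) = mat_sum ?D (map (\<lambda>k. ?f \<sigma> k + ?f \<tau> k) [0..<e])"
    using apply_local_add[of _ "d q div e" d q, OF op assms(2,3)] by simp
  also have "\<dots> = mat_sum ?D (map (?f \<sigma>) [0..<e]) + mat_sum ?D (map (?f \<tau>) [0..<e])"
    using c by (rule mat_sum_map_add)
  finally show ?thesis unfolding discard_factor_eq .
qed

lemma sum_list_map_concat:
  "sum_list (map f (concat (map g xs))) = (\<Sum>x\<leftarrow>xs. sum_list (map f (g x)))"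
  by (induction xs) auto

text \<open>Conservation of probability: each kind of node preserves the trace once its outcomes are
  added up, and the induction carries this to the leaves.\<close>

lemma mtrace_run:
  "wf_gepp M d P \<Longrightarrow> \<sigma> \<in> carrier_mat (total_dim d) (total_dim d) \<Longrightarrow>
   (\<Sum>b\<leftarrow>run d P \<sigma>. mtrace (snd b)) = mtrace \<sigma>"
proof (induction M d P arbitrary: \<sigma> rule: wf_gepp.induct)
  case (3 M d q U P)
  then have U: "kraus (d q) (d q) [U]" by (simp add: unitary_kraus)
  then have c: "apply_local q d U \<sigma> \<in> carrier_mat (total_dim d) (total_dim d)"
    by (intro apply_local_square_carrier 3(3)) (simp add: kraus_def)
  have "wf_gepp M d P" using 3(2) by simp
  from 3(1)[OF this c] show ?case
    using kraus_apply_local_mtrace[of d q, OF U 3(3)] by simp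
next
  case (4 M d q e P)
  then have U: "kraus (d q) (d q * e) [kron (1\<^sub>m (d q)) (ket e 0)]" by (simp add: ancilla_kraus)
  have "wf_gepp M (d(q := d q * e)) P" using 4(2) by simp
  from 4(1)[OF this add_ancilla_carrier[OF 4(3)]] show ?case
    using kraus_apply_local_mtrace[of d q, OF U 4(3)] by (simp add: add_ancilla_def del: fun_upd_apply)
next
  case (5 M d q e P)
  then have e: "e dvd d q" and P: "wf_gepp M (d(q := d q div e)) P" by simp_all
  have "mtrace (discard_factor q e d \<sigma>) = mtrace \<sigma>"
    using mtrace_mat_sum[OF discard_terms_carrier[of e d q \<sigma> "[0..<e]", OF e 5(3)]]
      kraus_apply_local_mtrace[of d q, OF discard_kraus_div[of e d q, OF e] 5(3)]
    by (simp add: discard_factor_eq comp_def)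
  then show ?case using 5(1)[OF P discard_factor_carrier[of e d q, OF e 5(3)]] by (simp del: fun_upd_apply)
next
  case (6 M d q bs)
  then have k: "kraus (d q) (d q) (map fst bs)" by (simp add: measurement_kraus)
  have "(\<Sum>x\<leftarrow>run d (snd b) (apply_local q d (fst b) \<sigma>). mtrace (snd x)) = mtrace (apply_local q d (fst b) \<sigma>)"
    if b: "b \<in> set bs" for b
  proof (rule 6(1)[OF b])
    show "wf_gepp M d (snd b)" using 6(2) b by simp
    show "apply_local q d (fst b) \<sigma> \<in> carrier_mat (total_dim d) (total_dim d)"
      by (rule apply_local_square_carrier[OF _ 6(3)]) (use k b in \<open>auto simp: kraus_def\<close>)
  qed
  then have "(\<Sum>b\<leftarrow>run d (Measure q bs) \<sigma>. mtrace (snd b)) = (\<Sum>b\<leftarrow>bs. mtrace (apply_local q d (fst b) \<sigma>))"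
    by (simp add: sum_list_map_concat cong: map_cong)
  then show ?case using kraus_apply_local_mtrace[of d q, OF k 6(3)] by (simp add: comp_def)
next
  case (7 M d bs)
  have "(\<Sum>x\<leftarrow>run d (snd b) (complex_of_real (fst b) \<cdot>\<^sub>m \<sigma>). mtrace (snd x)) = complex_of_real (fst b) * mtrace \<sigma>"
    if "b \<in> set bs" for b
    using 7(1)[OF that, of "complex_of_real (fst b) \<cdot>\<^sub>m \<sigma>"] 7(2,3) that by (simp add: mtrace_smult)
  then have "(\<Sum>b\<leftarrow>run d (Random bs) \<sigma>. mtrace (snd b)) = (\<Sum>b\<leftarrow>bs. complex_of_real (fst b) * mtrace \<sigma>)"
    by (simp add: sum_list_map_concat cong: map_cong)
  also have "\<dots> = complex_of_real (\<Sum>b\<leftarrow>bs. fst b) * mtrace \<sigma>"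
    by (induction bs) (auto simp: algebra_simps)
  finally show ?case using 7 by (simp add: distribution_def)
qed auto

section \<open>Schmidt rank\<close>

lemma of_real_cmod_square: "(complex_of_real (cmod z))\<^sup>2 = z * cnj z"
  by (metis complex_norm_square of_real_power)

lemma cnj_inner_eq_0:
  assumes "(\<Sum>x<m. q x * cnj (q x)) = 0" "x < (m::nat)"
  shows "q x = 0"
proof -
  have "complex_of_real (\<Sum>x<m. (cmod (q x))\<^sup>2) = 0"
    using assms(1) by (simp add: of_real_cmod_square)
  then have "(\<Sum>x<m. (cmod (q x))\<^sup>2) = 0" by (simp only: of_real_eq_0_iff)
  then show ?thesis using assms(2) by (simp add: sum_nonneg_eq_0_iff)
qed

text \<open>Gram-Schmidt on the left factors, with each correction absorbed into the right factors
  so that the sum of products is unchanged. The vectors are left unnormalised and may vanish, so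
  linearly dependent families need no separate treatment.\<close>

lemma orthogonalize:
  fixes a b :: "nat \<Rightarrow> nat \<Rightarrow> complex"
  shows "\<exists>q r. (\<forall>k<R. \<forall>l<R. k \<noteq> l \<longrightarrow> (\<Sum>x<m. q k x * cnj (q l x)) = 0) \<and>
    (\<forall>x y. (\<Sum>k<R. a k x * b k y) = (\<Sum>k<R. q k x * r k y))"
proof (induction R)
  case (Suc R)
  then obtain q r where orth: "\<And>k l. k < R \<Longrightarrow> l < R \<Longrightarrow> k \<noteq> l \<Longrightarrow> (\<Sum>x<m. q k x * cnj (q l x)) = 0"
    and eq: "\<And>x y. (\<Sum>k<R. a k x * b k y) = (\<Sum>k<R. q k x * r k y)" by blast
  \<comment> \<open>If \<open>q k\<close> vanishes on the first \<open>m\<close> indices, the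
    denominator is 0 and the coefficient is 0 by the convention for division. This is harmless,
    because the inner product with such a vector is 0 as well.\<close>
  define c where "c k = (\<Sum>x<m. a R x * cnj (q k x)) / (\<Sum>x<m. q k x * cnj (q k x))" for k
  define q' where "q' k = (if k < R then q k else (\<lambda>x. a R x - (\<Sum>k<R. c k * q k x)))" for k
  define r' where "r' k = (if k < R then (\<lambda>y. r k y + c k * b R y) else b R)" for k
  have new: "(\<Sum>x<m. q' R x * cnj (q l x)) = 0" if l: "l < R" for l
  proof -
    have "(\<Sum>x<m. q' R x * cnj (q l x)) =
      (\<Sum>x<m. a R x * cnj (q l x)) - (\<Sum>x<m. \<Sum>k<R. c k * (q k x * cnj (q l x)))"
      by (simp add: q'_def left_diff_distrib sum_subtractf sum_distrib_right mult.assoc)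
    also have "(\<Sum>x<m. \<Sum>k<R. c k * (q k x * cnj (q l x))) = (\<Sum>k<R. c k * (\<Sum>x<m. q k x * cnj (q l x)))"
      by (subst sum.swap) (simp add: sum_distrib_left)
    also have "\<dots> = (\<Sum>k<R. if k = l then c l * (\<Sum>x<m. q l x * cnj (q l x)) else 0)"
      using orth l by (intro sum.cong) auto
    also have "\<dots> = c l * (\<Sum>x<m. q l x * cnj (q l x))" using l by simp
    also have "\<dots> = (\<Sum>x<m. a R x * cnj (q l x))"
    proof (cases "(\<Sum>x<m. q l x * cnj (q l x)) = 0")
      case True
      have "(\<Sum>x<m. a R x * cnj (q l x)) = 0"
        by (intro sum.neutral ballI) (use cnj_inner_eq_0[OF True] in simp)
      then show ?thesis using True by simp
    qed (simp add: c_def)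
    finally show ?thesis by simp
  qed
  have new': "(\<Sum>x<m. q l x * cnj (q' R x)) = 0" if l: "l < R" for l
  proof -
    have "(\<Sum>x<m. q l x * cnj (q' R x)) = cnj (\<Sum>x<m. q' R x * cnj (q l x))"
      by (simp add: cnj_sum mult.commute)
    then show ?thesis using new[OF l] by simp
  qed
  have "(\<Sum>x<m. q' k x * cnj (q' l x)) = 0" if "k < Suc R" "l < Suc R" "k \<noteq> l" for k l
  proof (cases "k < R \<and> l < R")
    case True
    then show ?thesis using orth that by (simp add: q'_def)
  next
    case False
    then have "k = R \<and> l < R \<or> l = R \<and> k < R" using that by (auto simp: less_Suc_eq)
    then consider "k = R" "l < R" | "l = R" "k < R" by blast
    then show ?thesis
    proof cases
      case 1
      then show ?thesis using new[OF 1(2)] by (simp add: q'_def)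
    next
      case 2
      then show ?thesis using new'[OF 2(2)] by (simp add: q'_def)
    qed
  qed
  moreover have "(\<Sum>k<Suc R. a k x * b k y) = (\<Sum>k<Suc R. q' k x * r' k y)" for x y
  proof -
    have "(\<Sum>k<Suc R. q' k x * r' k y) =
      (\<Sum>k<R. q k x * r k y + c k * q k x * b R y) + (a R x - (\<Sum>k<R. c k * q k x)) * b R y"
      by (simp add: q'_def r'_def algebra_simps)
    also have "\<dots> = (\<Sum>k<R. q k x * r k y) + a R x * b R y"
      by (simp add: sum.distrib sum_distrib_left algebra_simps)
    finally show ?thesis by (simp add: eq)
  qed
  ultimately show ?case by blast
qed auto

lemma sum_swap3:
  "(\<Sum>x\<in>A. \<Sum>k\<in>B. \<Sum>l\<in>C. f x k l) = (\<Sum>k\<in>B. \<Sum>l\<in>C. \<Sum>x\<in>A. f x k l)"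
  by (subst sum.swap, rule sum.cong[OF refl], rule sum.swap)

lemma cmod_sum_mult_le:
  "(cmod (\<Sum>x<(m::nat). f x * g x))\<^sup>2 \<le> (\<Sum>x<m. (cmod (f x))\<^sup>2) * (\<Sum>x<m. (cmod (g x))\<^sup>2)"
proof -
  have "cmod (\<Sum>x<m. f x * g x) \<le> (\<Sum>x<m. cmod (f x) * cmod (g x))"
    by (rule order_trans[OF norm_sum]) (simp add: norm_mult)
  then have "(cmod (\<Sum>x<m. f x * g x))\<^sup>2 \<le> (\<Sum>x<m. cmod (f x) * cmod (g x))\<^sup>2"
    by (intro power_mono) auto
  also have "\<dots> \<le> (\<Sum>x<m. (cmod (f x))\<^sup>2) * (\<Sum>x<m. (cmod (g x))\<^sup>2)"
    by (rule Cauchy_Schwarz_ineq_sum)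
  finally show ?thesis .
qed

text \<open>For a matrix A of rank at most R this is \<open>|tr A|^2 \<le> R |A|^2\<close> in the Frobenius norm.\<close>

lemma trace_rank_bound:
  fixes a b :: "nat \<Rightarrow> nat \<Rightarrow> complex" and R m :: nat
  defines "A \<equiv> \<lambda>x y. \<Sum>k<R. a k x * b k y"
  shows "(cmod (\<Sum>x<m. A x x))\<^sup>2 \<le> real R * (\<Sum>x<m. \<Sum>y<m. (cmod (A x y))\<^sup>2)"
proof -
  obtain q r where orth: "\<And>k l. k < R \<Longrightarrow> l < R \<Longrightarrow> k \<noteq> l \<Longrightarrow> (\<Sum>x<m. q k x * cnj (q l x)) = 0"
    and eq: "\<And>x y. A x y = (\<Sum>k<R. q k x * r k y)"
    using orthogonalize[where a = a and b = b and R = R and m = m] unfolding A_def by blast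
  have "complex_of_real (\<Sum>x<m. \<Sum>y<m. (cmod (A x y))\<^sup>2) = (\<Sum>x<m. \<Sum>y<m. A x y * cnj (A x y))"
    by (simp add: of_real_cmod_square)
  also have "\<dots> = (\<Sum>x<m. \<Sum>y<m. \<Sum>k<R. \<Sum>l<R. (q k x * cnj (q l x)) * (r k y * cnj (r l y)))"
    unfolding eq by (simp add: cnj_sum sum_product mult_ac)
  also have "\<dots> = (\<Sum>x<m. \<Sum>k<R. \<Sum>l<R. \<Sum>y<m. (q k x * cnj (q l x)) * (r k y * cnj (r l y)))"
    by (rule sum.cong[OF refl], rule sum_swap3)
  also have "\<dots> = (\<Sum>k<R. \<Sum>l<R. \<Sum>x<m. \<Sum>y<m. (q k x * cnj (q l x)) * (r k y * cnj (r l y)))"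
    by (rule sum_swap3)
  also have "\<dots> = (\<Sum>k<R. \<Sum>l<R. (\<Sum>x<m. q k x * cnj (q l x)) * (\<Sum>y<m. r k y * cnj (r l y)))"
    by (simp add: sum_product)
  \<comment> \<open>Orthogonality of the left factors alone removes all cross terms, whatever the
    right factors are.\<close>
  also have "\<dots> = (\<Sum>k<R. \<Sum>l<R. if l = k then (\<Sum>x<m. q k x * cnj (q k x)) * (\<Sum>y<m. r k y * cnj (r k y)) else 0)"
    using orth by (intro sum.cong refl) auto
  also have "\<dots> = complex_of_real (\<Sum>k<R. (\<Sum>x<m. (cmod (q k x))\<^sup>2) * (\<Sum>y<m. (cmod (r k y))\<^sup>2))"
    by (simp add: of_real_cmod_square)
  finally have frob: "(\<Sum>x<m. \<Sum>y<m. (cmod (A x y))\<^sup>2) =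
      (\<Sum>k<R. (\<Sum>x<m. (cmod (q k x))\<^sup>2) * (\<Sum>y<m. (cmod (r k y))\<^sup>2))"
    by (simp only: of_real_eq_iff)
  have "(\<Sum>x<m. A x x) = (\<Sum>k<R. \<Sum>x<m. q k x * r k x)"
    unfolding eq by (rule sum.swap)
  then have "cmod (\<Sum>x<m. A x x) \<le> (\<Sum>k<R. cmod (\<Sum>x<m. q k x * r k x))"
    by (simp add: norm_sum)
  then have "(cmod (\<Sum>x<m. A x x))\<^sup>2 \<le> (\<Sum>k<R. cmod (\<Sum>x<m. q k x * r k x))\<^sup>2"
    by (intro power_mono) auto
  \<comment> \<open>Cauchy-Schwarz is used twice: over the \<open>R\<close> terms, which produces
    the factor \<open>R\<close>, and then inside each term.\<close>
  also have "\<dots> \<le> real R * (\<Sum>k<R. (cmod (\<Sum>x<m. q k x * r k x))\<^sup>2)"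
    using sum_squared_le_sum_of_squares[of "\<lambda>k. cmod (\<Sum>x<m. q k x * r k x)" "{..<R}"]
    by (simp add: mult.commute)
  also have "\<dots> \<le> real R * (\<Sum>k<R. (\<Sum>x<m. (cmod (q k x))\<^sup>2) * (\<Sum>y<m. (cmod (r k y))\<^sup>2))"
    by (intro mult_left_mono sum_mono cmod_sum_mult_le) auto
  finally show ?thesis unfolding frob .
qed

text \<open>The Schmidt number of a vector is the rank of its coefficient matrix. The bound is
  encoded as a decomposition into \<open>R\<close> product vectors, the form on which local
  operators act directly.\<close>

definition schmidt :: "nat \<Rightarrow> nat \<Rightarrow> nat \<Rightarrow> complex mat \<Rightarrow> bool" where
  "schmidt R m n v \<longleftrightarrow> v \<in> carrier_mat (m * n) 1 \<and>
     (\<exists>a b. \<forall>x<m. \<forall>y<n. v $$ (x * n + y, 0) = (\<Sum>k<R. a k x * b k y))"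

text \<open>\<open>X\<close> acts on each left factor and \<open>Z\<close> on each right factor, so
  the number of product terms does not change.\<close>

lemma schmidt_kron:
  assumes v: "schmidt R m n v" and X: "X \<in> carrier_mat p m" and Z: "Z \<in> carrier_mat q n"
  shows "schmidt R p q (kron X Z * v)"
proof -
  obtain a b where ab: "\<And>x y. x < m \<Longrightarrow> y < n \<Longrightarrow> v $$ (x * n + y, 0) = (\<Sum>k<R. a k x * b k y)"
    and vc: "v \<in> carrier_mat (m * n) 1" using v unfolding schmidt_def by blast
  have "(kron X Z * v) $$ (x * q + y, 0) =
      (\<Sum>k<R. (\<Sum>c<m. X $$ (x, c) * a k c) * (\<Sum>e<n. Z $$ (y, e) * b k e))"
    if x: "x < p" and y: "y < q" for x y
  proof -
    have "(kron X Z * v) $$ (x * q + y, 0) = (\<Sum>t<m * n. kron X Z $$ (x * q + y, t) * v $$ (t, 0))"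
      by (rule index_mult_sum[OF kron_carrier[OF X Z] vc pair_index_less[OF x y]]) simp
    also have "\<dots> = (\<Sum>c<m. \<Sum>e<n. kron X Z $$ (x * q + y, c * n + e) * v $$ (c * n + e, 0))"
      by (rule sum_lessThan_mult)
    also have "\<dots> = (\<Sum>c<m. \<Sum>e<n. \<Sum>k<R. (X $$ (x, c) * a k c) * (Z $$ (y, e) * b k e))"
    proof (intro sum.cong refl)
      fix c e assume "c \<in> {..<m}" "e \<in> {..<n}"
      then have c: "c < m" and e: "e < n" by auto
      have "kron X Z $$ (x * q + y, c * n + e) = X $$ (x, c) * Z $$ (y, e)"
        using y e by (simp add: index_kron[OF X Z pair_index_less[OF x y] pair_index_less[OF c e]])
      then show "kron X Z $$ (x * q + y, c * n + e) * v $$ (c * n + e, 0) =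
          (\<Sum>k<R. (X $$ (x, c) * a k c) * (Z $$ (y, e) * b k e))"
        unfolding ab[OF c e] by (simp add: sum_distrib_left mult_ac)
    qed
    also have "\<dots> = (\<Sum>c<m. \<Sum>k<R. \<Sum>e<n. (X $$ (x, c) * a k c) * (Z $$ (y, e) * b k e))"
      by (rule sum.cong[OF refl], rule sum.swap)
    also have "\<dots> = (\<Sum>k<R. \<Sum>c<m. \<Sum>e<n. (X $$ (x, c) * a k c) * (Z $$ (y, e) * b k e))"
      by (rule sum.swap)
    also have "\<dots> = (\<Sum>k<R. (\<Sum>c<m. X $$ (x, c) * a k c) * (\<Sum>e<n. Z $$ (y, e) * b k e))"
      by (simp add: sum_product)
    finally show ?thesis .
  qed
  moreover have "kron X Z * v \<in> carrier_mat (p * q) 1"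
    using mult_carrier_mat[OF kron_carrier[OF X Z] vc] .
  ultimately show ?thesis unfolding schmidt_def
    by (intro conjI exI[of _ "\<lambda>k x. \<Sum>c<m. X $$ (x, c) * a k c"] exI[of _ "\<lambda>k y. \<Sum>e<n. Z $$ (y, e) * b k e"]) auto
qed

text \<open>The maximally entangled vector lives on the indices \<open>x * T + x\<close> with equal
  amplitudes, so only these entries of \<rho> survive, and the two amplitudes multiply to 1/T.
  Fidelities are computed through this formula from here on.\<close>

lemma fidelity_eq:
  assumes "\<rho> \<in> carrier_mat (T * T) (T * T)"
  shows "fidelity T \<rho> = Re (\<Sum>x<T. \<Sum>y<T. \<rho> $$ (x * T + x, y * T + y)) / real T"
proof -
  let ?s = "complex_of_real (1 / sqrt (real T))"
  have me: "max_ent T $ (x * T + y) = (if x = y then ?s else 0)" if "x < T" "y < T" for x y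
    using that pair_index_less[of x T y T] by (simp add: max_ent_def)
  have dim: "dim_vec (max_ent T) = T * T" by (simp add: max_ent_def)
  have mv: "(\<rho> *\<^sub>v max_ent T) $ i = (\<Sum>y<T. \<rho> $$ (i, y * T + y) * ?s)" if i: "i < T * T" for i
  proof -
    have "(\<rho> *\<^sub>v max_ent T) $ i = (\<Sum>t<T * T. \<rho> $$ (i, t) * max_ent T $ t)"
      using assms i dim by (auto simp: scalar_prod_def atLeast0LessThan intro!: sum.cong)
    also have "\<dots> = (\<Sum>x<T. \<Sum>y<T. if y = x then \<rho> $$ (i, x * T + x) * ?s else 0)"
      unfolding sum_lessThan_mult by (intro sum.cong refl) (auto simp: me)
    finally show ?thesis by simp
  qed
  have "(\<rho> *\<^sub>v max_ent T) \<bullet>c max_ent T = (\<Sum>t<T * T. (\<rho> *\<^sub>v max_ent T) $ t * cnj (max_ent T $ t))"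
    using dim assms by (auto simp: scalar_prod_def atLeast0LessThan intro!: sum.cong)
  also have "\<dots> = (\<Sum>x<T. \<Sum>y<T. if y = x then (\<Sum>y<T. \<rho> $$ (x * T + x, y * T + y) * ?s) * ?s else 0)"
    unfolding sum_lessThan_mult by (intro sum.cong refl) (auto simp: me mv pair_index_less)
  also have "\<dots> = (\<Sum>x<T. (\<Sum>y<T. \<rho> $$ (x * T + x, y * T + y) * ?s) * ?s)"
    by (intro sum.cong refl, subst sum.delta) auto
  also have "\<dots> = (\<Sum>x<T. \<Sum>y<T. \<rho> $$ (x * T + x, y * T + y)) * complex_of_real (1 / real T)"
  proof -
    have "?s * ?s = complex_of_real (1 / real T)"
      unfolding of_real_mult[symmetric] by simp
    moreover have "(\<Sum>x<T. (\<Sum>y<T. \<rho> $$ (x * T + x, y * T + y) * s) * s) =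
        (\<Sum>x<T. \<Sum>y<T. \<rho> $$ (x * T + x, y * T + y)) * (s * s)" for s
      by (simp add: sum_distrib_right mult.assoc)
    ultimately show ?thesis by (simp only:)
  qed
  finally show ?thesis unfolding fidelity_def by simp
qed

lemma fidelity_add:
  assumes "\<sigma> \<in> carrier_mat (T * T) (T * T)" "\<tau> \<in> carrier_mat (T * T) (T * T)"
  shows "fidelity T (\<sigma> + \<tau>) = fidelity T \<sigma> + fidelity T \<tau>"
proof -
  have "(\<sigma> + \<tau>) $$ (x * T + x, y * T + y) = \<sigma> $$ (x * T + x, y * T + y) + \<tau> $$ (x * T + x, y * T + y)"
    if "x < T" "y < T" for x y
    using assms that pair_index_less[of x T x T] pair_index_less[of y T y T] by auto
  then show ?thesis
    using assms add_carrier_mat[OF assms(2), of \<sigma>]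
    by (simp add: fidelity_eq sum.distrib add_divide_distrib)
qed

lemma fidelity_smult:
  assumes "\<sigma> \<in> carrier_mat (T * T) (T * T)"
  shows "fidelity T (complex_of_real c \<cdot>\<^sub>m \<sigma>) = c * fidelity T \<sigma>"
proof -
  have "(complex_of_real c \<cdot>\<^sub>m \<sigma>) $$ (x * T + x, y * T + y) = complex_of_real c * \<sigma> $$ (x * T + x, y * T + y)"
    if "x < T" "y < T" for x y
    using assms that pair_index_less[of x T x T] pair_index_less[of y T y T] by auto
  then show ?thesis
    using assms by (simp add: fidelity_eq sum_distrib_left[symmetric])
qed

lemma fidelity_zero [simp]: "fidelity T (0\<^sub>m (T * T) (T * T)) = 0"
  using fidelity_smult[of "0\<^sub>m (T * T) (T * T)" T 0] by simp

lemma fidelity_mat_sum: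
  "set As \<subseteq> carrier_mat (T * T) (T * T) \<Longrightarrow> fidelity T (mat_sum (T * T) As) = (\<Sum>A\<leftarrow>As. fidelity T A)"
  by (induction As) (auto simp: fidelity_add)

lemma index_outer:
  assumes "v \<in> carrier_mat n 1" "i < n" "j < n"
  shows "(v * mat_adjoint v) $$ (i, j) = v $$ (i, 0) * cnj (v $$ (j, 0))"
  using index_mult_sum[OF assms(1) adjoint_carrier[OF assms(1)] assms(2,3)] assms by simp

lemma outer_carrier: "v \<in> carrier_mat n 1 \<Longrightarrow> v * mat_adjoint v \<in> carrier_mat n n"
  by (meson adjoint_carrier mult_carrier_mat)

lemma fidelity_outer:
  assumes v: "v \<in> carrier_mat (T * T) 1"
  shows "fidelity T (v * mat_adjoint v) = (cmod (\<Sum>x<T. v $$ (x * T + x, 0)))\<^sup>2 / real T"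
proof -
  have "(\<Sum>x<T. \<Sum>y<T. (v * mat_adjoint v) $$ (x * T + x, y * T + y)) =
     (\<Sum>x<T. v $$ (x * T + x, 0)) * cnj (\<Sum>x<T. v $$ (x * T + x, 0))"
    unfolding cnj_sum sum_product by (intro sum.cong refl index_outer[OF v] pair_index_less) auto
  also have "\<dots> = complex_of_real ((cmod (\<Sum>x<T. v $$ (x * T + x, 0)))\<^sup>2)"
    by (rule complex_norm_square[symmetric])
  finally show ?thesis by (simp add: fidelity_eq[OF outer_carrier[OF v]])
qed

lemma mtrace_outer:
  assumes v: "v \<in> carrier_mat n 1"
  shows "mtrace (v * mat_adjoint v) = complex_of_real (\<Sum>i<n. (cmod (v $$ (i, 0)))\<^sup>2)"
  using outer_carrier[OF v] by (simp add: mtrace_def index_outer[OF v] of_real_cmod_square del: index_mult_mat)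

text \<open>Cauchy-Schwarz against the constant function 1 on the diagonal of the coefficient
  matrix, whose squared entries are part of the full squared norm.\<close>

lemma fidelity_outer_le_trace:
  assumes v: "v \<in> carrier_mat (T * T) 1"
  shows "fidelity T (v * mat_adjoint v) \<le> Re (mtrace (v * mat_adjoint v))"
proof -
  have "(cmod (\<Sum>x<T. v $$ (x * T + x, 0)))\<^sup>2 \<le> (\<Sum>x<T. (cmod (v $$ (x * T + x, 0)))\<^sup>2) * real T"
    using cmod_sum_mult_le[where f = "\<lambda>x. v $$ (x * T + x, 0)" and g = "\<lambda>_. 1" and m = T] by simp
  moreover have "(\<Sum>x<T. (cmod (v $$ (x * T + x, 0)))\<^sup>2) \<le> (\<Sum>x<T. \<Sum>y<T. (cmod (v $$ (x * T + y, 0)))\<^sup>2)"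
  proof (rule sum_mono)
    fix x assume "x \<in> {..<T}"
    then show "(cmod (v $$ (x * T + x, 0)))\<^sup>2 \<le> (\<Sum>y<T. (cmod (v $$ (x * T + y, 0)))\<^sup>2)"
      using member_le_sum[of x "{..<T}" "\<lambda>y. (cmod (v $$ (x * T + y, 0)))\<^sup>2"] by simp
  qed
  ultimately have "(cmod (\<Sum>x<T. v $$ (x * T + x, 0)))\<^sup>2 \<le> (\<Sum>x<T. \<Sum>y<T. (cmod (v $$ (x * T + y, 0)))\<^sup>2) * real T"
    by (meson mult_right_mono of_nat_0_le_iff order_trans)
  then show ?thesis
    unfolding fidelity_outer[OF v] mtrace_outer[OF v] sum_lessThan_mult
    by (cases "T = 0") (simp_all add: divide_le_eq)
qed

text \<open>The overlap with the maximally entangled state is the trace of the coefficient matrix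
  divided by sqrt T, so \<open>trace_rank_bound\<close> applies to it.\<close>

lemma fidelity_outer_le_schmidt:
  assumes "schmidt R T T v"
  shows "fidelity T (v * mat_adjoint v) \<le> real R / real T * Re (mtrace (v * mat_adjoint v))"
proof -
  obtain a b where ab: "\<And>x y. x < T \<Longrightarrow> y < T \<Longrightarrow> v $$ (x * T + y, 0) = (\<Sum>k<R. a k x * b k y)"
    and v: "v \<in> carrier_mat (T * T) 1" using assms unfolding schmidt_def by blast
  have "(cmod (\<Sum>x<T. v $$ (x * T + x, 0)))\<^sup>2 \<le> real R * (\<Sum>x<T. \<Sum>y<T. (cmod (v $$ (x * T + y, 0)))\<^sup>2)"
    using trace_rank_bound[where a = a and b = b and R = R and m = T] by (simp add: ab)
  then show ?thesis
    by (simp add: fidelity_outer[OF v] mtrace_outer[OF v] sum_lessThan_mult divide_right_mono)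
qed

text \<open>The unnormalised states of Schmidt number at most R.\<close>

inductive cone :: "nat \<Rightarrow> nat \<Rightarrow> nat \<Rightarrow> complex mat \<Rightarrow> bool" for R m n where
  zero: "cone R m n (0\<^sub>m (m * n) (m * n))"
| step: "schmidt R m n v \<Longrightarrow> cone R m n \<sigma> \<Longrightarrow> cone R m n (v * mat_adjoint v + \<sigma>)"

section \<open>Closure properties and fidelity bounds for the cone of bounded Schmidt number\<close>

lemma schmidt_carrier: "schmidt R m n v \<Longrightarrow> v \<in> carrier_mat (m * n) 1"
  by (simp add: schmidt_def)

lemma cone_carrier: "cone R m n \<sigma> \<Longrightarrow> \<sigma> \<in> carrier_mat (m * n) (m * n)"
  by (induction rule: cone.induct) (auto intro!: add_carrier_mat)

lemma cone_outer: "schmidt R m n v \<Longrightarrow> cone R m n (v * mat_adjoint v)"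
  using cone.step[OF _ cone.zero, of R m n v] outer_carrier[OF schmidt_carrier, of R m n v] by simp

lemma cone_add: "cone R m n \<sigma> \<Longrightarrow> cone R m n \<tau> \<Longrightarrow> cone R m n (\<sigma> + \<tau>)"
proof (induction rule: cone.induct)
  case zero
  then show ?case using cone_carrier by (metis left_add_zero_mat)
next
  case (step v \<sigma>)
  have "v * mat_adjoint v + \<sigma> + \<tau> = v * mat_adjoint v + (\<sigma> + \<tau>)"
    using outer_carrier[OF schmidt_carrier[OF step(1)]] cone_carrier[OF step(2)] cone_carrier[OF step(4)]
    by (rule assoc_add_mat)
  then show ?case using cone.step[OF step(1) step(3)[OF step(4)]] by simp
qed

lemma cone_mat_sum: "(\<And>A. A \<in> set As \<Longrightarrow> cone R m n A) \<Longrightarrow> cone R m n (mat_sum (m * n) As)"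
  by (induction As) (auto intro: cone.zero cone_add)

lemma cone_conj_kron:
  assumes "cone R m n \<sigma>" and X: "X \<in> carrier_mat p m" and Z: "Z \<in> carrier_mat q n"
  shows "cone R p q (conj_by (kron X Z) \<sigma>)"
  using assms(1)
proof (induction rule: cone.induct)
  case zero
  show ?case using conj_by_zero[OF kron_carrier[OF X Z]] cone.zero by simp
next
  case (step v \<sigma>)
  note v = schmidt_carrier[OF step(1)]
  have "conj_by (kron X Z) (v * mat_adjoint v + \<sigma>) =
      (kron X Z * v) * mat_adjoint (kron X Z * v) + conj_by (kron X Z) \<sigma>"
    unfolding conj_by_add[OF kron_carrier[OF X Z] outer_carrier[OF v] cone_carrier[OF step(2)]]
      conj_by_outer[OF kron_carrier[OF X Z] v] ..
  then show ?case using cone.step[OF schmidt_kron[OF step(1) X Z] step(3)] by simp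
qed

text \<open>Scaling by \<open>c\<close> is conjugation by sqrt c times the identity, which is itself
  a Kronecker product, so the closure under local operators covers it.\<close>

lemma cone_smult:
  assumes "cone R m n \<sigma>" "0 \<le> c"
  shows "cone R m n (complex_of_real c \<cdot>\<^sub>m \<sigma>)"
proof -
  have c: "complex_of_real (sqrt c) * complex_of_real (sqrt c) = complex_of_real c"
    unfolding of_real_mult[symmetric] using assms(2) by simp
  have s: "complex_of_real (sqrt c) \<cdot>\<^sub>m 1\<^sub>m m \<in> carrier_mat m m" by simp
  have k: "kron (complex_of_real (sqrt c) \<cdot>\<^sub>m 1\<^sub>m m) (1\<^sub>m n) = complex_of_real (sqrt c) \<cdot>\<^sub>m 1\<^sub>m (m * n)"
    unfolding kron_one[symmetric] by (rule eq_matI) (auto simp: kron_def div_less_of_mult)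
  have a: "mat_adjoint (complex_of_real (sqrt c) \<cdot>\<^sub>m 1\<^sub>m (m * n)) = complex_of_real (sqrt c) \<cdot>\<^sub>m 1\<^sub>m (m * n)"
    by (rule eq_matI) auto
  have "conj_by (kron (complex_of_real (sqrt c) \<cdot>\<^sub>m 1\<^sub>m m) (1\<^sub>m n)) \<sigma> = complex_of_real c \<cdot>\<^sub>m \<sigma>"
    unfolding k conj_by_def a
    using cone_carrier[OF assms(1)] c mult.assoc[of "complex_of_real (sqrt c)" "complex_of_real (sqrt c)"]
    by (intro eq_matI) (auto simp: mult_smult_assoc_mat[of _ "m * n" "m * n" _ "m * n"] mult_smult_distrib[of _ "m * n" "m * n" _ "m * n"])
  then show ?thesis using cone_conj_kron[OF assms(1) s, of "1\<^sub>m n" n] by simp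
qed

lemma cone_trace_nonneg: "cone R m n \<sigma> \<Longrightarrow> 0 \<le> Re (mtrace \<sigma>)"
proof (induction rule: cone.induct)
  case (step v \<sigma>)
  note v = schmidt_carrier[OF step(1)]
  have "0 \<le> Re (mtrace (v * mat_adjoint v))"
    unfolding mtrace_outer[OF v] by (simp add: sum_nonneg)
  then show ?case using step(3) by (simp add: mtrace_add[OF outer_carrier[OF v] cone_carrier[OF step(2)]])
qed simp

lemma cone_fidelity_nonneg: "cone R T T \<sigma> \<Longrightarrow> 0 \<le> fidelity T \<sigma>"
proof (induction rule: cone.induct)
  case (step v \<sigma>)
  note v = schmidt_carrier[OF step(1)]
  have "0 \<le> fidelity T (v * mat_adjoint v)"
    unfolding fidelity_outer[OF v] by simp
  then show ?case using step(3) by (simp add: fidelity_add[OF outer_carrier[OF v] cone_carrier[OF step(2)]])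
qed simp

lemma cone_fidelity_le_trace: "cone R T T \<sigma> \<Longrightarrow> fidelity T \<sigma> \<le> Re (mtrace \<sigma>)"
proof (induction rule: cone.induct)
  case (step v \<sigma>)
  note v = schmidt_carrier[OF step(1)]
  show ?case using step(3) fidelity_outer_le_trace[OF v]
    by (simp add: fidelity_add[OF outer_carrier[OF v] cone_carrier[OF step(2)]]
        mtrace_add[OF outer_carrier[OF v] cone_carrier[OF step(2)]])
qed simp

lemma cone_fidelity_le: "cone R T T \<sigma> \<Longrightarrow> fidelity T \<sigma> \<le> real R / real T * Re (mtrace \<sigma>)"
proof (induction rule: cone.induct)
  case (step v \<sigma>)
  note v = schmidt_carrier[OF step(1)]
  show ?case using step(3) fidelity_outer_le_schmidt[OF step(1)]
    by (simp add: fidelity_add[OF outer_carrier[OF v] cone_carrier[OF step(2)]] distrib_left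
        mtrace_add[OF outer_carrier[OF v] cone_carrier[OF step(2)]])
qed simp

lemma cone_apply_local:
  assumes "cone R (d Alice) (d Bob) \<sigma>" "X \<in> carrier_mat e (d q)"
  shows "cone R ((d(q := e)) Alice) ((d(q := e)) Bob) (apply_local q d X \<sigma>)"
  using assms unfolding apply_local_conj_by local_op_def
  by (cases q) (auto intro!: cone_conj_kron)

text \<open>Every node acts on the state through local operators, finite sums and nonnegative
  scalings, so closure under these three is enough. The final dimensions are existentially
  quantified because a FAIL leaf may be reached at any local dimensions; only an output leaf fixes
  them to \<open>M\<close>.\<close>

lemma run_invariant:
  assumes op: "\<And>d q e X \<sigma>. Q d \<sigma> \<Longrightarrow> X \<in> carrier_mat e (d q) \<Longrightarrow> Q (d(q := e)) (apply_local q d X \<sigma>)"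
    and sum: "\<And>d As. (\<And>A. A \<in> set As \<Longrightarrow> Q d A) \<Longrightarrow> Q d (mat_sum (total_dim d) As)"
    and smult: "\<And>d c \<sigma>. 0 \<le> c \<Longrightarrow> Q d \<sigma> \<Longrightarrow> Q d (complex_of_real c \<cdot>\<^sub>m \<sigma>)"
  shows "wf_gepp M d P \<Longrightarrow> Q d \<sigma> \<Longrightarrow> (r, \<tau>) \<in> set (run d P \<sigma>) \<Longrightarrow>
    \<exists>d'. Q d' \<tau> \<and> (r \<noteq> None \<longrightarrow> d' Alice = M \<and> d' Bob = M)"
proof (induction M d P arbitrary: \<sigma> rule: wf_gepp.induct)
  case (3 M d q U P)
  have U: "U \<in> carrier_mat (d q) (d q)" using 3(2) by (simp add: unitary_mat_def)
  have "Q d (apply_local q d U \<sigma>)"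
    using op[OF 3(3) U] by (simp only: fun_upd_triv)
  then show ?case using 3 by simp
next
  case (4 M d q e P)
  then have P: "wf_gepp M (d(q := d q * e)) P"
    and rr: "(r, \<tau>) \<in> set (run (d(q := d q * e)) P (add_ancilla q e d \<sigma>))"
    by simp_all
  have "Q (d(q := d q * e)) (add_ancilla q e d \<sigma>)"
    unfolding add_ancilla_def by (rule op[OF 4(3) kron_ket_carrier(1)])
  then show ?case by (rule 4(1)[OF P _ rr])
next
  case (5 M d q e P)
  then have e: "e dvd d q" and P: "wf_gepp M (d(q := d q div e)) P"
    and r: "(r, \<tau>) \<in> set (run (d(q := d q div e)) P (discard_factor q e d \<sigma>))" by simp_all
  have "Q (d(q := d q div e)) (discard_factor q e d \<sigma>)"
    unfolding discard_factor_eq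
    using op[OF 5(3) discard_op_carrier[of e d q, OF e]]
    by (intro sum) (auto simp del: fun_upd_apply)
  then show ?case by (rule 5(1)[OF P _ r])
next
  case (6 M d q bs)
  then obtain b where b: "b \<in> set bs" "(r, \<tau>) \<in> set (run d (snd b) (apply_local q d (fst b) \<sigma>))"
    by auto
  have "fst b \<in> carrier_mat (d q) (d q)" using 6(2) b(1) by (auto simp: measurement_def)
  from op[OF 6(3) this] have "Q d (apply_local q d (fst b) \<sigma>)"
    by (simp only: fun_upd_triv)
  then show ?case using 6(1)[OF b(1) _ _ b(2)] 6(2) b(1) by simp
next
  case (7 M d bs)
  then obtain b where b: "b \<in> set bs" "(r, \<tau>) \<in> set (run d (snd b) (complex_of_real (fst b) \<cdot>\<^sub>m \<sigma>))"
    by auto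
  have "0 \<le> fst b" using 7(2) b(1) by (auto simp: distribution_def)
  from smult[OF this 7(3)] show ?case using 7(1)[OF b(1) _ _ b(2)] 7(2) b(1) by simp
qed auto

lemma cone_run:
  assumes "wf_gepp M d P" "cone R (d Alice) (d Bob) \<sigma>" "(r, \<tau>) \<in> set (run d P \<sigma>)"
  shows "\<exists>m n. cone R m n \<tau> \<and> (r \<noteq> None \<longrightarrow> m = M \<and> n = M)"
proof -
  have "\<exists>d'. cone R (d' Alice) (d' Bob) \<tau> \<and> (r \<noteq> None \<longrightarrow> d' Alice = M \<and> d' Bob = M)"
    by (rule run_invariant[where Q = "\<lambda>d. cone R (d Alice) (d Bob)", OF _ _ _ assms])
       (blast intro: cone_apply_local cone_mat_sum cone_smult)+
  then show ?thesis by blast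
qed

lemma run_carrier:
  assumes "wf_gepp M d P" "\<sigma> \<in> carrier_mat (total_dim d) (total_dim d)" "(Some l, \<tau>) \<in> set (run d P \<sigma>)"
  shows "\<tau> \<in> carrier_mat (M * M) (M * M)"
proof -
  have "\<exists>d'. \<tau> \<in> carrier_mat (total_dim d') (total_dim d') \<and> (Some l \<noteq> None \<longrightarrow> d' Alice = M \<and> d' Bob = M)"
    by (rule run_invariant[where Q = "\<lambda>d \<sigma>. \<sigma> \<in> carrier_mat (total_dim d) (total_dim d)", OF _ _ _ assms])
       (auto intro!: apply_local_carrier mat_sum_carrier simp del: fun_upd_apply)
  then show ?thesis by auto
qed

text \<open>Since branch states are unnormalised, this is the expected fidelity over single
  branches, with FAIL counted as 0. Summing over branches instead of labels makes it additive in the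
  input and insensitive to how branches are merged by labels.\<close>

definition total_fidelity :: "nat \<Rightarrow> (nat option \<times> complex mat) list \<Rightarrow> real" where
  "total_fidelity M bs = (\<Sum>b\<leftarrow>bs. if fst b = None then 0 else fidelity M (snd b))"

lemma total_fidelity_concat:
  "total_fidelity M (concat (map g xs)) = (\<Sum>x\<leftarrow>xs. total_fidelity M (g x))"
  by (simp add: total_fidelity_def sum_list_map_concat)

text \<open>Every step is additive in the state and so is the fidelity. This allows a mixed input to
  be treated component by component.\<close>

lemma total_fidelity_run_add:
  "wf_gepp M d P \<Longrightarrow> \<sigma> \<in> carrier_mat (total_dim d) (total_dim d) \<Longrightarrow>
   \<tau> \<in> carrier_mat (total_dim d) (total_dim d) \<Longrightarrow>
   total_fidelity M (run d P (\<sigma> + \<tau>)) = total_fidelity M (run d P \<sigma>) + total_fidelity M (run d P \<tau>)"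
proof (induction M d P arbitrary: \<sigma> \<tau> rule: wf_gepp.induct)
  case (2 M d l)
  then show ?case by (simp add: total_fidelity_def fidelity_add)
next
  case (3 M d q U P)
  have U: "U \<in> carrier_mat (d q) (d q)" and P: "wf_gepp M d P" using 3(2) by (simp_all add: unitary_mat_def)
  show ?case
    using 3(1)[OF P apply_local_square_carrier[of U d q, OF U 3(3)] apply_local_square_carrier[of U d q, OF U 3(4)]]
    by (simp add: apply_local_add[of _ "d q" d q, OF U 3(3,4)])
next
  case (4 M d q e P)
  then have P: "wf_gepp M (d(q := d q * e)) P" by simp
  have "add_ancilla q e d (\<sigma> + \<tau>) = add_ancilla q e d \<sigma> + add_ancilla q e d \<tau>"
    unfolding add_ancilla_def by (rule apply_local_add[of _ "d q * e" d q]) (use 4 in auto)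
  then show ?case
    using 4(1)[OF P add_ancilla_carrier[OF 4(3)] add_ancilla_carrier[OF 4(4)]] by (simp del: fun_upd_apply)
next
  case (5 M d q e P)
  then have e: "e dvd d q" and P: "wf_gepp M (d(q := d q div e)) P" by simp_all
  show ?case
    using 5(1)[OF P discard_factor_carrier[of e d q, OF e 5(3)] discard_factor_carrier[of e d q, OF e 5(4)]]
    by (simp add: discard_factor_add[of e d q, OF e 5(3,4)] del: fun_upd_apply)
next
  case (6 M d q bs)
  have "total_fidelity M (run d (snd b) (apply_local q d (fst b) (\<sigma> + \<tau>))) =
      total_fidelity M (run d (snd b) (apply_local q d (fst b) \<sigma>)) +
      total_fidelity M (run d (snd b) (apply_local q d (fst b) \<tau>))" if b: "b \<in> set bs" for b
  proof -
    have U: "fst b \<in> carrier_mat (d q) (d q)" and P: "wf_gepp M d (snd b)"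
      using 6(2) b by (auto simp: measurement_def)
    show ?thesis
      using 6(1)[OF b P apply_local_square_carrier[of "fst b" d q, OF U 6(3)] apply_local_square_carrier[of "fst b" d q, OF U 6(4)]]
      by (simp add: apply_local_add[of _ "d q" d q, OF U 6(3,4)])
  qed
  then show ?case by (simp add: total_fidelity_concat sum_list_addf cong: map_cong)
next
  case (7 M d bs)
  have "total_fidelity M (run d (snd b) (complex_of_real (fst b) \<cdot>\<^sub>m (\<sigma> + \<tau>))) =
      total_fidelity M (run d (snd b) (complex_of_real (fst b) \<cdot>\<^sub>m \<sigma>)) +
      total_fidelity M (run d (snd b) (complex_of_real (fst b) \<cdot>\<^sub>m \<tau>))" if b: "b \<in> set bs" for b
    using 7(1)[OF b, of "complex_of_real (fst b) \<cdot>\<^sub>m \<sigma>" "complex_of_real (fst b) \<cdot>\<^sub>m \<tau>"] 7(2-4) b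
    by (simp add: add_smult_distrib_left_mat[of _ "total_dim d" "total_dim d"])
  then show ?case by (simp add: total_fidelity_concat sum_list_addf cong: map_cong)
qed (simp add: total_fidelity_def)

section \<open>The input of a protocol\<close>

text \<open>Position of a basis vector in the order A A' B B': \<open>a\<close> and \<open>b\<close>
  index the given state, \<open>k\<close> and \<open>l\<close> the auxiliary state.\<close>

abbreviation quad_index :: "nat \<Rightarrow> nat \<Rightarrow> nat \<Rightarrow> nat \<Rightarrow> nat \<Rightarrow> nat \<Rightarrow> nat" where
  "quad_index N K a k b l \<equiv> (a * K + k) * (N * K) + (b * K + l)"

lemma quad_index_less:
  "a < N \<Longrightarrow> k < K \<Longrightarrow> b < N \<Longrightarrow> l < K \<Longrightarrow> quad_index N K a k b l < N * K * (N * K)"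
  by (intro pair_index_less)

lemma quad_index_cases:
  assumes "i < N * K * (N * K)"
  obtains a k b l where "a < N" "k < K" "b < N" "l < K" "i = quad_index N K a k b l"
proof
  show "i div (N * K) div K < N" "i div (N * K) mod K < K" "i mod (N * K) div K < N" "i mod (N * K) mod K < K"
    using div_less_of_mult[OF assms] mod_less_of_mult[OF assms]
    by (auto intro: div_less_of_mult mod_less_of_mult)
  show "i = quad_index N K (i div (N * K) div K) (i div (N * K) mod K) (i mod (N * K) div K) (i mod (N * K) mod K)"
    by (simp only: div_mult_mod_eq)
qed

lemma regroup_quad_index:
  assumes "a < N" "k < K" "b < N" "l < K"
  shows "regroup N K (quad_index N K a k b l) = (a * N + b) * (K * K) + (k * K + l)"
proof -
  have "b * K + l < N * K" using assms by (intro pair_index_less)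
  then have "quad_index N K a k b l div (N * K) = a * K + k" "quad_index N K a k b l mod (N * K) = b * K + l"
    by (rule pair_index_div_mod)+
  then show ?thesis using assms by (simp add: regroup_def Let_def)
qed

lemma sum_quad_index:
  fixes f :: "nat \<Rightarrow> 'a::comm_monoid_add"
  shows "(\<Sum>i<N * K * (N * K). f i) = (\<Sum>a<N. \<Sum>k<K. \<Sum>b<N. \<Sum>l<K. f (quad_index N K a k b l))"
  unfolding sum_lessThan_mult ..

lemma joint_input_carrier [simp]: "joint_input N K \<rho> \<in> carrier_mat (N * K * (N * K)) (N * K * (N * K))"
  by (simp add: joint_input_def)

lemma index_max_ent:
  "k < K \<Longrightarrow> l < K \<Longrightarrow> max_ent K $ (k * K + l) = (if k = l then complex_of_real (1 / sqrt (real K)) else 0)"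
  using pair_index_less[of k K l K] by (simp add: max_ent_def)

text \<open>The projector onto the auxiliary state has entry 1/K exactly where both of its index
  pairs are diagonal. Additivity, trace and purity of the joint input are all read off from this
  formula.\<close>

lemma index_joint_input:
  assumes \<rho>: "\<rho> \<in> carrier_mat (N * N) (N * N)"
    and i: "a < N" "k < K" "b < N" "l < K" and j: "a' < N" "k' < K" "b' < N" "l' < K"
  shows "joint_input N K \<rho> $$ (quad_index N K a k b l, quad_index N K a' k' b' l') =
    (if k = l \<and> k' = l' then \<rho> $$ (a * N + b, a' * N + b') / of_nat K else 0)"
proof -
  have p: "max_ent_proj K \<in> carrier_mat (K * K) (K * K)" by (simp add: max_ent_proj_def)
  have sq: "complex_of_real (1 / sqrt (real K)) * complex_of_real (1 / sqrt (real K)) = 1 / of_nat K"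
    unfolding of_real_mult[symmetric] by simp
  have lt: "a * N + b < N * N" "k * K + l < K * K" "a' * N + b' < N * N" "k' * K + l' < K * K"
    using i j by (auto intro: pair_index_less)
  have "joint_input N K \<rho> $$ (quad_index N K a k b l, quad_index N K a' k' b' l') =
    kron \<rho> (max_ent_proj K) $$ ((a * N + b) * (K * K) + (k * K + l), (a' * N + b') * (K * K) + (k' * K + l'))"
    unfolding joint_input_def
    by (simp only: index_mat quad_index_less[OF i] quad_index_less[OF j] split regroup_quad_index[OF i] regroup_quad_index[OF j])
  also have "\<dots> = \<rho> $$ (a * N + b, a' * N + b') * max_ent_proj K $$ (k * K + l, k' * K + l')"
    using lt by (simp only: index_kron[OF \<rho> p] pair_index_less pair_index_div_mod)
  also have "max_ent_proj K $$ (k * K + l, k' * K + l') = (if k = l \<and> k' = l' then 1 / of_nat K else 0)"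
  proof -
    have "max_ent_proj K $$ (k * K + l, k' * K + l') = max_ent K $ (k * K + l) * cnj (max_ent K $ (k' * K + l'))"
      using lt by (simp add: max_ent_proj_def)
    then show ?thesis
      using i j sq unfolding index_max_ent[OF i(2,4)] index_max_ent[OF j(2,4)]
      by (cases "k = l"; cases "k' = l'") (simp_all only: complex_cnj_complex_of_real complex_cnj_zero if_True if_False
          mult_zero_left mult_zero_right conj_absorb simp_thms)
  qed
  finally show ?thesis by simp
qed

lemma joint_input_add:
  assumes "\<rho> \<in> carrier_mat (N * N) (N * N)" "\<tau> \<in> carrier_mat (N * N) (N * N)"
  shows "joint_input N K (\<rho> + \<tau>) = joint_input N K \<rho> + joint_input N K \<tau>"
proof (rule eq_matI)
  fix i j assume "i < dim_row (joint_input N K \<rho> + joint_input N K \<tau>)" "j < dim_col (joint_input N K \<rho> + joint_input N K \<tau>)"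
  then have ij: "i < N * K * (N * K)" "j < N * K * (N * K)" by (auto simp: joint_input_def)
  obtain a k b l where i: "a < N" "k < K" "b < N" "l < K" "i = quad_index N K a k b l"
    using quad_index_cases[OF ij(1)] .
  obtain a' k' b' l' where j: "a' < N" "k' < K" "b' < N" "l' < K" "j = quad_index N K a' k' b' l'"
    using quad_index_cases[OF ij(2)] .
  have lt: "a * N + b < N * N" "a' * N + b' < N * N"
    using i j by (auto intro: pair_index_less)
  have "(joint_input N K \<rho> + joint_input N K \<tau>) $$ (i, j) = joint_input N K \<rho> $$ (i, j) + joint_input N K \<tau> $$ (i, j)"
    using ij by (intro index_add_mat) (auto simp: joint_input_def)
  then show "joint_input N K (\<rho> + \<tau>) $$ (i, j) = (joint_input N K \<rho> + joint_input N K \<tau>) $$ (i, j)"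
    using assms lt index_joint_input[OF assms(1) i(1-4) j(1-4)] index_joint_input[OF assms(2) i(1-4) j(1-4)]
      index_joint_input[OF add_carrier_mat[OF assms(2), of \<rho>] i(1-4) j(1-4)]
    by (auto simp: i(5) j(5) add_divide_distrib)
qed (auto simp: joint_input_def)

lemma joint_input_smult:
  assumes \<rho>: "\<rho> \<in> carrier_mat (N * N) (N * N)"
  shows "joint_input N K (c \<cdot>\<^sub>m \<rho>) = c \<cdot>\<^sub>m joint_input N K \<rho>"
proof (rule eq_matI)
  fix i j assume "i < dim_row (c \<cdot>\<^sub>m joint_input N K \<rho>)" "j < dim_col (c \<cdot>\<^sub>m joint_input N K \<rho>)"
  then have ij: "i < N * K * (N * K)" "j < N * K * (N * K)" by (auto simp: joint_input_def)
  obtain a k b l where i: "a < N" "k < K" "b < N" "l < K" "i = quad_index N K a k b l"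
    using quad_index_cases[OF ij(1)] .
  obtain a' k' b' l' where j: "a' < N" "k' < K" "b' < N" "l' < K" "j = quad_index N K a' k' b' l'"
    using quad_index_cases[OF ij(2)] .
  have lt: "a * N + b < N * N" "a' * N + b' < N * N"
    using i j by (auto intro: pair_index_less)
  have "(c \<cdot>\<^sub>m joint_input N K \<rho>) $$ (i, j) = c * joint_input N K \<rho> $$ (i, j)"
    using ij by (intro index_smult_mat) (auto simp: joint_input_def)
  then show "joint_input N K (c \<cdot>\<^sub>m \<rho>) $$ (i, j) = (c \<cdot>\<^sub>m joint_input N K \<rho>) $$ (i, j)"
    using \<rho> lt index_joint_input[OF \<rho> i(1-4) j(1-4)] index_joint_input[OF smult_carrier_mat[OF \<rho>] i(1-4) j(1-4)]
    by (auto simp: i(5) j(5))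
qed (auto simp: joint_input_def)

lemma mtrace_joint_input:
  assumes \<rho>: "\<rho> \<in> carrier_mat (N * N) (N * N)" and K: "1 \<le> K"
  shows "mtrace (joint_input N K \<rho>) = mtrace \<rho>"
proof -
  have "mtrace (joint_input N K \<rho>) =
      (\<Sum>a<N. \<Sum>k<K. \<Sum>b<N. \<Sum>l<K. if l = k then \<rho> $$ (a * N + b, a * N + b) / of_nat K else 0)"
    unfolding mtrace_def carrier_matD(1)[OF joint_input_carrier] sum_quad_index
    by (intro sum.cong refl) (auto simp: index_joint_input[OF \<rho>])
  also have "\<dots> = (\<Sum>a<N. \<Sum>b<N. \<rho> $$ (a * N + b, a * N + b))"
    using K by (simp add: sum.swap[of _ "{..<N}" "{..<K}"] sum_divide_distrib[symmetric])
  also have "\<dots> = mtrace \<rho>"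
    using \<rho> by (simp add: mtrace_def sum_lessThan_mult)
  finally show ?thesis .
qed

text \<open>The amplitudes of \<open>u\<close> tensored with the auxiliary vector, already in the
  regrouped order, so that pure inputs can be handled as vectors.\<close>

definition joint_vec :: "nat \<Rightarrow> nat \<Rightarrow> complex mat \<Rightarrow> complex mat" where
  "joint_vec N K u = mat (N * K * (N * K)) 1
     (\<lambda>(i, _). let x = i div (N * K); y = i mod (N * K) in
        if x mod K = y mod K then u $$ (x div K * N + y div K, 0) / complex_of_real (sqrt (real K)) else 0)"

lemma joint_vec_carrier: "joint_vec N K u \<in> carrier_mat (N * K * (N * K)) 1"
  by (simp add: joint_vec_def)

lemma index_joint_vec:
  assumes i: "a < N" "k < K" "b < N" "l < K"
  shows "joint_vec N K u $$ (quad_index N K a k b l, 0) =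
    (if k = l then u $$ (a * N + b, 0) / complex_of_real (sqrt (real K)) else 0)"
proof -
  have "b * K + l < N * K" using assms by (intro pair_index_less)
  then have "quad_index N K a k b l div (N * K) = a * K + k" "quad_index N K a k b l mod (N * K) = b * K + l"
    by (rule pair_index_div_mod)+
  then show ?thesis using i quad_index_less[OF i] by (simp add: joint_vec_def Let_def)
qed

lemma joint_input_outer:
  assumes u: "u \<in> carrier_mat (N * N) 1"
  shows "joint_input N K (u * mat_adjoint u) = joint_vec N K u * mat_adjoint (joint_vec N K u)"
proof (rule eq_matI)
  have sq: "complex_of_real (sqrt (real K)) * complex_of_real (sqrt (real K)) = of_nat K"
    unfolding of_real_mult[symmetric] by simp
  fix i j assume "i < dim_row (joint_vec N K u * mat_adjoint (joint_vec N K u))"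
    "j < dim_col (joint_vec N K u * mat_adjoint (joint_vec N K u))"
  then have ij: "i < N * K * (N * K)" "j < N * K * (N * K)" by (auto simp: joint_vec_def)
  obtain a k b l where i: "a < N" "k < K" "b < N" "l < K" "i = quad_index N K a k b l"
    using quad_index_cases[OF ij(1)] .
  obtain a' k' b' l' where j: "a' < N" "k' < K" "b' < N" "l' < K" "j = quad_index N K a' k' b' l'"
    using quad_index_cases[OF ij(2)] .
  have lt: "a * N + b < N * N" "a' * N + b' < N * N"
    using i j by (auto intro: pair_index_less)
  show "joint_input N K (u * mat_adjoint u) $$ (i, j) = (joint_vec N K u * mat_adjoint (joint_vec N K u)) $$ (i, j)"
    unfolding index_outer[OF joint_vec_carrier ij]
    unfolding i(5) j(5) index_joint_input[OF outer_carrier[OF u] i(1-4) j(1-4)] index_outer[OF u lt]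
      index_joint_vec[OF i(1-4)] index_joint_vec[OF j(1-4)]
    using sq by simp
qed (auto simp: joint_vec_def joint_input_def)

text \<open>A matrix is the sum of its rows, each placed by an indicator: the row index is the left
  factor and the row itself the right factor.\<close>

lemma schmidt_full:
  assumes "w \<in> carrier_mat (m * n) 1"
  shows "schmidt m m n w"
  unfolding schmidt_def
  by (intro conjI assms exI[of _ "\<lambda>k x. if k = x then 1 else 0"] exI[of _ "\<lambda>k y. w $$ (k * n + y, 0)"])
     (auto simp: if_distrib[of "\<lambda>t. t * _"] cong: if_cong)

text \<open>The product vector |00> with amplitude \<open>c\<close>; the test mixture takes for
  \<open>c\<close> the square root of its weight.\<close>

definition corner_vec :: "nat \<Rightarrow> complex \<Rightarrow> complex mat" where
  "corner_vec N c = mat (N * N) 1 (\<lambda>(i, _). if i = 0 then c else 0)"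

lemma corner_vec_carrier: "corner_vec N c \<in> carrier_mat (N * N) 1"
  by (simp add: corner_vec_def)

text \<open>The given factor is in the state |00>, so the coefficient matrix across the cut is a
  multiple of the identity on the first \<open>K\<close> indices of each party: all entanglement
  comes from the auxiliary state.\<close>

lemma schmidt_joint_corner: "schmidt K (N * K) (N * K) (joint_vec N K (corner_vec N c))"
proof -
  let ?c = "c / complex_of_real (sqrt (real K))"
  have "joint_vec N K (corner_vec N c) $$ (x * (N * K) + y, 0) =
      (\<Sum>k<K. (if x = k then 1 else 0) * (if y = k then ?c else 0))" if x: "x < N * K" and y: "y < N * K" for x y
  proof -
    have K: "0 < K" using x by (cases K) auto
    have "joint_vec N K (corner_vec N c) $$ (quad_index N K (x div K) (x mod K) (y div K) (y mod K), 0) =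
        (if x mod K = y mod K then corner_vec N c $$ (x div K * N + y div K, 0) / complex_of_real (sqrt (real K)) else 0)"
      by (rule index_joint_vec) (use x y div_less_of_mult mod_less_of_mult in auto)
    also have "corner_vec N c $$ (x div K * N + y div K, 0) = (if x div K = 0 \<and> y div K = 0 then c else 0)"
      using pair_index_less[OF div_less_of_mult[OF x] div_less_of_mult[OF y]] div_less_of_mult[OF x]
      by (auto simp: corner_vec_def)
    finally have eq: "joint_vec N K (corner_vec N c) $$ (x * (N * K) + y, 0) =
        (if x < K \<and> y < K \<and> x = y then ?c else 0)"
      using K by (auto simp: div_eq_0_iff)
    show ?thesis unfolding eq by (auto simp: if_distrib[of "\<lambda>t. t * _"] cong: if_cong)
  qed
  then show ?thesis unfolding schmidt_def
    by (intro conjI joint_vec_carrier exI[of _ "\<lambda>k x. if x = k then 1 else 0"] exI[of _ "\<lambda>k y. if y = k then ?c else 0"]) auto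
qed

section \<open>The lower bound\<close>

text \<open>The quadratic form is the squared modulus of the inner product of \<open>u\<close> and
  \<open>v\<close>.\<close>

lemma quadratic_form_outer_nonneg:
  fixes u :: "complex mat"
  assumes u: "u \<in> carrier_mat n 1" and v: "v \<in> carrier_vec n"
  shows "(u * mat_adjoint u *\<^sub>v v) \<bullet>c v \<ge> 0"
proof -
  have "(u * mat_adjoint u *\<^sub>v v) $ i = u $$ (i, 0) * (\<Sum>j<n. cnj (u $$ (j, 0)) * v $ j)" if i: "i < n" for i
  proof -
    have "(u * mat_adjoint u *\<^sub>v v) $ i = (\<Sum>j<n. (u * mat_adjoint u) $$ (i, j) * v $ j)"
      using outer_carrier[OF u] i v by (auto simp: scalar_prod_def atLeast0LessThan simp del: index_mult_mat(1) intro!: sum.cong)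
    also have "\<dots> = (\<Sum>j<n. u $$ (i, 0) * (cnj (u $$ (j, 0)) * v $ j))"
      using i by (intro sum.cong refl) (simp add: index_outer[OF u] del: index_mult_mat)
    finally show ?thesis by (simp add: sum_distrib_left)
  qed
  moreover have "(u * mat_adjoint u *\<^sub>v v) \<bullet>c v = (\<Sum>i<n. (u * mat_adjoint u *\<^sub>v v) $ i * cnj (v $ i))"
    using v by (auto simp: scalar_prod_def atLeast0LessThan intro!: sum.cong)
  ultimately have "(u * mat_adjoint u *\<^sub>v v) \<bullet>c v =
      (\<Sum>i<n. u $$ (i, 0) * (\<Sum>j<n. cnj (u $$ (j, 0)) * v $ j) * cnj (v $ i))"
    by simp
  also have "\<dots> = (\<Sum>j<n. cnj (u $$ (j, 0)) * v $ j) * cnj (\<Sum>j<n. cnj (u $$ (j, 0)) * v $ j)"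
    by (simp add: cnj_sum sum_distrib_left mult_ac)
  also have "\<dots> = complex_of_real ((cmod (\<Sum>j<n. cnj (u $$ (j, 0)) * v $ j))\<^sup>2)"
    by (rule complex_norm_square[symmetric])
  finally show ?thesis by (simp add: less_eq_complex_def)
qed

lemma density_outer_add:
  assumes u: "u \<in> carrier_mat n 1" and w: "w \<in> carrier_mat n 1"
    and tr: "mtrace (u * mat_adjoint u) + mtrace (w * mat_adjoint w) = 1"
  shows "density n (u * mat_adjoint u + w * mat_adjoint w)"
  unfolding density_def
proof (intro conjI ballI)
  show "u * mat_adjoint u + w * mat_adjoint w \<in> carrier_mat n n"
    by (rule add_carrier_mat[OF outer_carrier[OF w]])
  show "mtrace (u * mat_adjoint u + w * mat_adjoint w) = 1"
    using tr mtrace_add[OF outer_carrier[OF u] outer_carrier[OF w]] by simp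
  fix v :: "complex vec" assume v: "v \<in> carrier_vec n"
  have c: "u * mat_adjoint u *\<^sub>v v \<in> carrier_vec n" "w * mat_adjoint w *\<^sub>v v \<in> carrier_vec n"
    using outer_carrier[OF u] outer_carrier[OF w] by (meson mult_mat_vec_carrier v)+
  have "((u * mat_adjoint u + w * mat_adjoint w) *\<^sub>v v) \<bullet>c v =
      (u * mat_adjoint u *\<^sub>v v) \<bullet>c v + (w * mat_adjoint w *\<^sub>v v) \<bullet>c v"
    unfolding add_mult_distrib_mat_vec[OF outer_carrier[OF u] outer_carrier[OF w] v]
    by (rule add_scalar_prod_distrib[OF c]) (use v in simp)
  then show "0 \<le> ((u * mat_adjoint u + w * mat_adjoint w) *\<^sub>v v) \<bullet>c v"
    using quadratic_form_outer_nonneg[OF u v] quadratic_form_outer_nonneg[OF w v] by (simp add: add_nonneg_nonneg)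
qed

text \<open>A branch has at most one label, hence is counted at most once on the left; the branches
  left out contribute nonnegative terms on the right.\<close>

lemma sum_filter_Some_le:
  fixes g :: "nat option \<times> 'b \<Rightarrow> real"
  assumes "finite G" "\<And>b. b \<in> set bs \<Longrightarrow> fst b \<noteq> None \<Longrightarrow> 0 \<le> g b"
  shows "(\<Sum>l\<in>G. \<Sum>b\<leftarrow>filter (\<lambda>b. fst b = Some l) bs. g b) \<le> (\<Sum>b\<leftarrow>bs. if fst b = None then 0 else g b)"
  using assms(2)
proof (induction bs)
  case (Cons b bs)
  have "(\<Sum>l\<in>G. \<Sum>b\<leftarrow>filter (\<lambda>b. fst b = Some l) (b # bs). g b) =
      (\<Sum>l\<in>G. if fst b = Some l then g b else 0) + (\<Sum>l\<in>G. \<Sum>b\<leftarrow>filter (\<lambda>b. fst b = Some l) bs. g b)"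
    unfolding sum.distrib[symmetric] by (intro sum.cong) auto
  moreover have "(\<Sum>l\<in>G. if fst b = Some l then g b else 0) \<le> (if fst b = None then 0 else g b)"
    using assms(1) Cons.prems[of b] by (cases "fst b") auto
  ultimately show ?case using Cons by fastforce
qed auto

text \<open>For a label whose output is good enough, multiplying by its probability turns the bound
  on the normalised state into a bound on the sum of its branches. The good labels have total
  probability 1, and all other branches only add nonnegative fidelity.\<close>

lemma total_fidelity_ge:
  assumes cone: "\<And>b. b \<in> set (branches N K P \<rho>) \<Longrightarrow> fst b \<noteq> None \<Longrightarrow> cone R M M (snd b)"
    and p: "prob_fidelity_ge N K M P \<rho> t = 1"
  shows "t \<le> total_fidelity M (branches N K P \<rho>)"
proof -
  define bs where "bs = branches N K P \<rho>"
  define G where "G = {l. Some l \<in> fst ` set bs \<and> t \<le> fidelity M (output_state N K M P \<rho> l)}"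
  have "finite {l. Some l \<in> fst ` set bs}"
    using finite_vimageI[of "fst ` set bs" Some] by (simp add: vimage_def)
  then have fin: "finite G" unfolding G_def by simp
  have le: "t * outcome_prob N K P \<rho> (Some l) \<le> (\<Sum>b\<leftarrow>filter (\<lambda>b. fst b = Some l) bs. fidelity M (snd b))"
    if l: "l \<in> G" for l
  proof -
    let ?B = "filter (\<lambda>b. fst b = Some l) bs" and ?p = "outcome_prob N K P \<rho> (Some l)"
    have B: "cone R M M (snd b)" if "b \<in> set ?B" for b using that cone[of b] by (auto simp: bs_def)
    have p0: "0 \<le> ?p"
      unfolding outcome_prob_def bs_def[symmetric] using cone_trace_nonneg[OF B] by (intro sum_list_nonneg) auto
    have f0: "0 \<le> (\<Sum>b\<leftarrow>?B. fidelity M (snd b))"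
      using cone_fidelity_nonneg[OF B] by (intro sum_list_nonneg) auto
    have c: "set (map snd ?B) \<subseteq> carrier_mat (M * M) (M * M)"
      using cone_carrier[OF B] by auto
    have "fidelity M (output_state N K M P \<rho> l) = 1 / ?p * (\<Sum>b\<leftarrow>?B. fidelity M (snd b))"
      unfolding output_state_def bs_def[symmetric] fidelity_smult[OF mat_sum_carrier[OF c]] fidelity_mat_sum[OF c]
      by (simp add: comp_def)
    then have "t \<le> 1 / ?p * (\<Sum>b\<leftarrow>?B. fidelity M (snd b))" using l by (simp add: G_def)
    \<comment> \<open>With probability 0 the normalised state is a junk value, but then the left
      side is 0 and nonnegativity of the branch fidelities is enough.\<close>
    then show ?thesis using p0 f0 by (cases "?p = 0") (auto simp: field_simps)
  qed
  have "t = t * (\<Sum>l\<in>G. outcome_prob N K P \<rho> (Some l))"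
    using p unfolding prob_fidelity_ge_def G_def bs_def by simp
  also have "\<dots> \<le> (\<Sum>l\<in>G. \<Sum>b\<leftarrow>filter (\<lambda>b. fst b = Some l) bs. fidelity M (snd b))"
    unfolding sum_distrib_left by (rule sum_mono[OF le])
  also have "\<dots> \<le> total_fidelity M bs"
    unfolding total_fidelity_def
    by (rule sum_filter_Some_le[OF fin]) (use cone_fidelity_nonneg[OF cone] in \<open>auto simp: bs_def\<close>)
  finally show ?thesis by (simp add: bs_def)
qed

text \<open>A bound by \<open>c\<close> times the probability holds on each branch, and the
  probabilities add up to the trace of the input. It is applied with \<open>c\<close> = 1 to the
  maximally entangled component and with \<open>c\<close> = K/M to the product component.\<close>

lemma total_fidelity_run_le:
  assumes wf: "wf_gepp M d P" and \<sigma>: "cone R (d Alice) (d Bob) \<sigma>" and c: "0 \<le> c"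
    and le: "\<And>\<tau>. cone R M M \<tau> \<Longrightarrow> fidelity M \<tau> \<le> c * Re (mtrace \<tau>)"
  shows "total_fidelity M (run d P \<sigma>) \<le> c * Re (mtrace \<sigma>)"
proof -
  \<comment> \<open>A FAIL branch contributes 0, which is covered by nonnegativity of its trace; an
    output branch has both local dimensions equal to \<open>M\<close>, so \<open>le\<close>
    applies.\<close>
  have "(if fst b = None then 0 else fidelity M (snd b)) \<le> c * Re (mtrace (snd b))" if "b \<in> set (run d P \<sigma>)" for b
    using cone_run[OF wf \<sigma>, of "fst b" "snd b"] that le[of "snd b"] cone_trace_nonneg[of R _ _ "snd b"] c by auto
  then have "total_fidelity M (run d P \<sigma>) \<le> (\<Sum>b\<leftarrow>run d P \<sigma>. c * Re (mtrace (snd b)))"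
    unfolding total_fidelity_def by (rule sum_list_mono)
  also have "\<dots> = c * Re (\<Sum>b\<leftarrow>run d P \<sigma>. mtrace (snd b))"
  proof -
    have "(\<Sum>b\<leftarrow>bs. c * Re (mtrace (snd b))) = c * Re (\<Sum>b\<leftarrow>bs. mtrace (snd b))" for bs :: "(nat option \<times> complex mat) list"
      by (induction bs) (auto simp: distrib_left)
    then show ?thesis .
  qed
  finally show ?thesis using mtrace_run[OF wf cone_carrier[OF \<sigma>]] by simp
qed

section \<open>The two components of the test mixture\<close>

definition max_ent_vec :: "nat \<Rightarrow> complex \<Rightarrow> complex mat" where
  "max_ent_vec N c = mat (N * N) 1 (\<lambda>(i, _). c * max_ent N $ i)"

lemma max_ent_vec_carrier: "max_ent_vec N c \<in> carrier_mat (N * N) 1"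
  by (simp add: max_ent_vec_def)

lemma index_max_ent_vec:
  "x < N \<Longrightarrow> y < N \<Longrightarrow>
   max_ent_vec N c $$ (x * N + y, 0) = (if x = y then c * complex_of_real (1 / sqrt (real N)) else 0)"
  using pair_index_less[of x N y N] by (auto simp: max_ent_vec_def index_max_ent)

lemma max_ent_vec_state:
  assumes "1 \<le> N"
  shows "mtrace (max_ent_vec N c * mat_adjoint (max_ent_vec N c)) = complex_of_real ((cmod c)\<^sup>2)"
    and "fidelity N (max_ent_vec N c * mat_adjoint (max_ent_vec N c)) = (cmod c)\<^sup>2"
proof -
  have "(\<Sum>x<N. \<Sum>y<N. (cmod (max_ent_vec N c $$ (x * N + y, 0)))\<^sup>2) =
      (\<Sum>x<N. \<Sum>y<N. if y = x then (cmod c)\<^sup>2 / real N else 0)"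
    by (intro sum.cong refl) (auto simp: index_max_ent_vec norm_mult norm_divide power_mult_distrib power_divide)
  also have "\<dots> = (cmod c)\<^sup>2" using assms by simp
  finally show "mtrace (max_ent_vec N c * mat_adjoint (max_ent_vec N c)) = complex_of_real ((cmod c)\<^sup>2)"
    unfolding mtrace_outer[OF max_ent_vec_carrier] sum_lessThan_mult by simp
  have "(\<Sum>x<N. max_ent_vec N c $$ (x * N + x, 0)) = of_nat N * (c * complex_of_real (1 / sqrt (real N)))"
    by (simp add: index_max_ent_vec)
  also have "\<dots> = c * complex_of_real (sqrt (real N))"
    using assms real_div_sqrt[of "real N"]
    by (metis (no_types, opaque_lifting) mult.left_commute of_nat_0_le_iff of_real_mult of_real_of_nat_eq times_divide_eq_right mult.right_neutral)
  finally show "fidelity N (max_ent_vec N c * mat_adjoint (max_ent_vec N c)) = (cmod c)\<^sup>2"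
    unfolding fidelity_outer[OF max_ent_vec_carrier] using assms by (simp add: norm_mult power_mult_distrib)
qed

lemma corner_vec_state:
  assumes "1 \<le> N"
  shows "mtrace (corner_vec N c * mat_adjoint (corner_vec N c)) = complex_of_real ((cmod c)\<^sup>2)"
    and "fidelity N (corner_vec N c * mat_adjoint (corner_vec N c)) = (cmod c)\<^sup>2 / real N"
proof -
  have "(\<Sum>i<N * N. (cmod (corner_vec N c $$ (i, 0)))\<^sup>2) = (\<Sum>i<N * N. if i = 0 then (cmod c)\<^sup>2 else 0)"
    by (intro sum.cong refl) (auto simp: corner_vec_def)
  also have "\<dots> = (cmod c)\<^sup>2" using assms by simp
  finally show "mtrace (corner_vec N c * mat_adjoint (corner_vec N c)) = complex_of_real ((cmod c)\<^sup>2)"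
    unfolding mtrace_outer[OF corner_vec_carrier] by simp
  have "(\<Sum>x<N. corner_vec N c $$ (x * N + x, 0)) = (\<Sum>x<N. if x = 0 then c else 0)"
    using pair_index_less by (intro sum.cong refl) (auto simp: corner_vec_def)
  also have "\<dots> = c" using assms by simp
  finally show "fidelity N (corner_vec N c * mat_adjoint (corner_vec N c)) = (cmod c)\<^sup>2 / real N"
    unfolding fidelity_outer[OF corner_vec_carrier] by simp
qed

text \<open>The condition relating \<open>p\<close> and \<epsilon> says that the mixture is an
  admissible input, since replacing weight \<open>p\<close> of the maximally entangled state by |00>
  loses \<open>p * (1 - 1 / real N)\<close> of fidelity. The weight is kept free because the value 0
  is also used later.\<close>

lemma absolutely_successful_bound:
  assumes succ: "absolutely_successful N K M \<epsilon> \<delta> P"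
    and N: "1 \<le> N" and K: "1 \<le> K" and M: "1 \<le> M" and p: "0 \<le> p" "p \<le> 1" "p * (1 - 1 / real N) \<le> \<epsilon>"
  shows "1 - \<delta> \<le> (1 - p) + p * (real K / real M)"
proof -
  define u where "u = max_ent_vec N (complex_of_real (sqrt (1 - p)))"
  define w where "w = corner_vec N (complex_of_real (sqrt p))"
  define \<rho> where "\<rho> = u * mat_adjoint u + w * mat_adjoint w"
  define d :: "party \<Rightarrow> nat" where "d = (\<lambda>_. N * K)"
  have u: "u \<in> carrier_mat (N * N) 1" and w: "w \<in> carrier_mat (N * N) 1"
    unfolding u_def w_def by (rule max_ent_vec_carrier corner_vec_carrier)+
  have tr: "mtrace (u * mat_adjoint u) = complex_of_real (1 - p)" "mtrace (w * mat_adjoint w) = complex_of_real p"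
    and fid: "fidelity N (u * mat_adjoint u) = 1 - p" "fidelity N (w * mat_adjoint w) = p / real N"
    using p by (simp_all add: u_def w_def max_ent_vec_state[OF N] corner_vec_state[OF N])
  have dens: "density (N * N) \<rho>"
    unfolding \<rho>_def by (rule density_outer_add[OF u w]) (simp add: tr)
  have "fidelity N \<rho> = 1 - p * (1 - 1 / real N)"
    unfolding \<rho>_def by (simp add: fidelity_add[OF outer_carrier[OF u] outer_carrier[OF w]] fid algebra_simps)
  then have "fidelity N \<rho> \<ge> 1 - \<epsilon>" using p by simp
  then have prob: "prob_fidelity_ge N K M P \<rho> (1 - \<delta>) = 1" and wf: "wf_gepp M d P"
    using succ dens by (auto simp: absolutely_successful_def is_gepp_def d_def)
  define \<sigma> where "\<sigma> = joint_input N K (u * mat_adjoint u)"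
  define \<tau> where "\<tau> = joint_input N K (w * mat_adjoint w)"
  have joint: "joint_input N K \<rho> = \<sigma> + \<tau>"
    unfolding \<rho>_def \<sigma>_def \<tau>_def by (rule joint_input_add[OF outer_carrier[OF u] outer_carrier[OF w]])
  \<comment> \<open>The rank bound \<open>N * K\<close> holds for every vector of the joint input;
    membership with this bound supplies positivity of all branches of the mixture.\<close>
  have \<sigma>: "cone (N * K) (d Alice) (d Bob) \<sigma>" and \<tau>': "cone (N * K) (d Alice) (d Bob) \<tau>"
    unfolding \<sigma>_def \<tau>_def joint_input_outer[OF u] joint_input_outer[OF w] d_def
    by (intro cone_outer schmidt_full joint_vec_carrier)+
  \<comment> \<open>The same component lies in the much smaller cone of Schmidt number
    \<open>K\<close>, and this is what yields the factor K/M.\<close>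
  have \<tau>: "cone K (d Alice) (d Bob) \<tau>"
    unfolding \<tau>_def joint_input_outer[OF w] d_def by (intro cone_outer) (simp add: w_def schmidt_joint_corner)
  have "1 - \<delta> \<le> total_fidelity M (branches N K P \<rho>)"
  proof (rule total_fidelity_ge[OF _ prob])
    fix b assume "b \<in> set (branches N K P \<rho>)" "fst b \<noteq> None"
    then show "cone (N * K) M M (snd b)"
      using cone_run[OF wf cone_add[OF \<sigma> \<tau>'], of "fst b" "snd b"] by (auto simp: branches_def joint d_def)
  qed
  also have "\<dots> = total_fidelity M (run d P \<sigma>) + total_fidelity M (run d P \<tau>)"
    unfolding branches_def joint d_def[symmetric]
    by (rule total_fidelity_run_add[OF wf cone_carrier[OF \<sigma>] cone_carrier[OF \<tau>]])
  also have "total_fidelity M (run d P \<sigma>) \<le> 1 * Re (mtrace \<sigma>)"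
    by (rule total_fidelity_run_le[OF wf \<sigma>]) (auto simp: cone_fidelity_le_trace)
  also have "total_fidelity M (run d P \<tau>) \<le> real K / real M * Re (mtrace \<tau>)"
    by (rule total_fidelity_run_le[OF wf \<tau>]) (simp, erule cone_fidelity_le)
  finally show ?thesis
    using mtrace_joint_input[OF outer_carrier[OF u] K] mtrace_joint_input[OF outer_carrier[OF w] K]
    by (simp add: \<sigma>_def \<tau>_def tr mult.commute)
qed

text \<open>For K < M the weight is chosen so that the mixture has fidelity exactly 1 - \<epsilon>,
  and the upper bound on \<epsilon> says that this weight is at most 1. Otherwise the right side is
  nonpositive, and the pure maximally entangled input, with weight 0, already forces \<delta> to be
  nonnegative.\<close>

lemma delta_lower_bound:
  assumes N: "2 \<le> N" and K: "1 \<le> K" and M: "1 \<le> M" and \<epsilon>: "0 \<le> \<epsilon>" "K < M \<longrightarrow> \<epsilon> \<le> 1 - 1 / real N"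
    and succ: "absolutely_successful N K M \<epsilon> \<delta> P"
  shows "\<delta> \<ge> (real M - real K) / real M * (real N / (real N - 1)) * \<epsilon>"
proof (cases "K < M")
  case True
  define p where "p = real N / (real N - 1) * \<epsilon>"
  have p: "p * (1 - 1 / real N) = \<epsilon>" using N by (simp add: p_def field_simps)
  have "0 \<le> p" using N \<epsilon> by (simp add: p_def)
  moreover have "p \<le> 1" using True N \<epsilon> by (simp add: p_def field_simps)
  ultimately have "1 - \<delta> \<le> (1 - p) + p * (real K / real M)"
    using absolutely_successful_bound[OF succ _ K M] N p by simp
  moreover have MK: "(real M - real K) / real M = 1 - real K / real M" using M by (simp add: diff_divide_distrib)
  have "(real M - real K) / real M * (real N / (real N - 1)) * \<epsilon> = p - p * (real K / real M)"
    unfolding MK mult.assoc p_def[symmetric] by (simp add: algebra_simps)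
  ultimately show ?thesis by linarith
next
  case False
  have "0 \<le> \<delta>" using absolutely_successful_bound[OF succ _ K M, of 0] N \<epsilon> by simp
  moreover have "(real M - real K) / real M * (real N / (real N - 1)) * \<epsilon> \<le> 0"
    using False N \<epsilon>(1) by (intro mult_nonpos_nonneg) (auto intro!: mult_nonpos_nonneg simp: divide_nonpos_nonneg)
  ultimately show ?thesis by linarith
qed

section \<open>Partial basis maps\<close>

text \<open>The 0/1 matrix of a partial function on basis states. The measurement and discard
  operators of the optimal protocol have this form, so their products reduce to composition of
  partial functions.\<close>

definition map_op :: "nat \<Rightarrow> nat \<Rightarrow> (nat \<Rightarrow> nat) \<Rightarrow> nat set \<Rightarrow> complex mat" where
  "map_op r c f S = mat r c (\<lambda>(i, j). of_bool (j \<in> S \<and> f j = i))"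

lemma map_op_carrier [simp]: "map_op r c f S \<in> carrier_mat r c"
  by (simp add: map_op_def)

lemma index_map_op: "i < r \<Longrightarrow> j < c \<Longrightarrow> map_op r c f S $$ (i, j) = of_bool (j \<in> S \<and> f j = i)"
  by (simp add: map_op_def)

text \<open>The range condition matters: a value of \<open>g\<close> at or beyond \<open>c\<close>
  would give a zero column in the second factor, while the composed map could still be nonzero
  there.\<close>

lemma map_op_mult:
  assumes "\<And>j. j < k \<Longrightarrow> j \<in> S' \<Longrightarrow> g j < c"
  shows "map_op r c f S * map_op c k g S' = map_op r k (\<lambda>j. f (g j)) {j \<in> S'. g j \<in> S}"
proof (rule eq_matI)
  fix i j assume "i < dim_row (map_op r k (\<lambda>j. f (g j)) {j \<in> S'. g j \<in> S})"
    "j < dim_col (map_op r k (\<lambda>j. f (g j)) {j \<in> S'. g j \<in> S})"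
  then have i: "i < r" and j: "j < k" by (auto simp: map_op_def)
  have "(map_op r c f S * map_op c k g S') $$ (i, j) =
      (\<Sum>t<c. map_op r c f S $$ (i, t) * map_op c k g S' $$ (t, j))"
    by (rule index_mult_sum) (use i j in auto)
  also have "\<dots> = (\<Sum>t<c. if t = g j then of_bool (j \<in> S' \<and> g j \<in> S \<and> f (g j) = i) else 0)"
    using i j by (intro sum.cong refl) (auto simp: index_map_op)
  also have "\<dots> = map_op r k (\<lambda>j. f (g j)) {j \<in> S'. g j \<in> S} $$ (i, j)"
    using assms[OF j] i j by (auto simp: index_map_op)
  finally show "(map_op r c f S * map_op c k g S') $$ (i, j) = map_op r k (\<lambda>j. f (g j)) {j \<in> S'. g j \<in> S} $$ (i, j)" .
qed (auto simp: map_op_def)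

text \<open>Outcome \<open>t\<close> records the label \<open>lab\<close> while the state is moved
  by \<open>f\<close>. Summed over \<open>t\<close>, the entry at \<open>(i, j)\<close> asks whether
  label and image agree, so joint injectivity of \<open>lab\<close> and \<open>f\<close> is what
  completeness requires; \<open>f\<close> alone may identify states, as a reset does.\<close>

lemma map_op_kraus:
  assumes lab: "\<And>i. i < n \<Longrightarrow> lab i < L" and f: "\<And>i. i < n \<Longrightarrow> f i < e"
    and inj: "\<And>i j. i < n \<Longrightarrow> j < n \<Longrightarrow> lab i = lab j \<Longrightarrow> f i = f j \<Longrightarrow> i = j"
  shows "kraus n e (map (\<lambda>t. map_op e n f {i. lab i = t}) [0..<L])"
proof -
  let ?X = "\<lambda>t. map_op e n f {i. lab i = t}"
  have Xc: "mat_adjoint (?X t) * ?X t \<in> carrier_mat n n" for t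
    by (rule mult_carrier_mat[OF adjoint_carrier]) (rule map_op_carrier)+
  have c: "set (map (\<lambda>t. mat_adjoint (?X t) * ?X t) [0..<L]) \<subseteq> carrier_mat n n"
    using Xc by auto
  have "mat_sum n (map (\<lambda>t. mat_adjoint (?X t) * ?X t) [0..<L]) = 1\<^sub>m n"
  proof (rule eq_matI)
    fix i j assume "i < dim_row (1\<^sub>m n :: complex mat)" "j < dim_col (1\<^sub>m n :: complex mat)"
    then have i: "i < n" and j: "j < n" by auto
    have t: "(mat_adjoint (?X t) * ?X t) $$ (i, j) = (if t = lab i then of_bool (lab i = lab j \<and> f i = f j) else 0)" for t
    proof -
      have "(mat_adjoint (?X t) * ?X t) $$ (i, j) = (\<Sum>r<e. mat_adjoint (?X t) $$ (i, r) * ?X t $$ (r, j))"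
        by (rule index_mult_sum[OF adjoint_carrier]) (use i j in auto)
      also have "\<dots> = (\<Sum>r<e. if r = f i then of_bool (lab i = t \<and> lab j = t \<and> f i = f j) else 0)"
      proof (intro sum.cong refl)
        fix r assume "r \<in> {..<e}"
        then have r: "r < e" by simp
        have "mat_adjoint (?X t) $$ (i, r) = cnj (?X t $$ (r, i))"
          by (rule index_adjoint) (use i r in \<open>auto simp: map_op_def\<close>)
        then show "mat_adjoint (?X t) $$ (i, r) * ?X t $$ (r, j) = (if r = f i then of_bool (lab i = t \<and> lab j = t \<and> f i = f j) else 0)"
          using i j r by (auto simp: index_map_op)
      qed
      finally show ?thesis using f[OF i] by auto
    qed
    have "mat_sum n (map (\<lambda>t. mat_adjoint (?X t) * ?X t) [0..<L]) $$ (i, j) =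
        (\<Sum>t<L. (mat_adjoint (?X t) * ?X t) $$ (i, j))"
      unfolding mat_sum_index[OF c i j]
      by (simp add: comp_def interv_sum_list_conv_sum_set_nat atLeast0LessThan del: index_mult_mat)
    also have "\<dots> = of_bool (lab i = lab j \<and> f i = f j)"
      unfolding t using lab[OF i] by simp
    also have "\<dots> = 1\<^sub>m n $$ (i, j)" using inj[OF i j] i j by auto
    finally show "mat_sum n (map (\<lambda>t. mat_adjoint (?X t) * ?X t) [0..<L]) $$ (i, j) = 1\<^sub>m n $$ (i, j)" .
  qed (use mat_sum_carrier[OF c] in auto)
  then show ?thesis by (auto simp: kraus_def comp_def)
qed

lemma discard_op_eq_map_op:
  assumes "k < e"
  shows "kron (1\<^sub>m n) (mat_adjoint (ket e k)) = map_op n (n * e) (\<lambda>j. j div e) {j. j mod e = k}"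
proof (rule eq_matI)
  fix i j assume "i < dim_row (map_op n (n * e) (\<lambda>j. j div e) {j. j mod e = k})"
    "j < dim_col (map_op n (n * e) (\<lambda>j. j div e) {j. j mod e = k})"
  then have i: "i < n * Suc 0" and j: "j < n * e" by (auto simp: map_op_def)
  have "mat_adjoint (ket e k) \<in> carrier_mat (Suc 0) e" by simp
  from index_kron[OF one_carrier_mat this i j]
  show "kron (1\<^sub>m n) (mat_adjoint (ket e k)) $$ (i, j) = map_op n (n * e) (\<lambda>j. j div e) {j. j mod e = k} $$ (i, j)"
    using i j div_less_of_mult[OF j] mod_less_of_mult[OF j] by (auto simp: index_map_op ket_def)
qed (auto simp: map_op_def ket_def)

lemma index_conj_by:
  assumes Y: "Y \<in> carrier_mat m n" and \<sigma>: "\<sigma> \<in> carrier_mat n n" and p: "p < m" "q < m"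
  shows "conj_by Y \<sigma> $$ (p, q) = (\<Sum>i<n. \<Sum>j<n. Y $$ (p, i) * \<sigma> $$ (i, j) * cnj (Y $$ (q, j)))"
proof -
  have "conj_by Y \<sigma> $$ (p, q) = (\<Sum>j<n. (Y * \<sigma>) $$ (p, j) * mat_adjoint Y $$ (j, q))"
    unfolding conj_by_def by (rule index_mult_sum[OF mult_carrier_mat[OF Y \<sigma>] adjoint_carrier[OF Y] p])
  also have "\<dots> = (\<Sum>j<n. \<Sum>i<n. Y $$ (p, i) * \<sigma> $$ (i, j) * cnj (Y $$ (q, j)))"
  proof (intro sum.cong refl)
    fix j assume "j \<in> {..<n}"
    then have j: "j < n" by simp
    have "mat_adjoint Y $$ (j, q) = cnj (Y $$ (q, j))"
      by (rule index_adjoint) (use j p Y in auto)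
    then show "(Y * \<sigma>) $$ (p, j) * mat_adjoint Y $$ (j, q) = (\<Sum>i<n. Y $$ (p, i) * \<sigma> $$ (i, j) * cnj (Y $$ (q, j)))"
      unfolding index_mult_sum[OF Y \<sigma> p(1) j] by (simp add: sum_distrib_right)
  qed
  also have "\<dots> = (\<Sum>i<n. \<Sum>j<n. Y $$ (p, i) * \<sigma> $$ (i, j) * cnj (Y $$ (q, j)))"
    by (rule sum.swap)
  finally show ?thesis .
qed

text \<open>The maximally entangled vector is pulled back through \<open>Y\<close>: up to
  conjugation and the factor 1/sqrt T, the sums over \<open>x\<close> are the amplitudes of the
  adjoint of \<open>Y\<close> applied to it.\<close>

lemma fidelity_conj_by:
  assumes Y: "Y \<in> carrier_mat (T * T) n" and \<sigma>: "\<sigma> \<in> carrier_mat n n"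
  shows "fidelity T (conj_by Y \<sigma>) = Re (\<Sum>i<n. \<Sum>j<n.
    (\<Sum>x<T. Y $$ (x * T + x, i)) * \<sigma> $$ (i, j) * cnj (\<Sum>x<T. Y $$ (x * T + x, j))) / real T"
proof -
  have "(\<Sum>x<T. \<Sum>y<T. conj_by Y \<sigma> $$ (x * T + x, y * T + y)) =
      (\<Sum>x<T. \<Sum>y<T. \<Sum>i<n. \<Sum>j<n. Y $$ (x * T + x, i) * \<sigma> $$ (i, j) * cnj (Y $$ (y * T + y, j)))"
    by (intro sum.cong refl index_conj_by[OF Y \<sigma>]) (auto intro: pair_index_less)
  also have "\<dots> = (\<Sum>x<T. \<Sum>i<n. \<Sum>j<n. \<Sum>y<T. Y $$ (x * T + x, i) * \<sigma> $$ (i, j) * cnj (Y $$ (y * T + y, j)))"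
    by (rule sum.cong[OF refl], rule sum_swap3)
  also have "\<dots> = (\<Sum>i<n. \<Sum>j<n. \<Sum>x<T. \<Sum>y<T. Y $$ (x * T + x, i) * \<sigma> $$ (i, j) * cnj (Y $$ (y * T + y, j)))"
    by (rule sum_swap3)
  also have "\<dots> = (\<Sum>i<n. \<Sum>j<n. (\<Sum>x<T. Y $$ (x * T + x, i)) * \<sigma> $$ (i, j) * cnj (\<Sum>x<T. Y $$ (x * T + x, j)))"
  proof -
    have "(\<Sum>x<T. f x) * s * cnj (\<Sum>y<T. g y) = (\<Sum>x<T. \<Sum>y<T. f x * s * cnj (g y))" for f g s
      by (subst sum.swap) (simp add: sum_distrib_left sum_distrib_right cnj_sum)
    then show ?thesis by (simp only:)
  qed
  finally show ?thesis by (simp only: fidelity_eq[OF conj_by_carrier[OF Y \<sigma>]])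
qed

lemma sum_quad_diag:
  fixes c :: "nat \<Rightarrow> nat \<Rightarrow> complex"
  assumes "\<And>a k b l. a < N \<Longrightarrow> k < K \<Longrightarrow> b < N \<Longrightarrow> l < K \<Longrightarrow>
    f (quad_index N K a k b l) = (if k = l then c a b else 0)"
  shows "(\<Sum>i<N * K * (N * K). f i) = of_nat K * (\<Sum>a<N. \<Sum>b<N. c a b)"
proof -
  have "(\<Sum>i<N * K * (N * K). f i) = (\<Sum>a<N. \<Sum>k<K. \<Sum>b<N. \<Sum>l<K. if k = l then c a b else 0)"
    unfolding sum_quad_index by (intro sum.cong refl assms) auto
  then show ?thesis by (simp add: sum_distrib_left)
qed

text \<open>The real part of the quadratic form of \<rho> at the 0/1 vector supported on the pairs
  that satisfy \<open>G\<close>.\<close>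

definition pair_sum :: "nat \<Rightarrow> complex mat \<Rightarrow> (nat \<Rightarrow> nat \<Rightarrow> bool) \<Rightarrow> real" where
  "pair_sum N \<rho> G = (\<Sum>a<N. \<Sum>b<N. \<Sum>a'<N. \<Sum>b'<N.
     of_bool (G a b) * of_bool (G a' b') * Re (\<rho> $$ (a * N + b, a' * N + b')))"

text \<open>\<open>G a b\<close> says that Alice's state \<open>(a, k)\<close> and Bob's state
  \<open>(b, k)\<close> both survive and land on the same basis state; by assumption this does not
  depend on \<open>k\<close>. Row and column each contribute a sum over \<open>k\<close>, one factor
  \<open>K\<close> cancels the normalisation of the auxiliary state, and 1/M comes from the target
  state.\<close>

lemma fidelity_map_op:
  assumes \<rho>: "\<rho> \<in> carrier_mat (N * N) (N * N)" and K: "0 < K"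
    and h: "\<And>i. i < N * K \<Longrightarrow> i \<in> S \<Longrightarrow> h i < M"
    and G: "\<And>a b k. a < N \<Longrightarrow> b < N \<Longrightarrow> k < K \<Longrightarrow>
      a * K + k \<in> S \<and> b * K + k \<in> S' \<and> h (a * K + k) = h' (b * K + k) \<longleftrightarrow> G a b"
  shows "fidelity M (conj_by (kron (map_op M (N * K) h S) (map_op M (N * K) h' S')) (joint_input N K \<rho>)) =
    real K / real M * pair_sum N \<rho> G"
proof -
  let ?Y = "kron (map_op M (N * K) h S) (map_op M (N * K) h' S')"
  let ?J = "joint_input N K \<rho>"
  \<comment> \<open>Unnormalised overlap of the target state with the image of basis state
    \<open>i\<close>.\<close>
  define W where "W i = (\<Sum>x<M. ?Y $$ (x * M + x, i))" for i
  have Y: "?Y \<in> carrier_mat (M * M) (N * K * (N * K))"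
    by (rule kron_carrier[OF map_op_carrier map_op_carrier])
  have W: "W (quad_index N K a k b k) = of_bool (G a b)" if i: "a < N" "k < K" "b < N" for a k b
  proof -
    have lt: "a * K + k < N * K" "b * K + k < N * K" using i by (auto intro: pair_index_less)
    have "?Y $$ (x * M + x, quad_index N K a k b k) =
        of_bool (a * K + k \<in> S \<and> h (a * K + k) = x) * of_bool (b * K + k \<in> S' \<and> h' (b * K + k) = x)"
      if x: "x < M" for x
      unfolding index_kron[OF map_op_carrier map_op_carrier pair_index_less[OF x x] pair_index_less[OF lt]]
        pair_index_div_mod[OF x] pair_index_div_mod[OF lt(2)] index_map_op[OF x lt(1)] index_map_op[OF x lt(2)] ..
    then have "W (quad_index N K a k b k) = (\<Sum>x<M. if x = h (a * K + k) then of_bool (G a b) else 0)"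
      unfolding W_def using G[OF i(1,3,2)] by (intro sum.cong refl) auto
    then show ?thesis using h[OF lt(1)] G[OF i(1,3,2)] by (cases "G a b") auto
  qed
  define \<phi> where "\<phi> a b a' b' = of_bool (G a b) * of_bool (G a' b') * \<rho> $$ (a * N + b, a' * N + b') / of_nat K" for a b a' b'
  have "(\<Sum>i<N * K * (N * K). \<Sum>j<N * K * (N * K). W i * ?J $$ (i, j) * cnj (W j)) =
      of_nat K * (\<Sum>a<N. \<Sum>b<N. of_nat K * (\<Sum>a'<N. \<Sum>b'<N. \<phi> a b a' b'))"
  proof (rule sum_quad_diag)
    fix a k b l assume i: "a < N" "k < K" "b < N" "l < K"
    have "(\<Sum>j<N * K * (N * K). W (quad_index N K a k b l) * ?J $$ (quad_index N K a k b l, j) * cnj (W j)) =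
       of_nat K * (\<Sum>a'<N. \<Sum>b'<N. if k = l then \<phi> a b a' b' else 0)"
    proof (rule sum_quad_diag)
      fix a' k' b' l' assume j: "a' < N" "k' < K" "b' < N" "l' < K"
      show "W (quad_index N K a k b l) * ?J $$ (quad_index N K a k b l, quad_index N K a' k' b' l') *
          cnj (W (quad_index N K a' k' b' l')) = (if k' = l' then if k = l then \<phi> a b a' b' else 0 else 0)"
        unfolding index_joint_input[OF \<rho> i j]
        using W[OF i(1-3)] W[OF j(1-3)] by (auto simp: \<phi>_def)
    qed
    then show "(\<Sum>j<N * K * (N * K). W (quad_index N K a k b l) * ?J $$ (quad_index N K a k b l, j) * cnj (W j)) =
       (if k = l then of_nat K * (\<Sum>a'<N. \<Sum>b'<N. \<phi> a b a' b') else 0)"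
      by simp
  qed
  also have "\<dots> = of_nat K * (\<Sum>a<N. \<Sum>b<N. \<Sum>a'<N. \<Sum>b'<N. of_bool (G a b) * of_bool (G a' b') * \<rho> $$ (a * N + b, a' * N + b'))"
    using K by (simp add: \<phi>_def sum_distrib_left)
  finally have "Re (\<Sum>i<N * K * (N * K). \<Sum>j<N * K * (N * K). W i * ?J $$ (i, j) * cnj (W j)) =
      real K * pair_sum N \<rho> G"
    by (simp add: pair_sum_def Re_sum mult.assoc)
  then show ?thesis
    unfolding fidelity_conj_by[OF Y joint_input_carrier] W_def[symmetric] by simp
qed

section \<open>Composition of local operations\<close>

text \<open>The state of a branch is represented by one pair of local operators acting on the
  original input; a further step of Alice only multiplies the first of them.\<close>

lemma apply_local_Alice_kron:
  assumes "X \<in> carrier_mat (d Alice) p" "Z \<in> carrier_mat (d Bob) q" "X' \<in> carrier_mat e (d Alice)"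
    "\<sigma> \<in> carrier_mat (p * q) (p * q)"
  shows "apply_local Alice d X' (conj_by (kron X Z) \<sigma>) = conj_by (kron (X' * X) Z) \<sigma>"
proof -
  have "kron X' (1\<^sub>m (d Bob)) * kron X Z = kron (X' * X) (1\<^sub>m (d Bob) * Z)"
    using assms by (intro kron_mult) auto
  moreover have "conj_by (kron X' (1\<^sub>m (d Bob))) (conj_by (kron X Z) \<sigma>) =
      conj_by (kron X' (1\<^sub>m (d Bob)) * kron X Z) \<sigma>"
    by (rule conj_by_mult[OF kron_carrier[OF assms(3) one_carrier_mat] kron_carrier[OF assms(1,2)] assms(4)])
  ultimately show ?thesis
    using assms(2) by (simp add: apply_local_conj_by local_op_def)
qed

lemma apply_local_Bob_kron:
  assumes "X \<in> carrier_mat (d Alice) p" "Z \<in> carrier_mat (d Bob) q" "Z' \<in> carrier_mat e (d Bob)"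
    "\<sigma> \<in> carrier_mat (p * q) (p * q)"
  shows "apply_local Bob d Z' (conj_by (kron X Z) \<sigma>) = conj_by (kron X (Z' * Z)) \<sigma>"
proof -
  have "kron (1\<^sub>m (d Alice)) Z' * kron X Z = kron (1\<^sub>m (d Alice) * X) (Z' * Z)"
    using assms by (intro kron_mult) auto
  moreover have "conj_by (kron (1\<^sub>m (d Alice)) Z') (conj_by (kron X Z) \<sigma>) =
      conj_by (kron (1\<^sub>m (d Alice)) Z' * kron X Z) \<sigma>"
    by (rule conj_by_mult[OF kron_carrier[OF one_carrier_mat assms(3)] kron_carrier[OF assms(1,2)] assms(4)])
  ultimately show ?thesis
    using assms(1) by (simp add: apply_local_conj_by local_op_def)
qed

section \<open>Expected fidelity after sums, measurements and discards\<close>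

lemma total_fidelity_run_zero:
  assumes "wf_gepp M d P"
  shows "total_fidelity M (run d P (0\<^sub>m (total_dim d) (total_dim d))) = 0"
  using total_fidelity_run_add[OF assms, of "0\<^sub>m (total_dim d) (total_dim d)" "0\<^sub>m (total_dim d) (total_dim d)"]
  by simp

lemma total_fidelity_run_mat_sum:
  assumes "wf_gepp M d P" "set As \<subseteq> carrier_mat (total_dim d) (total_dim d)"
  shows "total_fidelity M (run d P (mat_sum (total_dim d) As)) = (\<Sum>A\<leftarrow>As. total_fidelity M (run d P A))"
  using assms(2)
  by (induction As) (simp_all add: total_fidelity_run_zero[OF assms(1)] total_fidelity_run_add[OF assms(1)])

lemma total_fidelity_Measure:
  "total_fidelity M (run d (Measure q bs) \<sigma>) =
    (\<Sum>b\<leftarrow>bs. total_fidelity M (run d (snd b) (apply_local q d (fst b) \<sigma>)))"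
  by (simp add: total_fidelity_concat)

text \<open>By additivity of the expected fidelity, a discard may be evaluated like a measurement of
  the lost factor, one outcome at a time.\<close>

lemma total_fidelity_Discard:
  assumes "wf_gepp M d (Discard q e P)" "\<sigma> \<in> carrier_mat (total_dim d) (total_dim d)"
  shows "total_fidelity M (run d (Discard q e P) \<sigma>) =
    (\<Sum>k<e. total_fidelity M (run (d(q := d q div e)) P
       (apply_local q d (map_op (d q div e) (d q) (\<lambda>j. j div e) {j. j mod e = k}) \<sigma>)))"
proof -
  have e: "e dvd d q" and P: "wf_gepp M (d(q := d q div e)) P" using assms(1) by simp_all
  have D: "kron (1\<^sub>m (d q div e)) (mat_adjoint (ket e k)) = map_op (d q div e) (d q) (\<lambda>j. j div e) {j. j mod e = k}"
    if "k < e" for k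
    using discard_op_eq_map_op[OF that, of "d q div e"] e by simp
  show ?thesis
    unfolding run.simps discard_factor_eq
      total_fidelity_run_mat_sum[OF P discard_terms_carrier[of e d q, OF e assms(2)]]
    by (simp add: comp_def interv_sum_list_conv_sum_set_nat atLeast0LessThan D del: fun_upd_apply)
qed

section \<open>Random partitions into blocks\<close>

lemma card_residue_class:
  assumes "j < (n::nat)"
  shows "card {c. c < m * n \<and> c mod n = j} = m"
proof -
  have "{c. c < m * n \<and> c mod n = j} = (\<lambda>s. s * n + j) ` {..<m}"
  proof (intro equalityI subsetI)
    fix c assume c: "c \<in> {c. c < m * n \<and> c mod n = j}"
    then have "c = c div n * n + j" "c div n < m" using div_mult_mod_eq[of c n] div_less_of_mult[of c m n] by auto
    then show "c \<in> (\<lambda>s. s * n + j) ` {..<m}" by blast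
  qed (use assms pair_index_less[OF _ assms] in auto)
  moreover have "inj_on (\<lambda>s. s * n + j) {..<m}" using assms by (auto simp: inj_on_def)
  ultimately show ?thesis by (simp add: card_image)
qed

text \<open>Double counting of the pairs of a permutation and a second element that falls into the
  block of \<open>a\<close>. Composing with a transposition shows that the count is the same for
  every element other than \<open>a\<close>, and a fixed permutation puts exactly
  \<open>m - 1\<close> other elements into that block.\<close>

lemma card_permutations_same_block:
  fixes m n :: nat
  assumes n: "0 < n" and ab: "a < m * n" "b < m * n" "a \<noteq> b"
  shows "(m * n - 1) * card {\<pi>. \<pi> permutes {..<m * n} \<and> \<pi> a mod n = \<pi> b mod n} = fact (m * n) * (m - 1)"
proof -
  let ?A = "{\<pi>. \<pi> permutes {..<m * n}}"
  let ?c = "\<lambda>b. card {\<pi>. \<pi> permutes {..<m * n} \<and> \<pi> a mod n = \<pi> b mod n}"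
  have fin: "finite ?A" by (simp add: finite_permutations)
  have const: "?c b' = ?c b" if b': "b' < m * n" "b' \<noteq> a" for b'
  proof -
    define \<tau> where "\<tau> = transpose b b'"
    have \<tau>: "\<tau> permutes {..<m * n}" "\<tau> a = a" "\<tau> b = b'" "\<tau> b' = b" "\<tau> \<circ> \<tau> = id"
      using ab b' by (auto simp: \<tau>_def permutes_swap_id)
    have inv: "\<pi> \<circ> \<tau> \<circ> \<tau> = \<pi>" for \<pi> :: "nat \<Rightarrow> nat"
      by (simp add: comp_assoc \<tau>(5))
    have "bij_betw (\<lambda>\<pi>. \<pi> \<circ> \<tau>) {\<pi>. \<pi> permutes {..<m * n} \<and> \<pi> a mod n = \<pi> b' mod n}
       {\<pi>. \<pi> permutes {..<m * n} \<and> \<pi> a mod n = \<pi> b mod n}"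
      by (rule bij_betw_byWitness[where f' = "\<lambda>\<pi>. \<pi> \<circ> \<tau>"])
         (auto simp: inv permutes_compose[OF \<tau>(1)] \<tau>(2-4))
    then show ?thesis by (rule bij_betw_same_card)
  qed
  have block: "card {b. b < m * n \<and> b \<noteq> a \<and> \<pi> a mod n = \<pi> b mod n} = m - 1" if \<pi>: "\<pi> permutes {..<m * n}" for \<pi>
  proof -
    have "bij_betw \<pi> {b. b < m * n \<and> \<pi> a mod n = \<pi> b mod n} {c. c < m * n \<and> c mod n = \<pi> a mod n}"
    proof (rule bij_betwI')
      fix c assume c: "c \<in> {c. c < m * n \<and> c mod n = \<pi> a mod n}"
      then obtain b where "b \<in> {..<m * n}" "c = \<pi> b" using permutes_image[OF \<pi>] by blast
      then show "\<exists>b\<in>{b. b < m * n \<and> \<pi> a mod n = \<pi> b mod n}. c = \<pi> b" using c by auto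
    qed (use permutes_in_image[OF \<pi>] permutes_inj[OF \<pi>] in \<open>auto simp: inj_eq\<close>)
    then have "card {b. b < m * n \<and> \<pi> a mod n = \<pi> b mod n} = m"
      using card_residue_class[of "\<pi> a mod n" n m] n by (simp add: bij_betw_same_card)
    moreover have "{b. b < m * n \<and> b \<noteq> a \<and> \<pi> a mod n = \<pi> b mod n} =
        {b. b < m * n \<and> \<pi> a mod n = \<pi> b mod n} - {a}" by auto
    ultimately show ?thesis using ab by (simp add: card_Diff_singleton)
  qed
  have "(m * n - 1) * ?c b = (\<Sum>b'\<in>{..<m * n} - {a}. ?c b')"
  proof -
    have "(\<Sum>b'\<in>{..<m * n} - {a}. ?c b') = (\<Sum>b'\<in>{..<m * n} - {a}. ?c b)"
      by (rule sum.cong[OF refl], rule const) auto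
    then show ?thesis using ab by simp
  qed
  also have "\<dots> = (\<Sum>b'\<in>{..<m * n} - {a}. \<Sum>\<pi>\<in>?A. of_bool (\<pi> a mod n = \<pi> b' mod n))"
    using fin by (intro sum.cong refl) (simp add: sum_of_bool_eq Collect_conj_eq Int_commute)
  also have "\<dots> = (\<Sum>\<pi>\<in>?A. \<Sum>b'\<in>{..<m * n} - {a}. of_bool (\<pi> a mod n = \<pi> b' mod n))"
    by (rule sum.swap)
  also have "\<dots> = (\<Sum>\<pi>\<in>?A. m - 1)"
  proof (intro sum.cong refl)
    fix \<pi> assume "\<pi> \<in> ?A"
    moreover have "({..<m * n} - {a}) \<inter> {b. \<pi> a mod n = \<pi> b mod n} = {b. b < m * n \<and> b \<noteq> a \<and> \<pi> a mod n = \<pi> b mod n}"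
      by auto
    ultimately show "(\<Sum>b'\<in>{..<m * n} - {a}. of_bool (\<pi> a mod n = \<pi> b' mod n)) = m - 1"
      using block[of \<pi>] by (simp add: sum_of_bool_eq)
  qed
  also have "\<dots> = fact (m * n) * (m - 1)" by (simp add: card_permutations[of _ "m * n"])
  finally show ?thesis .
qed

section \<open>The optimal protocol\<close>

context
  fixes m n K :: nat
  assumes pos: "0 < m" "0 < n" "0 < K"
begin

text \<open>The basis state a of the factor of dimension \<open>m * n\<close> lies in block \<open>\<pi> a mod n\<close> at position
  \<open>\<pi> a div n\<close>. The block becomes the last tensor factor, which is the one that a protocol can discard.\<close>

definition slot :: "(nat \<Rightarrow> nat) \<Rightarrow> nat \<Rightarrow> nat" where
  "slot \<pi> i = (\<pi> (i div K) div n * K + i mod K) * n + \<pi> (i div K) mod n"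

text \<open>Reading the block and permuting the basis are done by one operator, so that the block
  register is already in the discardable position afterwards.\<close>

definition block_op :: "(nat \<Rightarrow> nat) \<Rightarrow> nat \<Rightarrow> complex mat" where
  "block_op \<pi> j = map_op (m * n * K) (m * n * K) (slot \<pi>) {i. \<pi> (i div K) mod n = j}"

text \<open>The position is the most significant digit of the index, with \<open>K * n\<close>
  values below it. The quotient is measured as \<open>s\<close>, and keeping only the remainder puts
  the position to 0.\<close>

definition reset_op :: "nat \<Rightarrow> complex mat" where
  "reset_op s = map_op (m * n * K) (m * n * K) (\<lambda>r. r mod (K * n)) {r. r div (K * n) = s}"

text \<open>The term of the partial trace over the block register in which that register has value
  \<open>y\<close>.\<close>

definition cut_op :: "nat \<Rightarrow> complex mat" where
  "cut_op y = map_op (m * K) (m * n * K) (\<lambda>j. j div n) {j. j mod n = y}"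

text \<open>The common label 0 discards all classical information. Hence the fidelity requirement
  concerns only the average over all branches, not each branch separately.\<close>

definition finish :: gepp where
  "finish = Discard Alice n (Discard Bob n (Output 0))"

definition reset :: gepp where
  "reset = Measure Alice (map (\<lambda>s. (reset_op s,
     Measure Bob (map (\<lambda>s'. (reset_op s', finish)) [0..<m]))) [0..<m])"

definition trial :: "(nat \<Rightarrow> nat) \<Rightarrow> gepp" where
  "trial \<pi> = Measure Alice (map (\<lambda>j. (block_op \<pi> j,
     Measure Bob (map (\<lambda>j'. (block_op \<pi> j', if j = j' then finish else reset)) [0..<n]))) [0..<n])"

definition uniform_trial :: "(nat \<Rightarrow> nat) list \<Rightarrow> gepp" where
  "uniform_trial \<pi>s = Random (map (\<lambda>\<pi>. (1 / real (length \<pi>s), trial \<pi>)) \<pi>s)"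

text \<open>The same index is read in two ways: with the block \<open>j\<close> split off as last
  digit for the discard, and with the position \<open>s\<close> split off as first digit for the
  reset.\<close>

lemma slot_quad:
  assumes "s < m" "k < K" "j < n"
  shows "(s * K + k) * n + j < m * n * K" "((s * K + k) * n + j) div (K * n) = s"
    "((s * K + k) * n + j) mod (K * n) = k * n + j" "s * K + k < m * K"
proof -
  have kj: "k * n + j < K * n" using assms by (intro pair_index_less)
  have eq: "(s * K + k) * n + j = s * (K * n) + (k * n + j)" by (simp add: algebra_simps)
  have "s * (K * n) + (k * n + j) < m * (K * n)" using assms(1) kj by (rule pair_index_less)
  then show "(s * K + k) * n + j < m * n * K" unfolding eq by (simp add: mult_ac)
  show "((s * K + k) * n + j) div (K * n) = s" "((s * K + k) * n + j) mod (K * n) = k * n + j"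
    unfolding eq by (rule pair_index_div_mod[OF kj])+
  show "s * K + k < m * K" using assms by (intro pair_index_less)
qed

lemma slot_facts:
  assumes \<pi>: "\<pi> permutes {..<m * n}" and i: "i < m * n * K"
  shows "slot \<pi> i < m * n * K" "slot \<pi> i div n = \<pi> (i div K) div n * K + i mod K"
    "slot \<pi> i mod n = \<pi> (i div K) mod n" "slot \<pi> i div (K * n) = \<pi> (i div K) div n"
    "slot \<pi> i mod (K * n) = i mod K * n + \<pi> (i div K) mod n" "slot \<pi> i div n < m * K"
proof -
  have "i div K < m * n" using i by (rule div_less_of_mult)
  then have "\<pi> (i div K) < m * n" using permutes_in_image[OF \<pi>, of "i div K"] by simp
  then have s: "\<pi> (i div K) div n < m" by (rule div_less_of_mult)
  have j: "\<pi> (i div K) mod n < n" and k: "i mod K < K" using pos by simp_all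
  note q = slot_quad[OF s k j]
  show "slot \<pi> i < m * n * K" "slot \<pi> i div (K * n) = \<pi> (i div K) div n"
    "slot \<pi> i mod (K * n) = i mod K * n + \<pi> (i div K) mod n"
    unfolding slot_def by (rule q)+
  show "slot \<pi> i div n = \<pi> (i div K) div n * K + i mod K" "slot \<pi> i mod n = \<pi> (i div K) mod n"
    unfolding slot_def by (rule pair_index_div_mod[OF j])+
  then show "slot \<pi> i div n < m * K" using q(4) by simp
qed

lemma block_op_kraus:
  assumes \<pi>: "\<pi> permutes {..<m * n}"
  shows "kraus (m * n * K) (m * n * K) (map (block_op \<pi>) [0..<n])"
  unfolding block_op_def
proof (rule map_op_kraus)
  fix i assume i: "i < m * n * K"
  show "\<pi> (i div K) mod n < n" using pos by simp
  show "slot \<pi> i < m * n * K" by (rule slot_facts[OF \<pi> i])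
  fix j assume j: "j < m * n * K" and eq: "slot \<pi> i = slot \<pi> j"
  have "\<pi> (i div K) = \<pi> (j div K)"
    using slot_facts(3,4)[OF \<pi> i] slot_facts(3,4)[OF \<pi> j] eq by (metis div_mult_mod_eq)
  then have d: "i div K = j div K" using permutes_inj[OF \<pi>] by (simp add: inj_eq)
  moreover have "i mod K = j mod K"
    using slot_facts(2)[OF \<pi> i] slot_facts(2)[OF \<pi> j] eq d by simp
  ultimately show "i = j" by (metis div_mult_mod_eq)
qed

lemma reset_op_kraus: "kraus (m * n * K) (m * n * K) (map reset_op [0..<m])"
  unfolding reset_op_def
proof (rule map_op_kraus)
  fix i assume i: "i < m * n * K"
  then have "i < m * (K * n)" by (simp add: mult_ac)
  then show "i div (K * n) < m" by (rule div_less_of_mult)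
  show "i mod (K * n) < m * n * K" using i by (rule le_less_trans[OF mod_less_eq_dividend])
  fix j assume "i div (K * n) = j div (K * n)" "i mod (K * n) = j mod (K * n)"
  then show "i = j" by (metis div_mult_mod_eq)
qed

lemma op_carrier [simp]:
  "block_op \<pi> j \<in> carrier_mat (m * n * K) (m * n * K)" "reset_op s \<in> carrier_mat (m * n * K) (m * n * K)"
  "cut_op y \<in> carrier_mat (m * K) (m * n * K)"
  by (simp_all add: block_op_def reset_op_def cut_op_def)

lemma dim_div: "m * n * K div n = m * K"
  using pos by (metis mult.assoc mult.commute nonzero_mult_div_cancel_left not_gr_zero)

lemma wf_finish: "wf_gepp (m * K) (\<lambda>_. m * n * K) finish"
  using pos dim_div by (simp add: finish_def)

lemma wf_reset: "wf_gepp (m * K) (\<lambda>_. m * n * K) reset"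
  using reset_op_kraus wf_finish by (auto simp: reset_def measurement_kraus comp_def)

lemma wf_trial:
  assumes "\<pi> permutes {..<m * n}"
  shows "wf_gepp (m * K) (\<lambda>_. m * n * K) (trial \<pi>)"
  using block_op_kraus[OF assms] wf_finish wf_reset by (auto simp: trial_def measurement_kraus comp_def)

lemma total_fidelity_finish:
  assumes X: "X \<in> carrier_mat (m * n * K) (m * n * K)" and Z: "Z \<in> carrier_mat (m * n * K) (m * n * K)"
    and \<sigma>: "\<sigma> \<in> carrier_mat (m * n * K * (m * n * K)) (m * n * K * (m * n * K))"
  shows "total_fidelity (m * K) (run (\<lambda>_. m * n * K) finish (conj_by (kron X Z) \<sigma>)) =
    (\<Sum>y<n. \<Sum>y'<n. fidelity (m * K) (conj_by (kron (cut_op y * X) (cut_op y' * Z)) \<sigma>))"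
proof -
  define d :: "party \<Rightarrow> nat" where "d = (\<lambda>_. m * n * K)"
  define d1 :: "party \<Rightarrow> nat" where "d1 = d(Alice := m * K)"
  have d1: "d1 Alice = m * K" "d1 Bob = m * n * K" by (simp_all add: d1_def d_def)
  have dvd: "n dvd m * n * K" by simp
  have wf1: "wf_gepp (m * K) d1 (Discard Bob n (Output 0))"
    using pos by (simp add: d1 dim_div)
  have wf0: "wf_gepp (m * K) d (Discard Alice n (Discard Bob n (Output 0)))"
    using wf_finish by (simp add: finish_def d_def)
  have c: "conj_by (kron X Z) \<sigma> \<in> carrier_mat (total_dim d) (total_dim d)"
    unfolding d_def by (rule conj_by_carrier[OF kron_carrier[OF X Z] \<sigma>])
  have "total_fidelity (m * K) (run d finish (conj_by (kron X Z) \<sigma>)) =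
    (\<Sum>y<n. total_fidelity (m * K) (run d1 (Discard Bob n (Output 0)) (apply_local Alice d (cut_op y) (conj_by (kron X Z) \<sigma>))))"
    unfolding finish_def total_fidelity_Discard[OF wf0 c]
    by (simp add: d1_def d_def cut_op_def dim_div del: run.simps fun_upd_apply)
  also have "\<dots> = (\<Sum>y<n. total_fidelity (m * K) (run d1 (Discard Bob n (Output 0)) (conj_by (kron (cut_op y * X) Z) \<sigma>)))"
  proof -
    have "apply_local Alice d (cut_op y) (conj_by (kron X Z) \<sigma>) = conj_by (kron (cut_op y * X) Z) \<sigma>" for y
      by (rule apply_local_Alice_kron[where p = "m * n * K" and q = "m * n * K" and e = "m * K"])
         (use X Z \<sigma> in \<open>auto simp: d_def\<close>)
    then show ?thesis by (simp only:)
  qed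
  also have "\<dots> = (\<Sum>y<n. \<Sum>y'<n. fidelity (m * K) (conj_by (kron (cut_op y * X) (cut_op y' * Z)) \<sigma>))"
  proof (rule sum.cong[OF refl])
    fix y
    have X': "cut_op y * X \<in> carrier_mat (m * K) (m * n * K)" by (rule mult_carrier_mat[OF op_carrier(3) X])
    have c1: "conj_by (kron (cut_op y * X) Z) \<sigma> \<in> carrier_mat (total_dim d1) (total_dim d1)"
      unfolding d1 by (rule conj_by_carrier[OF kron_carrier[OF X' Z] \<sigma>])
    have "apply_local Bob d1 (cut_op y') (conj_by (kron (cut_op y * X) Z) \<sigma>) =
        conj_by (kron (cut_op y * X) (cut_op y' * Z)) \<sigma>" for y'
      by (rule apply_local_Bob_kron[where p = "m * n * K" and q = "m * n * K" and e = "m * K"])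
         (use X' Z \<sigma> d1 in auto)
    then show "total_fidelity (m * K) (run d1 (Discard Bob n (Output 0)) (conj_by (kron (cut_op y * X) Z) \<sigma>)) =
        (\<Sum>y'<n. fidelity (m * K) (conj_by (kron (cut_op y * X) (cut_op y' * Z)) \<sigma>))"
      unfolding total_fidelity_Discard[OF wf1 c1] by (simp add: d1 dim_div cut_op_def[symmetric] total_fidelity_def)
  qed
  finally show ?thesis by (simp add: d_def)
qed

text \<open>Both parties measure with the same family of operators, and the continuation may depend
  on both outcomes. This shape covers the block measurement as well as the reset.\<close>

lemma measure_both:
  assumes X: "X \<in> carrier_mat (m * n * K) (m * n * K)" and Z: "Z \<in> carrier_mat (m * n * K) (m * n * K)"
    and \<sigma>: "\<sigma> \<in> carrier_mat (m * n * K * (m * n * K)) (m * n * K * (m * n * K))"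
    and E: "\<And>s. E s \<in> carrier_mat (m * n * K) (m * n * K)"
  shows "total_fidelity M (run (\<lambda>_. m * n * K)
      (Measure Alice (map (\<lambda>s. (E s, Measure Bob (map (\<lambda>s'. (E s', P s s')) [0..<r]))) [0..<r]))
      (conj_by (kron X Z) \<sigma>)) =
    (\<Sum>s<r. \<Sum>s'<r. total_fidelity M (run (\<lambda>_. m * n * K) (P s s') (conj_by (kron (E s * X) (E s' * Z)) \<sigma>)))"
proof -
  define d :: "party \<Rightarrow> nat" where "d = (\<lambda>_. m * n * K)"
  have A: "apply_local Alice d (E s) (conj_by (kron X Z) \<sigma>) = conj_by (kron (E s * X) Z) \<sigma>" for s
    by (rule apply_local_Alice_kron[where p = "m * n * K" and q = "m * n * K" and e = "m * n * K"])
       (use X Z \<sigma> E in \<open>auto simp: d_def\<close>)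
  have B: "apply_local Bob d (E s') (conj_by (kron (E s * X) Z) \<sigma>) = conj_by (kron (E s * X) (E s' * Z)) \<sigma>" for s s'
    by (rule apply_local_Bob_kron[where p = "m * n * K" and q = "m * n * K" and e = "m * n * K"])
       (use mult_carrier_mat[OF E X] Z \<sigma> E in \<open>auto simp: d_def\<close>)
  show ?thesis
    unfolding d_def[symmetric] total_fidelity_Measure
    by (simp add: comp_def A B total_fidelity_Measure interv_sum_list_conv_sum_set_nat atLeast0LessThan del: run.simps)
qed

lemma total_fidelity_reset:
  assumes X: "X \<in> carrier_mat (m * n * K) (m * n * K)" and Z: "Z \<in> carrier_mat (m * n * K) (m * n * K)"
    and \<sigma>: "\<sigma> \<in> carrier_mat (m * n * K * (m * n * K)) (m * n * K * (m * n * K))"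
  shows "total_fidelity (m * K) (run (\<lambda>_. m * n * K) reset (conj_by (kron X Z) \<sigma>)) =
    (\<Sum>s<m. \<Sum>s'<m. \<Sum>y<n. \<Sum>y'<n.
      fidelity (m * K) (conj_by (kron (cut_op y * (reset_op s * X)) (cut_op y' * (reset_op s' * Z))) \<sigma>))"
  unfolding reset_def measure_both[OF X Z \<sigma> op_carrier(2)]
  by (intro sum.cong refl total_fidelity_finish \<sigma>) (rule mult_carrier_mat[OF op_carrier(2)], rule X Z)+

lemma cut_block_op:
  assumes \<pi>: "\<pi> permutes {..<m * n}"
  shows "cut_op y * block_op \<pi> j = map_op (m * K) (m * n * K) (\<lambda>i. slot \<pi> i div n)
    {i \<in> {i. \<pi> (i div K) mod n = j}. slot \<pi> i \<in> {j. j mod n = y}}"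
  unfolding cut_op_def block_op_def by (rule map_op_mult) (rule slot_facts[OF \<pi>])

lemma cut_reset_block_op:
  assumes \<pi>: "\<pi> permutes {..<m * n}"
  shows "cut_op y * (reset_op s * block_op \<pi> j) = map_op (m * K) (m * n * K) (\<lambda>i. slot \<pi> i mod (K * n) div n)
    {i \<in> {i \<in> {i. \<pi> (i div K) mod n = j}. slot \<pi> i \<in> {r. r div (K * n) = s}}.
      slot \<pi> i mod (K * n) \<in> {j. j mod n = y}}"
proof -
  have "reset_op s * block_op \<pi> j = map_op (m * n * K) (m * n * K) (\<lambda>i. slot \<pi> i mod (K * n))
      {i \<in> {i. \<pi> (i div K) mod n = j}. slot \<pi> i \<in> {r. r div (K * n) = s}}"
    unfolding reset_op_def block_op_def by (rule map_op_mult) (rule slot_facts[OF \<pi>])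
  then show ?thesis unfolding cut_op_def
    by (simp only:) (rule map_op_mult, rule le_less_trans[OF mod_less_eq_dividend slot_facts(1)[OF \<pi>]])
qed

text \<open>The discarded register must show the measured block on both sides. Within one block the
  images agree exactly when the positions agree, that is, when \<open>a = b\<close> by injectivity
  of the permutation.\<close>

lemma fidelity_same_block:
  assumes \<pi>: "\<pi> permutes {..<m * n}" and \<rho>: "\<rho> \<in> carrier_mat (m * n * (m * n)) (m * n * (m * n))"
  shows "fidelity (m * K) (conj_by (kron (cut_op y * block_op \<pi> j) (cut_op y' * block_op \<pi> j)) (joint_input (m * n) K \<rho>)) =
    1 / real m * pair_sum (m * n) \<rho> (\<lambda>a b. y = j \<and> y' = j \<and> a = b \<and> \<pi> a mod n = j)"
proof -
  have "fidelity (m * K) (conj_by (kron (cut_op y * block_op \<pi> j) (cut_op y' * block_op \<pi> j)) (joint_input (m * n) K \<rho>)) =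
    real K / real (m * K) * pair_sum (m * n) \<rho> (\<lambda>a b. y = j \<and> y' = j \<and> a = b \<and> \<pi> a mod n = j)"
    unfolding cut_block_op[OF \<pi>]
  proof (rule fidelity_map_op[OF \<rho> pos(3)])
    show "slot \<pi> i div n < m * K" if "i < m * n * K" for i by (rule slot_facts(6)[OF \<pi> that])
    fix a b k assume a: "a < m * n" and b: "b < m * n" and k: "k < K"
    note A = slot_facts[OF \<pi> pair_index_less[OF a k]] and B = slot_facts[OF \<pi> pair_index_less[OF b k]]
    have "\<pi> a = \<pi> b \<longleftrightarrow> a = b" using permutes_inj[OF \<pi>] by (simp add: inj_eq)
    then have ab: "\<pi> a div n = \<pi> b div n \<and> \<pi> a mod n = \<pi> b mod n \<longleftrightarrow> a = b"
      by (metis div_mult_mod_eq)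
    show "a * K + k \<in> {i \<in> {i. \<pi> (i div K) mod n = j}. slot \<pi> i \<in> {j. j mod n = y}} \<and>
         b * K + k \<in> {i \<in> {i. \<pi> (i div K) mod n = j}. slot \<pi> i \<in> {j. j mod n = y'}} \<and>
         slot \<pi> (a * K + k) div n = slot \<pi> (b * K + k) div n \<longleftrightarrow>
         y = j \<and> y' = j \<and> a = b \<and> \<pi> a mod n = j"
      using ab pos unfolding mem_Collect_eq A B pair_index_div_mod[OF k] by auto
  qed
  then show ?thesis using pos by simp
qed

text \<open>After the reset both positions are 0, so for equal auxiliary indices the images always
  agree and only the recorded outcomes remain as conditions. The factor 1/m is the fidelity left by
  resetting the position.\<close>

lemma fidelity_other_block:
  assumes \<pi>: "\<pi> permutes {..<m * n}" and \<rho>: "\<rho> \<in> carrier_mat (m * n * (m * n)) (m * n * (m * n))"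
  shows "fidelity (m * K) (conj_by (kron (cut_op y * (reset_op s * block_op \<pi> j)) (cut_op y' * (reset_op s' * block_op \<pi> j')))
      (joint_input (m * n) K \<rho>)) =
    1 / real m * pair_sum (m * n) \<rho> (\<lambda>a b. y = j \<and> y' = j' \<and> (\<pi> a mod n = j \<and> \<pi> a div n = s) \<and> \<pi> b mod n = j' \<and> \<pi> b div n = s')"
proof -
  have "fidelity (m * K) (conj_by (kron (cut_op y * (reset_op s * block_op \<pi> j)) (cut_op y' * (reset_op s' * block_op \<pi> j')))
      (joint_input (m * n) K \<rho>)) =
    real K / real (m * K) * pair_sum (m * n) \<rho> (\<lambda>a b. y = j \<and> y' = j' \<and> (\<pi> a mod n = j \<and> \<pi> a div n = s) \<and> \<pi> b mod n = j' \<and> \<pi> b div n = s')"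
    unfolding cut_reset_block_op[OF \<pi>]
  proof (rule fidelity_map_op[OF \<rho> pos(3)])
    show "slot \<pi> i mod (K * n) div n < m * K" if "i < m * n * K" for i
      by (rule le_less_trans[OF div_le_mono[OF mod_less_eq_dividend] slot_facts(6)[OF \<pi> that]])
    fix a b k assume a: "a < m * n" and b: "b < m * n" and k: "k < K"
    note A = slot_facts[OF \<pi> pair_index_less[OF a k]] and B = slot_facts[OF \<pi> pair_index_less[OF b k]]
    have j: "\<pi> a mod n < n" "\<pi> b mod n < n" using pos by simp_all
    show "a * K + k \<in> {i \<in> {i \<in> {i. \<pi> (i div K) mod n = j}. slot \<pi> i \<in> {r. r div (K * n) = s}}.
           slot \<pi> i mod (K * n) \<in> {j. j mod n = y}} \<and>
         b * K + k \<in> {i \<in> {i \<in> {i. \<pi> (i div K) mod n = j'}. slot \<pi> i \<in> {r. r div (K * n) = s'}}.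
           slot \<pi> i mod (K * n) \<in> {j. j mod n = y'}} \<and>
         slot \<pi> (a * K + k) mod (K * n) div n = slot \<pi> (b * K + k) mod (K * n) div n \<longleftrightarrow>
         y = j \<and> y' = j' \<and> (\<pi> a mod n = j \<and> \<pi> a div n = s) \<and> \<pi> b mod n = j' \<and> \<pi> b div n = s'"
      unfolding mem_Collect_eq A B pair_index_div_mod[OF k] pair_index_div_mod[OF j(1)] pair_index_div_mod[OF j(2)]
      by auto
  qed
  then show ?thesis using pos by simp
qed


lemma total_fidelity_trial_labels:
  assumes \<pi>: "\<pi> permutes {..<m * n}" and \<rho>: "\<rho> \<in> carrier_mat (m * n * (m * n)) (m * n * (m * n))"
  shows "total_fidelity (m * K) (run (\<lambda>_. m * n * K) (trial \<pi>) (joint_input (m * n) K \<rho>)) =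
    1 / real m * (\<Sum>j<n. \<Sum>j'<n. if j = j' then pair_sum (m * n) \<rho> (\<lambda>a b. a = b \<and> \<pi> a mod n = j)
      else \<Sum>s<m. \<Sum>s'<m. pair_sum (m * n) \<rho>
        (\<lambda>a b. (\<pi> a mod n = j \<and> \<pi> a div n = s) \<and> \<pi> b mod n = j' \<and> \<pi> b div n = s'))"
proof -
  let ?\<sigma> = "joint_input (m * n) K \<rho>"
  \<comment> \<open>The initial state is written as conjugated by identities, so that it has the
    shape expected by \<open>measure_both\<close>.\<close>
  let ?I = "1\<^sub>m (m * n * K) :: complex mat"
  have I: "?I \<in> carrier_mat (m * n * K) (m * n * K)" by simp
  have B: "block_op \<pi> j * ?I = block_op \<pi> j" for j
    by (rule right_mult_one_mat[OF op_carrier(1)])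
  have RB: "reset_op s * block_op \<pi> j \<in> carrier_mat (m * n * K) (m * n * K)" for s j
    by (rule mult_carrier_mat[OF op_carrier(2,1)])
  have \<sigma>: "conj_by (kron ?I ?I) ?\<sigma> = ?\<sigma>"
    unfolding kron_one conj_by_def adjoint_one
    by (simp add: left_mult_one_mat[OF joint_input_carrier] right_mult_one_mat[OF joint_input_carrier])
  \<comment> \<open>The value of a discarded block register is already determined by the measured
    block, so only one term of each sum survives.\<close>
  have pick: "(\<Sum>y<n. \<Sum>y'<n. 1 / real m * pair_sum (m * n) \<rho> (\<lambda>a b. y = j \<and> y' = j' \<and> G a b)) =
      1 / real m * pair_sum (m * n) \<rho> G" if j: "j < n" "j' < n" for j j' G
  proof -
    have "1 / real m * pair_sum (m * n) \<rho> (\<lambda>a b. y = j \<and> y' = j' \<and> G a b) =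
        (if y' = j' then if y = j then 1 / real m * pair_sum (m * n) \<rho> G else 0 else 0)" for y y'
      by (auto simp: pair_sum_def)
    then show ?thesis using j by simp
  qed
  have "total_fidelity (m * K) (run (\<lambda>_. m * n * K) (trial \<pi>) ?\<sigma>) =
      (\<Sum>j<n. \<Sum>j'<n. total_fidelity (m * K) (run (\<lambda>_. m * n * K) (if j = j' then finish else reset)
        (conj_by (kron (block_op \<pi> j) (block_op \<pi> j')) ?\<sigma>)))"
    unfolding trial_def
    using measure_both[where E = "block_op \<pi>" and M = "m * K" and r = n and P = "\<lambda>j j'. if j = j' then finish else reset",
        OF I I joint_input_carrier op_carrier(1), of \<rho>]
    unfolding \<sigma> B .
  also have "\<dots> = (\<Sum>j<n. \<Sum>j'<n. if j = j' then 1 / real m * pair_sum (m * n) \<rho> (\<lambda>a b. a = b \<and> \<pi> a mod n = j)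
      else \<Sum>s<m. \<Sum>s'<m. 1 / real m * pair_sum (m * n) \<rho>
        (\<lambda>a b. (\<pi> a mod n = j \<and> \<pi> a div n = s) \<and> \<pi> b mod n = j' \<and> \<pi> b div n = s'))"
  proof (rule sum.cong[OF refl], rule sum.cong[OF refl])
    fix j j' assume "j \<in> {..<n}" "j' \<in> {..<n}"
    then have j: "j < n" "j' < n" by auto
    show "total_fidelity (m * K) (run (\<lambda>_. m * n * K) (if j = j' then finish else reset)
          (conj_by (kron (block_op \<pi> j) (block_op \<pi> j')) ?\<sigma>)) =
        (if j = j' then 1 / real m * pair_sum (m * n) \<rho> (\<lambda>a b. a = b \<and> \<pi> a mod n = j)
         else \<Sum>s<m. \<Sum>s'<m. 1 / real m * pair_sum (m * n) \<rho>
          (\<lambda>a b. (\<pi> a mod n = j \<and> \<pi> a div n = s) \<and> \<pi> b mod n = j' \<and> \<pi> b div n = s'))"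
    proof (cases "j = j'")
      case True
      then show ?thesis
        using total_fidelity_finish[OF op_carrier(1) op_carrier(1) joint_input_carrier, of \<pi> j \<pi> j \<rho>]
        unfolding fidelity_same_block[OF \<pi> \<rho>] pick[OF j(1) j(1)] by simp
    next
      case False
      then show ?thesis
        using total_fidelity_reset[OF op_carrier(1) op_carrier(1) joint_input_carrier, of \<pi> j \<pi> j' \<rho>]
        unfolding fidelity_other_block[OF \<pi> \<rho>] pick[OF j] by simp
    qed
  qed
  also have "\<dots> = 1 / real m * (\<Sum>j<n. \<Sum>j'<n. if j = j' then pair_sum (m * n) \<rho> (\<lambda>a b. a = b \<and> \<pi> a mod n = j)
      else \<Sum>s<m. \<Sum>s'<m. pair_sum (m * n) \<rho>
        (\<lambda>a b. (\<pi> a mod n = j \<and> \<pi> a div n = s) \<and> \<pi> b mod n = j' \<and> \<pi> b div n = s'))"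
    by (simp only: sum_distrib_left if_distrib[of "(*) (1 / real m)"])
  finally show ?thesis .
qed

end

section \<open>Summing over the outcomes of a trial\<close>

lemma sum_swap42:
  "(\<Sum>j\<in>A. \<Sum>j'\<in>B. \<Sum>s\<in>C. \<Sum>s'\<in>D. \<Sum>a\<in>E. \<Sum>b\<in>F. f j j' s s' a b) =
   (\<Sum>a\<in>E. \<Sum>b\<in>F. \<Sum>j\<in>A. \<Sum>j'\<in>B. \<Sum>s\<in>C. \<Sum>s'\<in>D. f j j' s s' a b)"
proof -
  have "(\<Sum>j\<in>A. \<Sum>j'\<in>B. \<Sum>s\<in>C. \<Sum>s'\<in>D. \<Sum>a\<in>E. \<Sum>b\<in>F. f j j' s s' a b) =
      (\<Sum>j\<in>A. \<Sum>j'\<in>B. \<Sum>s\<in>C. \<Sum>a\<in>E. \<Sum>b\<in>F. \<Sum>s'\<in>D. f j j' s s' a b)"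
    by (rule sum.cong[OF refl], rule sum.cong[OF refl], rule sum.cong[OF refl], rule sum_swap3)
  also have "\<dots> = (\<Sum>j\<in>A. \<Sum>j'\<in>B. \<Sum>a\<in>E. \<Sum>b\<in>F. \<Sum>s\<in>C. \<Sum>s'\<in>D. f j j' s s' a b)"
    by (rule sum.cong[OF refl], rule sum.cong[OF refl], rule sum_swap3)
  also have "\<dots> = (\<Sum>j\<in>A. \<Sum>a\<in>E. \<Sum>b\<in>F. \<Sum>j'\<in>B. \<Sum>s\<in>C. \<Sum>s'\<in>D. f j j' s s' a b)"
    by (rule sum.cong[OF refl], rule sum_swap3)
  finally show ?thesis by (simp only: sum_swap3[of _ _ _ A])
qed

text \<open>Agreement of the blocks leaves only the vectors |aa>. Measuring the block destroys the
  coherence between two of them unless they share a block, which is the condition left after summing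
  over \<open>j\<close>.\<close>

lemma sum_pair_sum_blocks:
  assumes n: "0 < (n::nat)"
  shows "(\<Sum>j<n. pair_sum N \<rho> (\<lambda>a b. a = b \<and> \<pi> a mod n = j)) =
    (\<Sum>a<N. \<Sum>a'<N. of_bool (\<pi> a mod n = \<pi> a' mod n) * Re (\<rho> $$ (a * N + a, a' * N + a')))"
proof -
  have "pair_sum N \<rho> (\<lambda>a b. a = b \<and> \<pi> a mod n = j) =
      (\<Sum>a<N. \<Sum>a'<N. of_bool (\<pi> a mod n = j) * of_bool (\<pi> a' mod n = j) * Re (\<rho> $$ (a * N + a, a' * N + a')))" for j
  proof -
    have "pair_sum N \<rho> (\<lambda>a b. a = b \<and> \<pi> a mod n = j) =
      (\<Sum>a<N. \<Sum>b<N. if b = a then \<Sum>a'<N. \<Sum>b'<N. if b' = a' then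
        of_bool (\<pi> a mod n = j) * of_bool (\<pi> a' mod n = j) * Re (\<rho> $$ (a * N + a, a' * N + a')) else 0 else 0)"
      unfolding pair_sum_def
    proof (rule sum.cong[OF refl], rule sum.cong[OF refl])
      fix a b
      show "(\<Sum>a'<N. \<Sum>b'<N. of_bool (a = b \<and> \<pi> a mod n = j) * of_bool (a' = b' \<and> \<pi> a' mod n = j) *
            Re (\<rho> $$ (a * N + b, a' * N + b'))) =
          (if b = a then \<Sum>a'<N. \<Sum>b'<N. if b' = a' then
            of_bool (\<pi> a mod n = j) * of_bool (\<pi> a' mod n = j) * Re (\<rho> $$ (a * N + a, a' * N + a')) else 0 else 0)"
      proof (cases "b = a")
        case True
        show ?thesis unfolding if_P[OF True]
          by (rule sum.cong[OF refl], rule sum.cong[OF refl]) (use True in auto)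
      qed simp
    qed
    then show ?thesis by simp
  qed
  then have "(\<Sum>j<n. pair_sum N \<rho> (\<lambda>a b. a = b \<and> \<pi> a mod n = j)) =
      (\<Sum>a<N. \<Sum>a'<N. \<Sum>j<n. of_bool (\<pi> a mod n = j) * of_bool (\<pi> a' mod n = j) * Re (\<rho> $$ (a * N + a, a' * N + a')))"
    by (simp only:) (rule sum_swap3)
  also have "\<dots> = (\<Sum>a<N. \<Sum>a'<N. \<Sum>j<n. if j = \<pi> a mod n then
      of_bool (\<pi> a mod n = \<pi> a' mod n) * Re (\<rho> $$ (a * N + a, a' * N + a')) else 0)"
    by (intro sum.cong refl) auto
  finally show ?thesis using n by simp
qed

text \<open>Block and position together determine the basis state, so each outcome of a reset
  selects a single pair and no coherence survives. What remains is the population of the pairs whose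
  blocks differ.\<close>

lemma sum_pair_sum_singletons:
  fixes \<pi> :: "nat \<Rightarrow> nat"
  assumes \<pi>: "inj \<pi>" and n: "0 < n" and bound: "\<And>a. a < N \<Longrightarrow> \<pi> a div n < m"
  shows "(\<Sum>j<n. \<Sum>j'<n. if j = j' then 0 else \<Sum>s<m. \<Sum>s'<m. pair_sum N \<rho>
        (\<lambda>a b. (\<pi> a mod n = j \<and> \<pi> a div n = s) \<and> \<pi> b mod n = j' \<and> \<pi> b div n = s')) =
    (\<Sum>a<N. \<Sum>b<N. of_bool (\<pi> a mod n \<noteq> \<pi> b mod n) * Re (\<rho> $$ (a * N + b, a * N + b)))"
proof -
  have uniq: "a = a'" if "\<pi> a mod n = \<pi> a' mod n" "\<pi> a div n = \<pi> a' div n" for a a'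
    using that \<pi> by (metis div_mult_mod_eq injD)
  define G where "G j j' s s' a b \<longleftrightarrow> (\<pi> a mod n = j \<and> \<pi> a div n = s) \<and> \<pi> b mod n = j' \<and> \<pi> b div n = s'" for j j' s s' a b
  have "pair_sum N \<rho> (G j j' s s') = (\<Sum>a<N. \<Sum>b<N. of_bool (G j j' s s' a b) * Re (\<rho> $$ (a * N + b, a * N + b)))" for j j' s s'
    unfolding pair_sum_def
  proof (rule sum.cong[OF refl], rule sum.cong[OF refl])
    fix a b assume ab: "a \<in> {..<N}" "b \<in> {..<N}"
    have "(\<Sum>a'<N. \<Sum>b'<N. of_bool (G j j' s s' a b) * of_bool (G j j' s s' a' b') * Re (\<rho> $$ (a * N + b, a' * N + b'))) =
        (\<Sum>a'<N. \<Sum>b'<N. if b' = b then if a' = a then of_bool (G j j' s s' a b) * Re (\<rho> $$ (a * N + b, a * N + b)) else 0 else 0)"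
    proof (rule sum.cong[OF refl], rule sum.cong[OF refl])
      fix a' b'
      have "a' = a \<and> b' = b" if "G j j' s s' a b" "G j j' s s' a' b'"
        using that unfolding G_def by (auto intro: uniq)
      then show "of_bool (G j j' s s' a b) * of_bool (G j j' s s' a' b') * Re (\<rho> $$ (a * N + b, a' * N + b')) =
          (if b' = b then if a' = a then of_bool (G j j' s s' a b) * Re (\<rho> $$ (a * N + b, a * N + b)) else 0 else 0)"
        by (cases "G j j' s s' a b"; cases "G j j' s s' a' b'") auto
    qed
    then show "(\<Sum>a'<N. \<Sum>b'<N. of_bool (G j j' s s' a b) * of_bool (G j j' s s' a' b') * Re (\<rho> $$ (a * N + b, a' * N + b'))) =
        of_bool (G j j' s s' a b) * Re (\<rho> $$ (a * N + b, a * N + b))"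
      using ab by simp
  qed
  then have "(\<Sum>j<n. \<Sum>j'<n. if j = j' then 0 else \<Sum>s<m. \<Sum>s'<m. pair_sum N \<rho> (G j j' s s')) =
      (\<Sum>j<n. \<Sum>j'<n. \<Sum>s<m. \<Sum>s'<m. \<Sum>a<N. \<Sum>b<N.
        of_bool (j \<noteq> j') * (of_bool (G j j' s s' a b) * Re (\<rho> $$ (a * N + b, a * N + b))))"
    by (intro sum.cong refl) simp
  also have "\<dots> = (\<Sum>a<N. \<Sum>b<N. \<Sum>j<n. \<Sum>j'<n. \<Sum>s<m. \<Sum>s'<m.
        of_bool (j \<noteq> j') * (of_bool (G j j' s s' a b) * Re (\<rho> $$ (a * N + b, a * N + b))))"
    by (rule sum_swap42)
  also have "\<dots> = (\<Sum>a<N. \<Sum>b<N. of_bool (\<pi> a mod n \<noteq> \<pi> b mod n) * Re (\<rho> $$ (a * N + b, a * N + b)))"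
  proof (rule sum.cong[OF refl], rule sum.cong[OF refl])
    fix a b assume "a \<in> {..<N}" "b \<in> {..<N}"
    then have lt: "\<pi> a div n < m" "\<pi> b div n < m" "\<pi> a mod n < n" "\<pi> b mod n < n"
      using bound n by auto
    \<comment> \<open>For given \<open>a\<close> and \<open>b\<close> at most one choice of the four
      outcomes fits, so the fourfold sum collapses.\<close>
    have "of_bool (j \<noteq> j') * (of_bool (G j j' s s' a b) * Re (\<rho> $$ (a * N + b, a * N + b))) =
       (if s' = \<pi> b div n then if s = \<pi> a div n then if j' = \<pi> b mod n then if j = \<pi> a mod n then
         of_bool (\<pi> a mod n \<noteq> \<pi> b mod n) * Re (\<rho> $$ (a * N + b, a * N + b)) else 0 else 0 else 0 else 0)" for j j' s s'
      by (auto simp: G_def)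
    then show "(\<Sum>j<n. \<Sum>j'<n. \<Sum>s<m. \<Sum>s'<m.
        of_bool (j \<noteq> j') * (of_bool (G j j' s s' a b) * Re (\<rho> $$ (a * N + b, a * N + b)))) =
      of_bool (\<pi> a mod n \<noteq> \<pi> b mod n) * Re (\<rho> $$ (a * N + b, a * N + b))"
      using lt by simp
  qed
  finally show ?thesis unfolding G_def .
qed

lemma total_fidelity_trial:
  assumes pos: "0 < m" "0 < n" "0 < K"
    and \<pi>: "\<pi> permutes {..<m * n}" and \<rho>: "\<rho> \<in> carrier_mat (m * n * (m * n)) (m * n * (m * n))"
    and N: "N = m * n"
  shows "total_fidelity (m * K) (run (\<lambda>_. N * K) (trial m n K \<pi>) (joint_input N K \<rho>)) =
    1 / real m * ((\<Sum>a<N. \<Sum>a'<N. of_bool (\<pi> a mod n = \<pi> a' mod n) * Re (\<rho> $$ (a * N + a, a' * N + a'))) +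
      (\<Sum>a<N. \<Sum>b<N. of_bool (\<pi> a mod n \<noteq> \<pi> b mod n) * Re (\<rho> $$ (a * N + b, a * N + b))))"
proof -
  have split: "(\<Sum>j<n. \<Sum>j'<n. if j = j' then f j else g j j') =
      (\<Sum>j<n. f j) + (\<Sum>j<n. \<Sum>j'<n. if j = j' then 0 else g j j')" for f :: "nat \<Rightarrow> real" and g
  proof -
    have "(\<Sum>j<n. \<Sum>j'<n. if j = j' then f j else g j j') =
        (\<Sum>j<n. \<Sum>j'<n. (if j' = j then f j else 0) + (if j = j' then 0 else g j j'))"
      by (intro sum.cong refl) auto
    then show ?thesis by (simp add: sum.distrib)
  qed
  have "\<pi> a div n < m" if "a < m * n" for a
    using permutes_in_image[OF \<pi>, of a] that by (simp add: div_less_of_mult)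
  note singletons = sum_pair_sum_singletons[OF permutes_inj[OF \<pi>] pos(2) this]
  show ?thesis
    unfolding N total_fidelity_trial_labels[OF pos \<pi> \<rho>]
    by (subst split, subst sum_pair_sum_blocks[OF pos(2)], subst singletons) (assumption | rule refl)+
qed

text \<open>Summing the trial over all permutations leaves an isotropic functional of \<open>\<rho>\<close>: it depends only
  on the trace and the fidelity.\<close>

lemma total_fidelity_uniform_trial:
  assumes pos: "0 < m" "0 < n" "0 < K" and N: "N = m * n" "2 \<le> N"
    and \<pi>s: "distinct \<pi>s" "set \<pi>s = {\<pi>. \<pi> permutes {..<N}}"
    and \<rho>: "\<rho> \<in> carrier_mat (N * N) (N * N)"
  defines "q \<equiv> (real m - 1) / (real N - 1)"
  shows "total_fidelity (m * K) (run (\<lambda>_. N * K) (uniform_trial m n K \<pi>s) (joint_input N K \<rho>)) =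
    1 / real m * (q * (real N * fidelity N \<rho>) + (1 - q) * Re (mtrace \<rho>))"
proof -
  let ?A = "{\<pi>. \<pi> permutes {..<N}}"
  define L where "L = real (length \<pi>s)"
  define r1 where "r1 a a' = Re (\<rho> $$ (a * N + a, a' * N + a'))" for a a'
  define r2 where "r2 a b = Re (\<rho> $$ (a * N + b, a * N + b))" for a b
  have "length \<pi>s = card ?A" using distinct_card[OF \<pi>s(1)] \<pi>s(2) by simp
  also have cA: "card ?A = fact N" by (simp add: card_permutations)
  finally have L: "L = fact N" by (simp add: L_def)
  then have L0: "L > 0" by simp
  have fin: "finite ?A" by (simp add: finite_permutations)
  \<comment> \<open>Two equal states always share a block and two distinct ones do with probability
    \<open>q\<close>. Writing this as a constant plus a diagonal correction makes the double sums
    split.\<close>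
  have avg: "(\<Sum>\<pi>\<in>?A. of_bool (\<pi> a mod n = \<pi> b mod n) / L) = q + (if b = a then 1 - q else 0)"
    if ab: "a < N" "b < N" for a b
  proof -
    have "(\<Sum>\<pi>\<in>?A. of_bool (\<pi> a mod n = \<pi> b mod n) / L) =
        real (card {\<pi>. \<pi> permutes {..<N} \<and> \<pi> a mod n = \<pi> b mod n}) / L"
      using fin by (simp add: sum_divide_distrib[symmetric] sum_of_bool_eq Collect_conj_eq Int_commute)
    also have "\<dots> = q + (if b = a then 1 - q else 0)"
    proof (cases "b = a")
      case True
      then show ?thesis using cA L0 by (simp add: L)
    next
      case False
      have "real ((m * n - 1) * card {\<pi>. \<pi> permutes {..<m * n} \<and> \<pi> a mod n = \<pi> b mod n}) = real (fact (m * n) * (m - 1))"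
        using card_permutations_same_block[OF pos(2), of a m b] ab False N by simp
      then have "(real N - 1) * real (card {\<pi>. \<pi> permutes {..<N} \<and> \<pi> a mod n = \<pi> b mod n}) = L * (real m - 1)"
        unfolding N(1)[symmetric] of_nat_mult using N(2) pos(1) by (simp add: L of_nat_diff)
      then show ?thesis using False N(2) L0 by (simp add: q_def field_simps)
    qed
    finally show ?thesis .
  qed
  have avg': "(\<Sum>\<pi>\<in>?A. of_bool (\<pi> a mod n \<noteq> \<pi> b mod n) / L) = 1 - q - (if b = a then 1 - q else 0)"
    if ab: "a < N" "b < N" for a b
  proof -
    have "(\<Sum>\<pi>\<in>?A. of_bool (\<pi> a mod n \<noteq> \<pi> b mod n) / L) =
        (\<Sum>\<pi>\<in>?A. 1 / L - of_bool (\<pi> a mod n = \<pi> b mod n) / L)"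
      by (intro sum.cong refl) auto
    also have "\<dots> = 1 - (\<Sum>\<pi>\<in>?A. of_bool (\<pi> a mod n = \<pi> b mod n) / L)"
      using cA L0 by (simp add: sum_subtractf L)
    finally show ?thesis unfolding avg[OF ab] by simp
  qed
  \<comment> \<open>The weight of a random branch scales the state; it is moved into \<rho> so that
    the formula for one trial can be used.\<close>
  have step: "total_fidelity (m * K) (run (\<lambda>_. N * K) (trial m n K \<pi>) (complex_of_real (1 / L) \<cdot>\<^sub>m joint_input N K \<rho>)) =
      1 / real m * ((\<Sum>a<N. \<Sum>a'<N. of_bool (\<pi> a mod n = \<pi> a' mod n) / L * r1 a a') +
        (\<Sum>a<N. \<Sum>b<N. of_bool (\<pi> a mod n \<noteq> \<pi> b mod n) / L * r2 a b))" if "\<pi> \<in> ?A" for \<pi>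
  proof -
    have \<pi>: "\<pi> permutes {..<m * n}" using that N by simp
    have c: "complex_of_real (1 / L) \<cdot>\<^sub>m \<rho> \<in> carrier_mat (m * n * (m * n)) (m * n * (m * n))"
      using \<rho> N by simp
    have ix: "Re ((complex_of_real (1 / L) \<cdot>\<^sub>m \<rho>) $$ (a * N + b, a' * N + b')) = Re (\<rho> $$ (a * N + b, a' * N + b')) / L"
      if "a < N" "b < N" "a' < N" "b' < N" for a b a' b'
      using \<rho> pair_index_less[OF that(1,2)] pair_index_less[OF that(3,4)] by simp
    have "(\<Sum>a<N. \<Sum>a'<N. of_bool (\<pi> a mod n = \<pi> a' mod n) * Re ((complex_of_real (1 / L) \<cdot>\<^sub>m \<rho>) $$ (a * N + a, a' * N + a'))) =
        (\<Sum>a<N. \<Sum>a'<N. of_bool (\<pi> a mod n = \<pi> a' mod n) / L * r1 a a')"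
      by (intro sum.cong refl) (simp only: ix r1_def lessThan_iff times_divide_eq_left times_divide_eq_right)
    moreover have "(\<Sum>a<N. \<Sum>b<N. of_bool (\<pi> a mod n \<noteq> \<pi> b mod n) * Re ((complex_of_real (1 / L) \<cdot>\<^sub>m \<rho>) $$ (a * N + b, a * N + b))) =
        (\<Sum>a<N. \<Sum>b<N. of_bool (\<pi> a mod n \<noteq> \<pi> b mod n) / L * r2 a b)"
      by (intro sum.cong refl) (simp only: ix r2_def lessThan_iff times_divide_eq_left times_divide_eq_right)
    ultimately show ?thesis
      unfolding joint_input_smult[OF \<rho>, symmetric] total_fidelity_trial[OF pos \<pi> c N(1)] by (simp only:)
  qed
  have "total_fidelity (m * K) (run (\<lambda>_. N * K) (uniform_trial m n K \<pi>s) (joint_input N K \<rho>)) =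
      (\<Sum>\<pi>\<leftarrow>\<pi>s. total_fidelity (m * K) (run (\<lambda>_. N * K) (trial m n K \<pi>) (complex_of_real (1 / L) \<cdot>\<^sub>m joint_input N K \<rho>)))"
    by (simp add: uniform_trial_def[OF pos] total_fidelity_concat comp_def L_def)
  also have "\<dots> = (\<Sum>\<pi>\<in>?A. total_fidelity (m * K) (run (\<lambda>_. N * K) (trial m n K \<pi>) (complex_of_real (1 / L) \<cdot>\<^sub>m joint_input N K \<rho>)))"
    using sum_list_distinct_conv_sum_set[OF \<pi>s(1)] \<pi>s(2) by simp
  also have "\<dots> = (\<Sum>\<pi>\<in>?A. 1 / real m * ((\<Sum>a<N. \<Sum>a'<N. of_bool (\<pi> a mod n = \<pi> a' mod n) / L * r1 a a') +
        (\<Sum>a<N. \<Sum>b<N. of_bool (\<pi> a mod n \<noteq> \<pi> b mod n) / L * r2 a b)))"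
    by (rule sum.cong[OF refl], rule step)
  also have "\<dots> = 1 / real m * ((\<Sum>a<N. \<Sum>a'<N. \<Sum>\<pi>\<in>?A. of_bool (\<pi> a mod n = \<pi> a' mod n) / L * r1 a a') +
        (\<Sum>a<N. \<Sum>b<N. \<Sum>\<pi>\<in>?A. of_bool (\<pi> a mod n \<noteq> \<pi> b mod n) / L * r2 a b))"
    by (simp only: sum_distrib_left[symmetric] sum.distrib sum_swap3[of _ _ _ ?A])
  also have "(\<Sum>a<N. \<Sum>a'<N. \<Sum>\<pi>\<in>?A. of_bool (\<pi> a mod n = \<pi> a' mod n) / L * r1 a a') =
      (\<Sum>a<N. \<Sum>a'<N. q * r1 a a' + (if a' = a then (1 - q) * r1 a a else 0))"
  proof (rule sum.cong[OF refl], rule sum.cong[OF refl])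
    fix a a' assume "a \<in> {..<N}" "a' \<in> {..<N}"
    then show "(\<Sum>\<pi>\<in>?A. of_bool (\<pi> a mod n = \<pi> a' mod n) / L * r1 a a') = q * r1 a a' + (if a' = a then (1 - q) * r1 a a else 0)"
      unfolding sum_distrib_right[symmetric] by (subst avg) (auto simp: distrib_right)
  qed
  also have "(\<Sum>a<N. \<Sum>b<N. \<Sum>\<pi>\<in>?A. of_bool (\<pi> a mod n \<noteq> \<pi> b mod n) / L * r2 a b) =
      (\<Sum>a<N. \<Sum>b<N. (1 - q) * r2 a b - (if b = a then (1 - q) * r1 a a else 0))"
  proof (rule sum.cong[OF refl], rule sum.cong[OF refl])
    fix a b assume "a \<in> {..<N}" "b \<in> {..<N}"
    then show "(\<Sum>\<pi>\<in>?A. of_bool (\<pi> a mod n \<noteq> \<pi> b mod n) / L * r2 a b) = (1 - q) * r2 a b - (if b = a then (1 - q) * r1 a a else 0)"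
      unfolding sum_distrib_right[symmetric] by (subst avg') (auto simp: left_diff_distrib r1_def r2_def)
  qed
  \<comment> \<open>The two diagonal corrections involve the same entries of \<rho> with opposite
    signs and cancel, so only the fidelity and the trace remain. This cancellation takes the place
    of a twirl.\<close>
  also have "(\<Sum>a<N. \<Sum>a'<N. q * r1 a a' + (if a' = a then (1 - q) * r1 a a else 0)) +
      (\<Sum>a<N. \<Sum>b<N. (1 - q) * r2 a b - (if b = a then (1 - q) * r1 a a else 0)) =
      q * (\<Sum>a<N. \<Sum>a'<N. r1 a a') + (1 - q) * (\<Sum>a<N. \<Sum>b<N. r2 a b)"
    by (simp add: sum.distrib sum_subtractf sum_distrib_left)
  also have "(\<Sum>a<N. \<Sum>a'<N. r1 a a') = real N * fidelity N \<rho>"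
    using N(2) by (simp add: fidelity_eq[OF \<rho>] r1_def Re_sum)
  also have "(\<Sum>a<N. \<Sum>b<N. r2 a b) = Re (mtrace \<rho>)"
    using \<rho> by (simp add: mtrace_def sum_lessThan_mult r2_def Re_sum)
  finally show ?thesis .
qed

lemma uniform_trial_outcome:
  assumes pos: "0 < m" "0 < n" "0 < K"
  shows "b \<in> set (run d (uniform_trial m n K \<pi>s) \<sigma>) \<Longrightarrow> fst b = Some 0"
  by (auto simp: uniform_trial_def[OF pos] trial_def[OF pos] reset_def[OF pos] finish_def[OF pos] split: if_splits)

text \<open>The output fidelity is \<open>1 - c * (1 - fidelity N \<rho>)\<close>, where
  \<open>c\<close> is the constant of the lower bound. Since \<open>c\<close> is nonnegative, the
  worst admissible input is one of fidelity exactly 1 - \<epsilon>.\<close>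

lemma absolutely_successful_uniform_trial:
  assumes pos: "0 < m" "0 < n" "0 < K" and N: "N = m * n" "2 \<le> N" and M: "M = m * K"
    and \<pi>s: "distinct \<pi>s" "set \<pi>s = {\<pi>. \<pi> permutes {..<N}}"
  shows "absolutely_successful N K M \<epsilon> ((real M - real K) / real M * (real N / (real N - 1)) * \<epsilon>) (uniform_trial m n K \<pi>s)"
  unfolding absolutely_successful_def
proof (intro conjI allI impI)
  let ?P = "uniform_trial m n K \<pi>s"
  define c where "c = (real M - real K) / real M * (real N / (real N - 1))"
  define q where "q = (real m - 1) / (real N - 1)"
  have "id \<in> set \<pi>s" unfolding \<pi>s(2) by (simp add: permutes_id)
  then have L: "length \<pi>s \<noteq> 0" by auto
  have "sum_list (map fst (map (\<lambda>\<pi>. (1 / real (length \<pi>s), trial m n K \<pi>)) \<pi>s)) = 1"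
    using L by (simp add: comp_def sum_list_triv)
  then have wf: "wf_gepp M (\<lambda>_. N * K) ?P"
    using wf_trial[OF pos] \<pi>s(2) by (auto simp: uniform_trial_def[OF pos] distribution_def N M)
  then show "is_gepp N K M ?P" by (simp add: is_gepp_def)
  \<comment> \<open>The slope of the affine function is \<open>c\<close>, and the identity
    \<open>q * (real N - 1) = real m - 1\<close> makes slope and intercept add up to 1: a perfect
    input gives a perfect output.\<close>
  have q: "q * real N / real m = c" "(1 - q) / real m = 1 - c"
  proof -
    have "(real M - real K) / real M = (real m - 1) / real m"
      using pos by (simp add: M field_simps)
    then show "q * real N / real m = c" by (simp add: c_def q_def)
    moreover have "q * (real N - 1) = real m - 1" using N(2) by (simp add: q_def)
    then have "(1 - q) / real m = 1 - q * real N / real m" using pos by (simp add: field_simps)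
    ultimately show "(1 - q) / real m = 1 - c" by simp
  qed
  have c0: "0 \<le> c" using pos N(2) by (auto simp: c_def M intro!: mult_nonneg_nonneg divide_nonneg_nonneg)
  fix \<rho> assume "density (N * N) \<rho> \<and> fidelity N \<rho> \<ge> 1 - \<epsilon>"
  then have \<rho>: "\<rho> \<in> carrier_mat (N * N) (N * N)" and tr: "mtrace \<rho> = 1" and fid: "fidelity N \<rho> \<ge> 1 - \<epsilon>"
    by (auto simp: density_def)
  define bs where "bs = branches N K ?P \<rho>"
  have out: "fst b = Some 0" if "b \<in> set bs" for b
    using uniform_trial_outcome[OF pos] that unfolding bs_def branches_def by blast
  have J: "joint_input N K \<rho> \<in> carrier_mat (N * K * (N * K)) (N * K * (N * K))" by simp
  show "prob_fail N K ?P \<rho> = 0"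
    unfolding prob_fail_def outcome_prob_def bs_def[symmetric] using out by (auto simp: filter_empty_conv cong: filter_cong)
  \<comment> \<open>All branches carry label 0, so the output state is the average of the whole run
    and its probability is the trace of the input.\<close>
  have all: "filter (\<lambda>b. fst b = Some 0) bs = bs" using out by (simp add: filter_id_conv)
  have trace: "(\<Sum>b\<leftarrow>bs. mtrace (snd b)) = 1"
    using mtrace_run[OF wf J] mtrace_joint_input[OF \<rho>, of K] pos(3) tr by (simp add: bs_def branches_def)
  have "Re (\<Sum>b\<leftarrow>xs. mtrace (snd b)) = (\<Sum>b\<leftarrow>xs. Re (mtrace (snd b)))" for xs :: "(nat option \<times> complex mat) list"
    by (induction xs) auto
  then have prob: "outcome_prob N K ?P \<rho> (Some 0) = 1"
    unfolding outcome_prob_def bs_def[symmetric] all using trace by (metis one_complex.sel(1))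
  have carr: "set (map snd bs) \<subseteq> carrier_mat (M * M) (M * M)"
  proof
    fix \<tau> assume "\<tau> \<in> set (map snd bs)"
    then obtain b where b: "b \<in> set bs" "\<tau> = snd b" by auto
    then have "(Some 0, \<tau>) \<in> set (run (\<lambda>_. N * K) ?P (joint_input N K \<rho>))"
      using out[OF b(1)] by (metis bs_def branches_def prod.collapse)
    then show "\<tau> \<in> carrier_mat (M * M) (M * M)" by (rule run_carrier[OF wf J])
  qed
  have "fidelity M (output_state N K M ?P \<rho> 0) = (\<Sum>b\<leftarrow>bs. fidelity M (snd b))"
    unfolding output_state_def bs_def[symmetric] all fidelity_smult[OF mat_sum_carrier[OF carr]] fidelity_mat_sum[OF carr] prob
    by (simp add: comp_def)
  also have "\<dots> = total_fidelity M bs"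
  proof -
    have "map (\<lambda>b. fidelity M (snd b)) bs = map (\<lambda>b. if fst b = None then 0 else fidelity M (snd b)) bs"
      by (rule map_cong[OF refl]) (simp add: out)
    then show ?thesis unfolding total_fidelity_def by (simp only:)
  qed
  also have "\<dots> = 1 / real m * (q * (real N * fidelity N \<rho>) + (1 - q) * Re (mtrace \<rho>))"
    unfolding bs_def branches_def M q_def by (rule total_fidelity_uniform_trial[OF pos N \<pi>s \<rho>])
  also have "\<dots> = (q * real N / real m) * fidelity N \<rho> + (1 - q) / real m"
    using tr by (simp add: distrib_left)
  also have "\<dots> = 1 - c * (1 - fidelity N \<rho>)" unfolding q by (simp add: algebra_simps)
  finally have "fidelity M (output_state N K M ?P \<rho> 0) = 1 - c * (1 - fidelity N \<rho>)" .
  moreover have "c * (1 - fidelity N \<rho>) \<le> c * \<epsilon>" using c0 fid by (intro mult_left_mono) auto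
  ultimately have good: "fidelity M (output_state N K M ?P \<rho> 0) \<ge> 1 - c * \<epsilon>" by simp
  have "bs \<noteq> []" using trace by auto
  have "fst ` set bs \<subseteq> {Some 0}" using out by auto
  with \<open>bs \<noteq> []\<close> have "fst ` set bs = {Some 0}" by (auto dest: subset_singletonD)
  then have "{l. Some l \<in> fst ` set bs \<and> fidelity M (output_state N K M ?P \<rho> l) \<ge> 1 - c * \<epsilon>} = {0}"
    using good by auto
  then show "prob_fidelity_ge N K M ?P \<rho> (1 - (real M - real K) / real M * (real N / (real N - 1)) * \<epsilon>) = 1"
    unfolding prob_fidelity_ge_def bs_def[symmetric] c_def[symmetric] using prob by simp
qed

lemma exists_absolutely_successful:
  assumes N: "2 \<le> N" and K: "1 \<le> K" and M: "1 \<le> M" and dvd: "M dvd N * K" "K dvd M"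
  shows "\<exists>P. absolutely_successful N K M \<epsilon> ((real M - real K) / real M * (real N / (real N - 1)) * \<epsilon>) P"
proof -
  \<comment> \<open>The block size is M/K and the number of blocks is NK/M; cancelling
    \<open>K\<close> shows that the blocks fill the basis exactly.\<close>
  obtain m where m: "M = K * m" using dvd(2) by blast
  obtain n where n: "N * K = M * n" using dvd(1) by blast
  have "N * K = m * n * K" using m n by (simp add: mult_ac)
  then have Nmn: "N = m * n" using K by simp
  then have pos: "0 < m" "0 < n" "0 < K" using N K by (auto intro: gr0I)
  obtain \<pi>s where "set \<pi>s = {\<pi>. \<pi> permutes {..<N}}" "distinct \<pi>s"
    using finite_distinct_list[OF finite_permutations[of "{..<N}"]] by auto
  then show ?thesis
    using absolutely_successful_uniform_trial[OF pos Nmn N, of M \<pi>s \<epsilon>] m by (auto simp: mult.commute)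
qed

theorem theorem1:
  shows
    "(\<forall>(N::nat) (K::nat) (M::nat) (\<epsilon>::real) (\<delta>::real) (P::gepp).
        2 \<le> N \<longrightarrow> 1 \<le> K \<longrightarrow> 1 \<le> M \<longrightarrow> 0 \<le> \<epsilon> \<longrightarrow> (K < M \<longrightarrow> \<epsilon> \<le> 1 - 1 / real N) \<longrightarrow>
        absolutely_successful N K M \<epsilon> \<delta> P \<longrightarrow>
        \<delta> \<ge> (real M - real K) / real M * (real N / (real N - 1)) * \<epsilon>)
     \<and>
     (\<forall>(N::nat) (K::nat) (M::nat) (\<epsilon>::real).
        2 \<le> N \<longrightarrow> 1 \<le> K \<longrightarrow> 1 \<le> M \<longrightarrow> M dvd N * K \<longrightarrow> K dvd M \<longrightarrow>
        (\<exists>P. absolutely_successful N K M \<epsilon>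
               ((real M - real K) / real M * (real N / (real N - 1)) * \<epsilon>) P))"
proof (intro conjI allI impI, goal_cases)
  case 1
  then show ?case by (rule delta_lower_bound)
next
  case 2
  then show ?case by (rule exists_absolutely_successful)
qed

end
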